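(* Let $M_T$ be a tree-rooted map and $w=\Xi(M_T)$ its associated parenthesis-shuffle. Then $\varphi_0(\vec M^T)=\lambda'_0(w)$ and $\varphi_1(\vec M^T)=\Theta(\lambda'_1(w))$, where $\vec M^T=\delta(M_T)$.
   Context: Maps are rooted planar maps (2-cell embeddings of connected planar graphs in the oriented sphere up to orientation-preserving homeomorphism, with a root half-edge; loops and multiple edges allowed); trees are maps with one face; tree-rooted maps $M_T$ are maps with a distinguished spanning tree $T$. The tour of a tree follows its border counterclockwise from the root to the root, ordering vertices by first visit and ordering half-edges of edges not in $T$. $\Xi(M_T)$: during the tour of $T$ write $a$ (resp. $\bar a$) the first (resp. second) time an edge of $T$ is followed and $b$ (resp. $\bar b$) the first (resp. second) time an edge not in $T$ is crossed. $\delta(M_T)$ orients edges of $T$ away from the root-vertex and each other edge so that its head is crossed before its tail in the tour (root counts as a head). Vertex explosion: each vertex $v$ is replaced by as many vertices as incident heads, each new vertex carrying one head $h$ and the tails $t$ of $v$ for which $h$ is the first head met turning counterclockwise around $v$ from $t$; result $\varphi_0$; $\varphi_1$ is the partition of the vertices of $\varphi_0$ (ordered by first visit in its tour) into classes coming from the same original vertex. A prefix-shuffle is a word on $\{a,\bar a,b,\bar b\}$ whose prefixes all have $|\cdot|_a\ge|\cdot|_{\bar a}$, $|\cdot|_b\ge|\cdot|_{\bar b}$; a parenthesis-shuffle is a prefix-shuffle with $|w|_a=|w|_{\bar a}$, $|w|_b=|w|_{\bar b}$. $\tau$ is the tree with one vertex, a root and no edge; $\sigma(T_1,T_2)$ is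 $T_2$ with a new edge added from its root-vertex, as the last edge at that vertex in tour order, to the root-vertex of $T_1$ (whose root becomes the head of this edge). $\lambda_0$: $\lambda_0(\epsilon)=u\tau v$; $\lambda_0(w'a)$ replaces the last $u$ of $\lambda_0(w')$ by $u\tau v$; $\lambda_0(w'b)$ replaces the first $v$ by $u\tau v$; $\lambda_0(w'\bar a)$ replaces the subword $T_1vT_2$ around the first $v$ by $\sigma(T_1,T_2)$; $\lambda_0(w'\bar b)$ replaces $T_1uT_2$ around the last $u$ by $\sigma(T_1,T_2)$. For a parenthesis-shuffle, $\lambda_0(w)=uTv$ and $\lambda'_0(w)=T$. Binary trees: each vertex is a node (degree 3) or leaf; around a node counterclockwise: father (or root), left son, right son; leaves are active or inactive. $B_1$: root, one node, two active leaves. $\lambda_1(\epsilon)=B_1$; $\lambda_1(w'a)$: replace the last active left leaf by $B_1$; $\lambda_1(w'b)$: replace the first active right leaf by $B_1$; $\lambda_1(w'\bar a)$: inactivate the first active right leaf; $\lambda_1(w'\bar b)$: inactivate the last active left leaf (orders by appearance in the tour). For a parenthesis-shuffle, $\lambda'_1(w)$ is $\lambda_1(w)$ with its two remaining active leaves inactivated. An edge of a binary tree is branching if one endpoint is a right son and the other a left son or the root-vertex; $\theta(B)$ contracts all non-branching edges. $\Upsilon$ maps a non-crossing partition of $\{1,\dots,m\}$ to a tree: place $1,\dots,m$ on the real line, draw each part as a connected region of the lower half-plane touching exactly its points, pairwise disjoint; take a vertex for each part and each connected component of the complement in the lower half-plane, and an edge for each boundary arc between adjacent regions; the tree is rooted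 at the vertex of the unbounded component. $\Theta(B)=\Upsilon^{-1}(\theta(B))$. *)

theory Defs
  imports
    "HOL-Combinatorics.Orbits"
    "HOL-Combinatorics.Cycles"
    "HOL-Library.Disjoint_Sets"
begin

section \<open>Rooted planar maps\<close>

text \<open>
  Maps are encoded by rotation systems. \<open>darts\<close> are the half-edges, \<open>rot\<close> sends a half-edge to the
  next one counterclockwise around its vertex, \<open>opp\<close> exchanges the two halves of an edge. The root is
  an additional dangling half-edge that marks a corner, so it is the only fixed point of \<open>opp\<close> and a
  map with \<open>n\<close> edges has \<open>2 n + 1\<close> darts. Homeomorphism classes of embeddings correspond to
  isomorphism classes of such systems; planarity is Euler's formula.
\<close>

record 'h rmap =
  darts :: "'h set"
  rot :: "'h \<Rightarrow> 'h"
  opp :: "'h \<Rightarrow> 'h"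
  root :: 'h

definition edge_darts :: "'h rmap \<Rightarrow> 'h set" where
  "edge_darts M = darts M - {root M}"

definition vertices :: "'h rmap \<Rightarrow> 'h set set" where
  "vertices M = orbit (rot M) ` darts M"

definition edges :: "'h rmap \<Rightarrow> 'h set set" where
  "edges M = (\<lambda>h. {h, opp M h}) ` edge_darts M"

definition faces :: "'h rmap \<Rightarrow> 'h set set" where
  "faces M = orbit (rot M \<circ> opp M) ` darts M"

text \<open>\<open>linked M E x y\<close>: the vertices of \<open>x\<close> and \<open>y\<close> are joined by a path whose edges lie in \<open>E\<close>
  (a set of half-edges closed under \<open>opp M\<close>).\<close>

definition linked :: "'h rmap \<Rightarrow> 'h set \<Rightarrow> 'h \<Rightarrow> 'h \<Rightarrow> bool" where
  "linked M E = rtranclp (\<lambda>x y. y = rot M x \<or> (x \<in> E \<and> y = opp M x))"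

definition rooted_map :: "'h rmap \<Rightarrow> bool" where
  "rooted_map M \<longleftrightarrow>
     finite (darts M) \<and> root M \<in> darts M \<and>
     rot M permutes darts M \<and> opp M permutes darts M \<and>
     (\<forall>h\<in>darts M. opp M (opp M h) = h) \<and>
     (\<forall>h\<in>darts M. opp M h = h \<longleftrightarrow> h = root M) \<and>
     (\<forall>h\<in>darts M. linked M (edge_darts M) (root M) h) \<and>
     card (vertices M) + card (faces M) = card (edges M) + 2"

definition rmap_iso :: "'a rmap \<Rightarrow> 'b rmap \<Rightarrow> bool" where
  "rmap_iso M N \<longleftrightarrow>
     (\<exists>f. bij_betw f (darts M) (darts N) \<and> f (root M) = root N \<and>
          (\<forall>h\<in>darts M. f (rot M h) = rot N (f h) \<and> f (opp M h) = opp N (f h)))"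

definition is_tree :: "'h rmap \<Rightarrow> bool" where
  "is_tree M \<longleftrightarrow> rooted_map M \<and> card (faces M) = 1"

text \<open>The cyclic order that \<open>f\<close> induces on \<open>A\<close>: iterate \<open>f\<close> until the first return to \<open>A\<close>.\<close>

definition induced :: "'h set \<Rightarrow> ('h \<Rightarrow> 'h) \<Rightarrow> 'h \<Rightarrow> 'h" where
  "induced A f x = (if x \<in> A then (f ^^ (LEAST n. 0 < n \<and> (f ^^ n) x \<in> A)) x else x)"

definition submap :: "'h rmap \<Rightarrow> 'h set \<Rightarrow> 'h rmap" where
  "submap M T =
     \<lparr>darts = insert (root M) T, rot = induced (insert (root M) T) (rot M),
      opp = (\<lambda>h. if h \<in> T then opp M h else h), root = root M\<rparr>"

definition spanning_tree :: "'h rmap \<Rightarrow> 'h set \<Rightarrow> bool" where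
  "spanning_tree M T \<longleftrightarrow>
     T \<subseteq> edge_darts M \<and> opp M ` T = T \<and> is_tree (submap M T) \<and>
     (\<forall>v\<in>vertices M. v \<inter> insert (root M) T \<noteq> {})"

definition tree_rooted_map :: "'h rmap \<Rightarrow> 'h set \<Rightarrow> bool" where
  "tree_rooted_map M T \<longleftrightarrow> rooted_map M \<and> spanning_tree M T"

section \<open>The tour of the tree\<close>

text \<open>
  Walking counterclockwise around \<open>T\<close> means keeping \<open>T\<close> on the left. Past a half-edge of \<open>T\<close> one
  follows its edge and reaches the counterclockwise successor of the opposite half-edge; a half-edge
  outside \<open>T\<close> is crossed, which leads to its counterclockwise successor. The tour lists the
  half-edges met from the root until the return to it.
\<close>

definition motion :: "'h rmap \<Rightarrow> 'h set \<Rightarrow> 'h \<Rightarrow> 'h" where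
  "motion M T h = rot M (if h \<in> T then opp M h else h)"

definition tour :: "'h rmap \<Rightarrow> 'h set \<Rightarrow> 'h list" where
  "tour M T = support (motion M T) (root M)"

definition precedes :: "'h rmap \<Rightarrow> 'h set \<Rightarrow> 'h \<Rightarrow> 'h \<Rightarrow> bool" where
  "precedes M T h k \<longleftrightarrow>
     (\<exists>i j. i < j \<and> j < length (tour M T) \<and> tour M T ! i = h \<and> tour M T ! j = k)"

text \<open>\<open>OpA\<close>, \<open>ClA\<close>, \<open>OpB\<close>, \<open>ClB\<close> stand for the letters a, a-bar, b, b-bar.\<close>

datatype letter = OpA | ClA | OpB | ClB

definition Xi :: "'h rmap \<Rightarrow> 'h set \<Rightarrow> letter list" where
  "Xi M T =
     (let hs = tour M T in
      map (\<lambda>i. let again = opp M (hs ! i) \<in> set (take i hs) in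
               if hs ! i \<in> T then (if again then ClA else OpA)
               else (if again then ClB else OpB))
          [1..<length hs])"

definition prefix_shuffle :: "letter list \<Rightarrow> bool" where
  "prefix_shuffle w \<longleftrightarrow>
     (\<forall>u v. w = u @ v \<longrightarrow>
        count_list u ClA \<le> count_list u OpA \<and> count_list u ClB \<le> count_list u OpB)"

definition parenthesis_shuffle :: "letter list \<Rightarrow> bool" where
  "parenthesis_shuffle w \<longleftrightarrow>
     prefix_shuffle w \<and>
     count_list w OpA = count_list w ClA \<and> count_list w OpB = count_list w ClB"

section \<open>Tree-orientation and vertex explosion\<close>

text \<open>
  An orientation is given by its set of heads, which contains the root. An edge of \<open>T\<close> points away
  from the root-vertex iff its tail is still joined to the root-vertex when the edge is deleted
  from \<open>T\<close>.
\<close>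

definition delta :: "'h rmap \<Rightarrow> 'h set \<Rightarrow> 'h set" where
  "delta M T =
     {root M} \<union>
     {h \<in> T. linked M (T - {h, opp M h}) (root M) (opp M h)} \<union>
     {h \<in> edge_darts M - T. precedes M T h (opp M h)}"

text \<open>The first head met turning counterclockwise from \<open>h\<close>; a head meets itself.\<close>

definition head_met :: "'h rmap \<Rightarrow> 'h set \<Rightarrow> 'h \<Rightarrow> 'h" where
  "head_met M H h = (rot M ^^ (LEAST n. (rot M ^^ n) h \<in> H)) h"

definition phi0 :: "'h rmap \<Rightarrow> 'h set \<Rightarrow> 'h rmap" where
  "phi0 M H =
     M\<lparr>rot := (\<lambda>h. if h \<in> darts M
                    then induced {k \<in> darts M. head_met M H k = head_met M H h} (rot M) h
                    else h)\<rparr>"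

text \<open>Position (from 1) of a vertex of the tree \<open>N\<close> in the order of first visits in its tour.\<close>

definition first_visit :: "'h rmap \<Rightarrow> 'h set \<Rightarrow> nat" where
  "first_visit N v =
     (LEAST i. i < length (tour N (edge_darts N)) \<and> tour N (edge_darts N) ! i \<in> v)"

definition vertex_rank :: "'h rmap \<Rightarrow> 'h set \<Rightarrow> nat" where
  "vertex_rank N v = card {u \<in> vertices N. first_visit N u \<le> first_visit N v}"

text \<open>The explosion keeps the half-edges, so a new vertex comes from the old one that contains it.\<close>

definition phi1 :: "'h rmap \<Rightarrow> 'h set \<Rightarrow> nat set set" where
  "phi1 M H =
     (\<lambda>v. vertex_rank (phi0 M H) ` {u \<in> vertices (phi0 M H). u \<subseteq> v}) ` vertices M"

section \<open>Plane trees as maps\<close>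

text \<open>The children of a vertex are listed in tour order, that is counterclockwise from the edge to
  the father (from the root, at the root-vertex).\<close>

datatype ptree = Node (kids: "ptree list")

text \<open>A vertex is addressed by the list of child indices on its branch, starting at the root-vertex.\<close>

primrec is_vertex :: "nat list \<Rightarrow> ptree \<Rightarrow> bool" where
  "is_vertex [] t \<longleftrightarrow> True"
| "is_vertex (i # p) t \<longleftrightarrow> i < length (kids t) \<and> is_vertex p (kids t ! i)"

primrec arity :: "nat list \<Rightarrow> ptree \<Rightarrow> nat" where
  "arity [] t = length (kids t)"
| "arity (i # p) t = arity p (kids t ! i)"

text \<open>\<open>Son p\<close> and \<open>Father p\<close> are the halves, at the vertex \<open>p\<close> and at its father respectively, of the
  edge above \<open>p\<close>; \<open>Son []\<close> is the root.\<close>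

datatype tree_dart = Son (pos: "nat list") | Father (pos: "nat list")

definition tree_darts :: "ptree \<Rightarrow> tree_dart set" where
  "tree_darts t = {Son p | p. is_vertex p t} \<union> {Father p | p. is_vertex p t \<and> p \<noteq> []}"

definition tree_rot :: "ptree \<Rightarrow> tree_dart \<Rightarrow> tree_dart" where
  "tree_rot t d =
     (case d of
        Son p \<Rightarrow> if arity p t = 0 then Son p else Father (p @ [0])
      | Father p \<Rightarrow>
          if Suc (last p) < arity (butlast p) t then Father (butlast p @ [Suc (last p)])
          else Son (butlast p))"

definition tree_opp :: "tree_dart \<Rightarrow> tree_dart" where
  "tree_opp d = (case d of Son p \<Rightarrow> if p = [] then Son p else Father p | Father p \<Rightarrow> Son p)"

definition tree_map :: "ptree \<Rightarrow> tree_dart rmap" where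
  "tree_map t =
     \<lparr>darts = tree_darts t,
      rot = (\<lambda>d. if d \<in> tree_darts t then tree_rot t d else d),
      opp = (\<lambda>d. if d \<in> tree_darts t then tree_opp d else d),
      root = Son []\<rparr>"

section \<open>The mapping \<open>\<lambda>\<^sub>0\<close>\<close>

definition tau :: ptree where
  "tau = Node []"

definition graft :: "ptree \<Rightarrow> ptree \<Rightarrow> ptree" where
  "graft t\<^sub>1 t\<^sub>2 = Node (kids t\<^sub>2 @ [t\<^sub>1])"

datatype symbol = U | V | Tree (the_tree: ptree)

definition before_first :: "'a \<Rightarrow> 'a list \<Rightarrow> 'a list" where
  "before_first x xs = takeWhile (\<lambda>y. y \<noteq> x) xs"

definition after_first :: "'a \<Rightarrow> 'a list \<Rightarrow> 'a list" where
  "after_first x xs = tl (dropWhile (\<lambda>y. y \<noteq> x) xs)"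

definition before_last :: "'a \<Rightarrow> 'a list \<Rightarrow> 'a list" where
  "before_last x xs = rev (after_first x (rev xs))"

definition after_last :: "'a \<Rightarrow> 'a list \<Rightarrow> 'a list" where
  "after_last x xs = rev (before_first x (rev xs))"

text \<open>\<open>join (xs @ [Tree t\<^sub>1]) (Tree t\<^sub>2 # ys)\<close> puts \<open>graft t\<^sub>1 t\<^sub>2\<close> between \<open>xs\<close> and \<open>ys\<close>. Both arguments
  have this shape whenever \<open>lambda0_step\<close> is used along a prefix-shuffle.\<close>

definition join :: "symbol list \<Rightarrow> symbol list \<Rightarrow> symbol list" where
  "join xs ys = butlast xs @ [Tree (graft (the_tree (last xs)) (the_tree (hd ys)))] @ tl ys"

fun lambda0_step :: "symbol list \<Rightarrow> letter \<Rightarrow> symbol list" where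
  "lambda0_step s OpA = before_last U s @ [U, Tree tau, V] @ after_last U s"
| "lambda0_step s OpB = before_first V s @ [U, Tree tau, V] @ after_first V s"
| "lambda0_step s ClA = join (before_first V s) (after_first V s)"
| "lambda0_step s ClB = join (before_last U s) (after_last U s)"

definition lambda0 :: "letter list \<Rightarrow> symbol list" where
  "lambda0 w = foldl lambda0_step [U, Tree tau, V] w"

definition lambda0' :: "letter list \<Rightarrow> ptree" where
  "lambda0' w = (THE t. lambda0 w = [U, Tree t, V])"

section \<open>The mapping \<open>\<lambda>\<^sub>1\<close>\<close>

text \<open>\<open>Leaf True\<close> is an active leaf. Vertices are addressed as in plane trees, with 0 for the left son
  and 1 for the right son.\<close>

datatype btree = Leaf bool | BNode btree btree

primrec active_leaves :: "btree \<Rightarrow> nat list list" where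
  "active_leaves (Leaf active) = (if active then [[]] else [])"
| "active_leaves (BNode l r) =
     map (Cons 0) (active_leaves l) @ map (Cons 1) (active_leaves r)"

fun replace_at :: "nat list \<Rightarrow> btree \<Rightarrow> btree \<Rightarrow> btree" where
  "replace_at [] C B = C"
| "replace_at (i # p) C (BNode l r) =
     (if i = 0 then BNode (replace_at p C l) r else BNode l (replace_at p C r))"
| "replace_at (i # p) C (Leaf s) = Leaf s"

primrec inactivate_all :: "btree \<Rightarrow> btree" where
  "inactivate_all (Leaf s) = Leaf False"
| "inactivate_all (BNode l r) = BNode (inactivate_all l) (inactivate_all r)"

definition left_son :: "nat list \<Rightarrow> bool" where
  "left_son p \<longleftrightarrow> p \<noteq> [] \<and> last p = 0"

definition right_son :: "nat list \<Rightarrow> bool" where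
  "right_son p \<longleftrightarrow> p \<noteq> [] \<and> last p = 1"

definition last_active_left :: "btree \<Rightarrow> nat list" where
  "last_active_left B = last (filter left_son (active_leaves B))"

definition first_active_right :: "btree \<Rightarrow> nat list" where
  "first_active_right B = hd (filter right_son (active_leaves B))"

definition B1 :: btree where
  "B1 = BNode (Leaf True) (Leaf True)"

fun lambda1_step :: "btree \<Rightarrow> letter \<Rightarrow> btree" where
  "lambda1_step B OpA = replace_at (last_active_left B) B1 B"
| "lambda1_step B OpB = replace_at (first_active_right B) B1 B"
| "lambda1_step B ClA = replace_at (first_active_right B) (Leaf False) B"
| "lambda1_step B ClB = replace_at (last_active_left B) (Leaf False) B"

definition lambda1 :: "letter list \<Rightarrow> btree" where
  "lambda1 w = foldl lambda1_step B1 w"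

definition lambda1' :: "letter list \<Rightarrow> btree" where
  "lambda1' w = inactivate_all (lambda1 w)"

section \<open>From binary trees to non-crossing partitions\<close>

primrec shape :: "btree \<Rightarrow> ptree" where
  "shape (Leaf s) = Node []"
| "shape (BNode l r) = Node [shape l, shape r]"

text \<open>Contracting the edges in \<open>C\<close>: around a merged vertex the next half-edge is found by turning
  counterclockwise and following the contracted edges, i.e. by the motion along \<open>C\<close>.\<close>

definition contract :: "'h rmap \<Rightarrow> 'h set \<Rightarrow> 'h rmap" where
  "contract M C =
     \<lparr>darts = darts M - C, rot = induced (darts M - C) (motion M C),
      opp = (\<lambda>h. if h \<in> C then h else opp M h), root = root M\<rparr>"

definition branching :: "nat list \<Rightarrow> nat list \<Rightarrow> bool" where
  "branching p q \<longleftrightarrow>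
     (right_son p \<and> (left_son q \<or> q = [])) \<or> (right_son q \<and> (left_son p \<or> p = []))"

definition theta :: "btree \<Rightarrow> tree_dart rmap" where
  "theta B =
     (let N = tree_map (shape B) in
      contract N {d \<in> edge_darts N. \<not> branching (pos d) (butlast (pos d))})"

definition noncrossing_partition :: "nat \<Rightarrow> nat set set \<Rightarrow> bool" where
  "noncrossing_partition m P \<longleftrightarrow>
     partition_on {1..m} P \<and>
     (\<forall>b\<in>P. \<forall>c\<in>P. \<forall>i\<in>b. \<forall>k\<in>b. \<forall>j\<in>c. \<forall>l\<in>c. i < j \<and> j < k \<and> k < l \<longrightarrow> b = c)"

definition part_of :: "nat set set \<Rightarrow> nat \<Rightarrow> nat set" where
  "part_of P i = (THE b. b \<in> P \<and> i \<in> b)"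

definition next_in :: "nat set set \<Rightarrow> nat \<Rightarrow> nat" where
  "next_in P i =
     (let b = part_of P i in if \<exists>j\<in>b. i < j then Min {j \<in> b. i < j} else Min b)"

definition prev_in :: "nat set set \<Rightarrow> nat \<Rightarrow> nat" where
  "prev_in P i =
     (let b = part_of P i in if \<exists>j\<in>b. j < i then Max {j \<in> b. j < i} else Max b)"

text \<open>
  The region of a part \<open>{i\<^sub>1 < \<dots> < i\<^sub>k}\<close> is bounded by \<open>k\<close> arcs: one from \<open>i\<^sub>j\<close> to \<open>i\<^sub>j\<^sub>+\<^sub>1\<close> for each
  \<open>j < k\<close>, and one from \<open>i\<^sub>k\<close> back to \<open>i\<^sub>1\<close> below the region. Arc \<open>i\<close> is the one leaving point \<open>i\<close>, so
  there is one edge for each point \<open>i\<close>. Its half-edge \<open>Part i\<close> is on the side of the region that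
  contains the point \<open>i\<close>, and \<open>Comp i\<close> is on the side of the component of the complement.

  The arcs around the region of a part occur counterclockwise in decreasing cyclic order of the
  leaving points. The boundary of a component of the complement, followed counterclockwise, runs
  leftwards on the real line: after arc \<open>i\<close>, which ends at \<open>j = next_in P i\<close>, comes the segment from
  \<open>j\<close> to \<open>j - 1\<close> and then arc \<open>j - 1\<close>. On the unbounded component, left of the point \<open>1\<close> it goes to
  infinity, where the root is placed, and comes back along the line from the right to the point \<open>m\<close>.
\<close>

datatype arc_dart = Inf | Part nat | Comp nat

fun arc_rot :: "nat \<Rightarrow> nat set set \<Rightarrow> arc_dart \<Rightarrow> arc_dart" where
  "arc_rot m P Inf = (if m = 0 then Inf else Comp m)"
| "arc_rot m P (Part i) = Part (prev_in P i)"
| "arc_rot m P (Comp i) = (if next_in P i = 1 then Inf else Comp (next_in P i - 1))"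

fun arc_opp :: "arc_dart \<Rightarrow> arc_dart" where
  "arc_opp Inf = Inf"
| "arc_opp (Part i) = Comp i"
| "arc_opp (Comp i) = Part i"

definition Upsilon :: "nat \<Rightarrow> nat set set \<Rightarrow> arc_dart rmap" where
  "Upsilon m P =
     (let D = {Inf} \<union> Part ` {1..m} \<union> Comp ` {1..m} in
      \<lparr>darts = D,
       rot = (\<lambda>d. if d \<in> D then arc_rot m P d else d),
       opp = (\<lambda>d. if d \<in> D then arc_opp d else d),
       root = Inf\<rparr>)"

definition Theta :: "btree \<Rightarrow> nat set set" where
  "Theta B = (THE P. \<exists>m. noncrossing_partition m P \<and> rmap_iso (Upsilon m P) (theta B))"

end

theory Submission
  imports Defs
begin

text \<open>
  Let \<open>c\<close> be the motion along \<open>T\<close>, a single cycle on the half-edges. The vertices of the map are the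
  cycles of \<open>c\<close> composed with the matching of the half-edges of \<open>T\<close>, the faces those of \<open>c\<close> composed
  with the matching of the other half-edges. A transposition adds at most one cycle, so Euler's formula
  forces both matchings to produce as many cycles as possible. Two crossing pairs turn one cycle into
  one cycle again; hence neither matching has a crossing, and the tour reads a parenthesis-shuffle.

  The heads are then the root, the half-edges of \<open>T\<close> met second and the other half-edges met first.
  Consequently the tour completes the exploded vertices with the help of two stacks: an opening letter
  suspends the current tree and starts a new one, a closing letter grafts the current and the last
  suspended tree of its kind. The stacks spell the word of \<open>\<lambda>\<^sub>0\<close>. They also spell the nodes and active
  leaves of \<open>\<lambda>\<^sub>1\<close> in inorder, every tree being replaced by the reverse of its preorder. The tour of
  \<open>\<theta>(B)\<close> visits the components of the complement in inorder of the nodes of \<open>B\<close>, and the parts of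
  \<open>\<Theta>(B)\<close> are the maximal chains of right sons; a node is made a right son exactly when it is a further
  piece of the vertex of its father.
\<close>

section \<open>Walks\<close>

text \<open>Isomorphisms are built by comparing tours. In a map whose tour along all edges visits
  every half-edge, turning from a half-edge is the motion from its opposite, so the list of the tour
  together with \<open>opp\<close> determines the map (\<open>rmap_iso_tourI\<close>); contracting
  edges merely filters the list. As \<open>Theta\<close> is a definite description, the partition
  must also be recovered uniquely from such a map (\<open>Upsilon_unique\<close>).

  The preorder is reversed because grafting appends the grafted tree to the preorder of its host,
  while on the stacks the grafted tree stands to the left of its host. With the reversal a closing
  letter only deletes one leaf mark, and the ranks read in inorder become \<open>m, ..., 1\<close>,
  the order in which the tour of \<open>Upsilon\<close> meets the arcs on the complement side.

  That a right chain stays within one vertex of the map is local; that different chains lie in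
  different vertices is not. It comes from counting: chains start at the root label or at tails of
  edges of \<open>T\<close>, and by the exact count of vertices there are as many of these as
  vertices.\<close>

fun steps :: "('a \<Rightarrow> 'a) \<Rightarrow> 'a \<Rightarrow> 'a list \<Rightarrow> 'a \<Rightarrow> bool" where
  "steps f x [] y \<longleftrightarrow> f x = y"
| "steps f x (z # zs) y \<longleftrightarrow> f x = z \<and> steps f z zs y"

lemma steps_append: "steps f x (xs @ z # ys) y \<longleftrightarrow> steps f x xs z \<and> steps f z ys y"
  by (induction xs arbitrary: x) auto

lemma steps_funpow: "steps f x xs y \<Longrightarrow> i \<le> length xs \<Longrightarrow> (f ^^ Suc i) x = (xs @ [y]) ! i"
proof (induction xs arbitrary: x i)
  case (Cons z zs)
  then show ?case
    by (cases i) (auto simp: funpow_swap1)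
qed simp

lemma steps_pow: "steps f x (map (\<lambda>i. (f ^^ Suc i) x) [0..<n]) ((f ^^ Suc n) x)"
  by (induction n) (auto simp: steps_append)

lemma steps_cong:
  assumes "steps f x xs y" "g x' = f x" "\<And>z. z \<in> set xs \<Longrightarrow> g z = f z"
  shows "steps g x' xs y"
  using assms by (induction xs arbitrary: x x') auto

lemma steps_closed: "steps f x xs y \<Longrightarrow> z \<in> insert x (set xs) \<Longrightarrow> f z \<in> insert y (set xs)"
  by (induction xs arbitrary: x) auto

lemma steps_subset_orbit: "steps f x xs y \<Longrightarrow> insert y (set xs) \<subseteq> orbit f x"
proof (induction xs arbitrary: x)
  case (Cons z zs)
  then have "insert y (set zs) \<subseteq> orbit f z" and z: "f x = z" by auto
  then show ?case
    using orbit_subset[of _ f x] by (auto simp: z intro: orbit.base orbit_eqI)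
qed (auto intro: orbit.intros)

lemma steps_orbit:
  assumes "steps f r xs r"
  shows "orbit f r = insert r (set xs)"
proof
  have "z \<in> insert r (set xs)" if "z \<in> orbit f r" for z
    using that by induction (use steps_closed[OF assms] in auto)
  then show "orbit f r \<subseteq> insert r (set xs)" by blast
qed (use steps_subset_orbit[OF assms] in auto)

lemma steps_support:
  assumes "steps f r xs r" "r \<notin> set xs"
  shows "support f r = r # xs"
proof -
  have p: "(f ^^ Suc i) r = (xs @ [r]) ! i" if "i \<le> length xs" for i
    using steps_funpow[OF assms(1) that] .
  have "least_power f r = Suc (length xs)"
    unfolding least_power_def
  proof (rule Least_equality)
    show "(f ^^ Suc (length xs)) r = r \<and> Suc (length xs) > 0"
      using p[of "length xs"] by (simp add: nth_append)
    fix n assume n: "(f ^^ n) r = r \<and> n > 0"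
    then obtain m where m: "n = Suc m" by (cases n) auto
    show "Suc (length xs) \<le> n"
    proof (rule ccontr)
      assume "\<not> ?thesis"
      then have "m < length xs" using m by simp
      then have "r = xs ! m" using p[of m] n m by (simp add: nth_append)
      then show False using \<open>m < length xs\<close> assms(2) by auto
    qed
  qed
  moreover have "map (\<lambda>i. (f ^^ Suc i) r) [0..<length xs] = xs"
    using p by (intro nth_equalityI) (auto simp: nth_append simp del: funpow.simps)
  then have "map (\<lambda>i. (f ^^ i) r) [0..<Suc (length xs)] = r # xs"
    unfolding map_upt_Suc by simp
  ultimately show ?thesis by simp
qed

lemma steps_rotate:
  assumes "steps f r xs r" "r # xs = us @ a # vs"
  shows "steps f a (vs @ us) a"
proof (cases us)
  case (Cons u us')
  with assms show ?thesis by (auto simp: steps_append)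
qed (use assms in auto)

lemma permutation_steps:
  assumes "permutation f"
  obtains xs where "steps f r xs r" "distinct (r # xs)" "set (r # xs) = orbit f r"
proof -
  define n where "n = least_power f r - 1"
  have n: "least_power f r = Suc n" "(f ^^ Suc n) r = r"
    using least_power_of_permutation[OF assms, of r] by (auto simp: n_def)
  define xs where "xs = map (\<lambda>i. (f ^^ Suc i) r) [0..<n]"
  have s: "steps f r xs r"
    using steps_pow[of f r n] n unfolding xs_def by simp
  have "support f r = r # xs"
    unfolding n(1) xs_def map_upt_Suc by simp
  then have "distinct (r # xs)"
    using cycle_of_permutation[OF assms, of r] by simp
  then show ?thesis using that[OF s] steps_orbit[OF s] by simp
qed

lemma induced_steps:
  assumes "steps f x xs y" "x \<in> A" "y \<in> A" "set xs \<inter> A = {}"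
  shows "induced A f x = y"
proof -
  have p: "(f ^^ Suc i) x = (xs @ [y]) ! i" if "i \<le> length xs" for i
    using steps_funpow[OF assms(1) that] .
  have "(LEAST n. 0 < n \<and> (f ^^ n) x \<in> A) = Suc (length xs)"
  proof (rule Least_equality)
    show "0 < Suc (length xs) \<and> (f ^^ Suc (length xs)) x \<in> A"
      using p[of "length xs"] assms(3) by (simp add: nth_append)
    fix n assume n: "0 < n \<and> (f ^^ n) x \<in> A"
    then obtain m where m: "n = Suc m" by (cases n) auto
    show "Suc (length xs) \<le> n"
    proof (rule ccontr)
      assume "\<not> ?thesis"
      then have "m < length xs" using m by simp
      then have "xs ! m \<in> A" using p[of m] n m by (simp add: nth_append)
      then show False using \<open>m < length xs\<close> assms(4) by (auto dest: nth_mem)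
    qed
  qed
  then show ?thesis
    using p[of "length xs"] assms(2) by (simp add: induced_def nth_append)
qed

text \<open>Contraction gives the rotation an \<open>induced\<close> form, so one move of the
  contracted map applies \<open>a\<close> (the \<open>opp\<close> of the map) and then follows
  \<open>f\<close> up to the first return to \<open>A\<close>. Outside \<open>A\<close> the map
  \<open>g\<close> coincides with \<open>f\<close>, so each stretch of the \<open>g\<close>-walk
  between two visits of \<open>A\<close> is a single \<open>h\<close>-step.\<close>

lemma steps_induced:
  assumes "steps g x xs y" "x \<in> A" "y \<in> A"
    and h: "\<And>x. x \<in> A \<Longrightarrow> h x = induced A f (a x)"
    and f: "\<And>x. x \<in> A \<Longrightarrow> f (a x) = g x" "\<And>x. x \<in> A \<Longrightarrow> a x \<in> A" "\<And>x. x \<notin> A \<Longrightarrow> f x = g x"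
  shows "steps h x (filter (\<lambda>z. z \<in> A) xs) y"
  using assms(1,2)
proof (induction "length xs" arbitrary: xs x rule: less_induct)
  case less
  have step: "h x = z" if "steps g x us z" "set us \<inter> A = {}" "z \<in> A" for us z
  proof -
    have "steps f (a x) us z"
      using that by (intro steps_cong[OF that(1)]) (use f less.prems in auto)
    then show ?thesis
      using induced_steps[of f "a x" us z A] that h f less.prems by auto
  qed
  show ?case
  proof (cases "set xs \<inter> A = {}")
    case True
    then have "filter (\<lambda>z. z \<in> A) xs = []" by (auto simp: filter_empty_conv)
    then show ?thesis using step[OF less.prems(1) True assms(3)] by simp
  next
    case False
    then have "\<exists>z\<in>set xs. z \<in> A" by blast
    from split_list_first_prop[OF this]
    obtain us z vs where s: "xs = us @ z # vs" "z \<in> A" "set us \<inter> A = {}" by blast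
    then have "filter (\<lambda>z. z \<in> A) us = []" by (auto simp: filter_empty_conv)
    moreover have "steps g x us z" "steps g z vs y"
      using less.prems s by (auto simp: steps_append)
    ultimately show ?thesis
      using step[of us z] s less.hyps[of vs z] by simp
  qed
qed

text \<open>If the first returns from \<open>x\<close> and \<open>y\<close> agree, cancelling the
  shorter power leads from one of the two points to the other. This would be an earlier return to
  \<open>A\<close>, unless both times are equal.\<close>

lemma induced_inj_on:
  assumes f: "permutation f"
  shows "induced A f ` A \<subseteq> A" "inj_on (induced A f) A"
proof -
  define n where "n x = (LEAST n. 0 < n \<and> (f ^^ n) x \<in> A)" for x
  have n: "0 < n x \<and> (f ^^ n x) x \<in> A" if "x \<in> A" for x
  proof -
    have "\<exists>n. 0 < n \<and> (f ^^ n) x \<in> A"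
      using least_power_of_permutation[OF f, of x] that by metis
    then show ?thesis unfolding n_def by (rule LeastI_ex)
  qed
  show "induced A f ` A \<subseteq> A" using n by (auto simp: induced_def n_def)
  have le: "x = y" if "x \<in> A" "y \<in> A" "(f ^^ n x) x = (f ^^ n y) y" "n x \<le> n y" for x y
  proof -
    have "inj f" using f by (simp add: permutation bij_is_inj)
    then have inj: "inj (f ^^ n x)" by (rule inj_fn)
    have "(f ^^ n y) y = (f ^^ n x) ((f ^^ (n y - n x)) y)"
      using that by (metis funpow_add le_add_diff_inverse o_apply)
    then have "(f ^^ (n y - n x)) y = x"
      using inj that(3) by (simp add: inj_eq)
    moreover have "\<not> (0 < n y - n x \<and> (f ^^ (n y - n x)) y \<in> A)"
      using not_less_Least[of "n y - n x" "\<lambda>n. 0 < n \<and> (f ^^ n) y \<in> A"] n[OF \<open>x \<in> A\<close>] that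
      by (fastforce simp: n_def)
    ultimately show ?thesis using that by auto
  qed
  show "inj_on (induced A f) A"
  proof (rule inj_onI)
    fix x y assume "x \<in> A" "y \<in> A" "induced A f x = induced A f y"
    then have "(f ^^ n x) x = (f ^^ n y) y" by (simp add: induced_def n_def)
    then show "x = y" using le[of x y] le[of y x] \<open>x \<in> A\<close> \<open>y \<in> A\<close> by (metis nat_le_linear)
  qed
qed

section \<open>Planarity of matchings along a cycle\<close>

lemma orbit_eq_permutation:
  assumes "permutation f" "y \<in> orbit f x"
  shows "orbit f y = orbit f x"
  using assms cyclic_on_orbit' orbit_cyclic_eq3 by metis

text \<open>A cycle of the product that avoids \<open>a\<close> and \<open>b\<close> is a cycle of
  \<open>f\<close> other than that of \<open>a\<close>. The at most two remaining cycles replace at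
  least one.\<close>

lemma card_orbits_transpose:
  assumes "f permutes D" "finite D" "a \<in> D" "b \<in> D"
  shows "card (orbit (f \<circ> transpose a b) ` D) \<le> card (orbit f ` D) + 1"
proof -
  define g where "g = f \<circ> transpose a b"
  have g: "permutation g" "permutation f"
    using assms permutation_permutes unfolding g_def
    by (blast intro: permutation_compose permutation_swap_id)+
  have "orbit g x \<in> (orbit f ` D - {orbit f a}) \<union> {orbit g a, orbit g b}" if "x \<in> D" for x
  proof (cases "a \<in> orbit g x \<or> b \<in> orbit g x")
    case True
    then show ?thesis using orbit_eq_permutation[OF g(1), of _ x] by auto
  next
    case False
    have eq: "orbit f x = orbit g x"
      using False permutation_self_in_orbit[OF g(1), of x]
      by (intro orbit_cong) (auto simp: g_def transpose_def)
    moreover have "orbit f x \<noteq> orbit f a"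
      using False eq permutation_self_in_orbit[OF g(2), of a] by auto
    ultimately show ?thesis using that by auto
  qed
  then have "orbit g ` D \<subseteq> (orbit f ` D - {orbit f a}) \<union> {orbit g a, orbit g b}" by auto
  then have "card (orbit g ` D) \<le> card ((orbit f ` D - {orbit f a}) \<union> {orbit g a, orbit g b})"
    using assms by (intro card_mono) auto
  also have "\<dots> \<le> card (orbit f ` D - {orbit f a}) + card {orbit g a, orbit g b}"
    by (rule card_Un_le)
  also have "\<dots> \<le> card (orbit f ` D - {orbit f a}) + 2"
    by (simp add: card_insert_if)
  also have "\<dots> = card (orbit f ` D) + 1"
    using assms card_Suc_Diff1[of "orbit f ` D" "orbit f a"] by simp
  finally show ?thesis unfolding g_def .
qed

definition matching :: "'a set \<Rightarrow> ('a \<Rightarrow> 'a) \<Rightarrow> bool" where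
  "matching E m \<longleftrightarrow> (\<forall>x\<in>E. m x \<in> E \<and> m x \<noteq> x \<and> m (m x) = x) \<and> (\<forall>x. x \<notin> E \<longrightarrow> m x = x)"

lemma matching_permutes: "matching E m \<Longrightarrow> m permutes E"
  by (rule bij_imp_permutes) (auto simp: matching_def intro!: bij_betw_byWitness[where f' = m])

lemma matching_remove:
  assumes "matching E m" "a \<in> E"
  shows "matching (E - {a, m a}) (m(a := a, m a := m a))"
  using assms unfolding matching_def by (auto, metis)

text \<open>A matching is a product of \<open>card E / 2\<close> disjoint transpositions, and each
  of them adds at most one cycle. Doubling avoids the division.\<close>

lemma card_orbits_matching:
  assumes "finite D" "E \<subseteq> D" "matching E m" "f permutes D"
  shows "2 * card (orbit (f \<circ> m) ` D) \<le> 2 * card (orbit f ` D) + card E"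
  using assms(2,3)
proof (induction "card E" arbitrary: E m rule: less_induct)
  case less
  have fE: "finite E" using less.prems assms(1) finite_subset by blast
  show ?case
  proof (cases "E = {}")
    case True
    then have "m = id" using less.prems by (auto simp: matching_def)
    then show ?thesis by simp
  next
    case False
    then obtain a where a: "a \<in> E" by blast
    define b where "b = m a"
    define m' where "m' = m(a := a, b := b)"
    have b: "b \<in> E" "b \<noteq> a" "m b = a" using less.prems a by (auto simp: matching_def b_def)
    have m': "matching (E - {a, b}) m'"
      using matching_remove[OF less.prems(2) a] by (simp add: m'_def b_def)
    have c: "card (E - {a, b}) = card E - 2" "2 \<le> card E"
      using a b fE card_mono[of E "{a, b}"] by (auto simp: card_Diff_subset)
    have "2 * card (orbit (f \<circ> m') ` D) \<le> 2 * card (orbit f ` D) + card (E - {a, b})"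
      using c m' less.prems by (intro less.hyps) auto
    moreover have "f \<circ> m = (f \<circ> m') \<circ> transpose a b"
      using b by (auto simp: fun_eq_iff m'_def b_def transpose_def)
    moreover have "f \<circ> m' permutes D"
      using m' less.prems
      by (intro permutes_compose assms permutes_subset[OF matching_permutes[OF m']]) auto
    then have "card (orbit ((f \<circ> m') \<circ> transpose a b) ` D) \<le> card (orbit (f \<circ> m') ` D) + 1"
      using a b less.prems assms(1) by (intro card_orbits_transpose) auto
    ultimately show ?thesis using c by simp
  qed
qed

text \<open>The hypothesis \<open>card\<close> says that the bound of
  \<open>card_orbits_matching\<close> is attained. Crossing pairs \<open>a, m a\<close> and
  \<open>x, m x\<close> only rearrange the cycle of \<open>f\<close> into another single cycle, and
  the pairs that are left are too few to reach the bound.\<close>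

lemma noncrossing_matching:
  assumes D: "finite D" "f permutes D" and E: "E \<subseteq> D" "matching E m"
    and f: "steps f r xs r" "distinct (r # xs)" "set (r # xs) = D"
    and card: "2 + card E \<le> 2 * card (orbit (f \<circ> m) ` D)"
    and s: "r # xs = us @ a # bs @ x # cs @ m a # ds @ m x # es" "a \<in> E" "x \<in> E"
  shows False
proof -
  define b y where by_def: "b = m a" "y = m x"
  have d: "distinct (us @ a # bs @ x # cs @ b # ds @ y # es)"
    using f s by (simp add: by_def)
  have m: "m a = b" "m b = a" "m x = y" "m y = x" "b \<in> E" "y \<in> E"
    using s E by (auto simp: matching_def by_def)
  have "steps f a ((bs @ x # cs @ b # ds @ y # es) @ us) a"
    using steps_rotate[OF f(1) s(1)] by (simp add: by_def)
  then have st: "steps f a bs x" "steps f x cs b" "steps f b ds y" "steps f y (es @ us) a"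
    by (auto simp: steps_append)
  have ne: "a \<noteq> b" "a \<noteq> x" "a \<noteq> y" "b \<noteq> x" "b \<noteq> y" "x \<noteq> y"
    using d by auto
  have other: "z \<noteq> a \<and> z \<noteq> b \<and> z \<noteq> x \<and> z \<noteq> y" if "z \<in> set (us @ bs @ cs @ ds @ es)" for z
    using d that by auto
  define g where "g = f \<circ> transpose a b \<circ> transpose x y"
  have g: "g a = f b" "g b = f a" "g x = f y" "g y = f x"
    "\<And>z. z \<noteq> a \<Longrightarrow> z \<noteq> b \<Longrightarrow> z \<noteq> x \<Longrightarrow> z \<noteq> y \<Longrightarrow> g z = f z"
    using ne by (simp_all add: g_def transpose_def)
  \<comment> \<open>Each stretch of the old cycle is kept, but its entry is exchanged within a pair.
    Because the pairs cross, the stretches link up in the order \<open>ds\<close>,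
    \<open>cs\<close>, \<open>bs\<close>, \<open>es @ us\<close> and close only after all
    four.\<close>
  have "steps g a ds y" by (rule steps_cong[OF st(3)]) (use g other in auto)
  moreover have "steps g y cs b" by (rule steps_cong[OF st(2)]) (use g other in auto)
  moreover have "steps g b bs x" by (rule steps_cong[OF st(1)]) (use g other in auto)
  moreover have "steps g x (es @ us) a" by (rule steps_cong[OF st(4)]) (use g other in auto)
  ultimately have "steps g a (ds @ y # cs @ b # bs @ x # es @ us) a"
    by (simp add: steps_append)
  then have "orbit g a = insert a (set (ds @ y # cs @ b # bs @ x # es @ us))"
    by (rule steps_orbit)
  also have "\<dots> = D" using f(3) s(1) by (auto simp: by_def)
  finally have oD: "orbit g a = D" .
  have gD: "g permutes D"
    unfolding g_def using D E s m
    by (intro permutes_compose permutes_swap_id) auto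
  then have "permutation g" using D by (auto simp: permutation_permutes)
  then have "orbit g ` D \<subseteq> {D}" using orbit_eq_permutation[of g _ a] oD by auto
  then have c1: "card (orbit g ` D) \<le> 1" using card_mono[of "{D}"] by fastforce
  define m' where "m' = m(a := a, b := b)"
  define m2 where "m2 = m'(x := x, y := y)"
  have "matching (E - {a, b}) m'"
    using matching_remove[OF E(2) s(2)] m by (simp add: m'_def)
  moreover have "m' x = y" using d m by (auto simp: m'_def)
  moreover have "x \<in> E - {a, b}" using d s by auto
  ultimately have m2: "matching (E - {a, b} - {x, y}) m2"
    using matching_remove[of "E - {a, b}" m' x] by (simp add: m2_def)
  have "(f \<circ> m) z = (g \<circ> m2) z" for z
  proof (cases "z \<in> {a, b, x, y}")
    case True
    then show ?thesis using ne m g by (auto simp: m2_def m'_def)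
  next
    case False
    then have "m z \<notin> {a, b, x, y}" using m E(2) unfolding matching_def
      by (metis insert_iff singletonD)
    then show ?thesis using False g by (simp add: m2_def m'_def)
  qed
  then have "f \<circ> m = g \<circ> m2" by blast
  moreover have "2 * card (orbit (g \<circ> m2) ` D) \<le> 2 * card (orbit g ` D) + card (E - {a, b} - {x, y})"
    using m2 E gD D by (intro card_orbits_matching) auto
  moreover have "card (E - {a, b} - {x, y}) < card E"
    using E D s by (intro psubset_card_mono) (auto intro: finite_subset)
  ultimately show False using c1 card by simp
qed

section \<open>The tour of a tree-rooted map\<close>

lemma matching_card_pairs:
  assumes "matching E m" "finite E"
  shows "2 * card ((\<lambda>h. {h, m h}) ` E) = card E"
proof -
  have "2 * card ((\<lambda>h. {h, m h}) ` E) = card (\<Union> ((\<lambda>h. {h, m h}) ` E))"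
  proof (rule card_partition)
    fix p q assume "p \<in> (\<lambda>h. {h, m h}) ` E" "q \<in> (\<lambda>h. {h, m h}) ` E" "p \<noteq> q"
    then show "p \<inter> q = {}" using assms(1) unfolding matching_def by (auto, metis+)
  qed (use assms in \<open>auto simp: matching_def card_insert_if\<close>)
  also have "\<Union> ((\<lambda>h. {h, m h}) ` E) = E" using assms(1) by (auto simp: matching_def)
  finally show ?thesis .
qed

lemma split_list2:
  assumes "x \<in> set xs" "y \<in> set xs" "x \<noteq> y"
  shows "(\<exists>us vs ws. xs = us @ x # vs @ y # ws) \<or> (\<exists>us vs ws. xs = us @ y # vs @ x # ws)"
proof -
  obtain us vs where s: "xs = us @ x # vs" using split_list[OF assms(1)] by blast
  then have "y \<in> set us \<or> y \<in> set vs" using assms by auto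
  then show ?thesis
  proof
    assume "y \<in> set us"
    then obtain a b where "us = a @ y # b" using split_list by fast
    then have "xs = a @ y # b @ x # vs" using s by simp
    then show ?thesis by blast
  next
    assume "y \<in> set vs"
    then obtain a b where "vs = a @ y # b" using split_list by fast
    then have "xs = us @ x # a @ y # b" using s by simp
    then show ?thesis by blast
  qed
qed

section \<open>Vertices and faces expressed through the motion\<close>

locale tree_rooted =
  fixes M :: "'h rmap" and T :: "'h set"
  assumes tree_rooted: "tree_rooted_map M T"
begin

abbreviation "D \<equiv> darts M"
abbreviation "r \<equiv> root M"
abbreviation "\<sigma> \<equiv> rot M"
abbreviation "\<alpha> \<equiv> opp M"
abbreviation "c \<equiv> motion M T"
abbreviation "H \<equiv> delta M T"

definition B :: "'h set" where "B = edge_darts M - T"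
definition along :: "'h \<Rightarrow> 'h" where "along x = (if x \<in> T then \<alpha> x else x)"
definition across :: "'h \<Rightarrow> 'h" where "across x = (if x \<in> B then \<alpha> x else x)"

lemma map_facts:
  shows finite_D: "finite D" and root_D: "r \<in> D" and rot_permutes: "\<sigma> permutes D"
    and opp_permutes: "\<alpha> permutes D" and euler: "card (vertices M) + card (faces M) = card (edges M) + 2"
  using tree_rooted unfolding tree_rooted_map_def rooted_map_def by auto

lemma opp_opp [simp]: "x \<in> D \<Longrightarrow> \<alpha> (\<alpha> x) = x"
  and opp_fixed: "x \<in> D \<Longrightarrow> \<alpha> x = x \<longleftrightarrow> x = r"
  using tree_rooted unfolding tree_rooted_map_def rooted_map_def by auto

lemma opp_in_D [simp]: "\<alpha> x \<in> D \<longleftrightarrow> x \<in> D" and rot_in_D [simp]: "\<sigma> x \<in> D \<longleftrightarrow> x \<in> D"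
  using opp_permutes rot_permutes by (auto simp: permutes_in_image)

lemma T_subset: "T \<subseteq> D - {r}" and opp_image_T: "\<alpha> ` T = T" and tree: "is_tree (submap M T)"
  and spanning: "v \<in> vertices M \<Longrightarrow> v \<inter> insert r T \<noteq> {}"
  using tree_rooted unfolding tree_rooted_map_def spanning_tree_def edge_darts_def by auto

lemma opp_root [simp]: "\<alpha> r = r"
  using opp_fixed root_D by blast

lemma matching_T: "matching T along"
  using T_subset opp_image_T opp_fixed unfolding matching_def along_def by auto

lemma opp_T: "x \<in> T \<Longrightarrow> \<alpha> x \<in> T"
  using opp_image_T by blast

lemma opp_B: "x \<in> B \<Longrightarrow> \<alpha> x \<in> B"
  using opp_T[of "\<alpha> x"] opp_opp[of x] opp_fixed[of x] opp_fixed[of "\<alpha> x"] by (auto simp: B_def edge_darts_def)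

lemma B_subset: "B \<subseteq> D - {r}"
  by (auto simp: B_def edge_darts_def)

lemma T_B: "T \<inter> B = {}" "T \<union> B = D - {r}"
  using T_subset by (auto simp: B_def edge_darts_def)

lemma matching_B: "matching B across"
  using B_subset opp_B opp_fixed unfolding matching_def across_def by auto

lemma motion_along: "c x = \<sigma> (along x)"
  by (simp add: motion_def along_def)

lemma rot_eq: "\<sigma> = c \<circ> along"
  using matching_T by (auto simp: fun_eq_iff motion_along matching_def) (metis along_def)

text \<open>On \<open>T\<close> the motion already passes to the opposite half-edge before turning;
  on \<open>B\<close> it does not, and \<open>across\<close> supplies the exchange.\<close>

lemma face_eq: "\<sigma> \<circ> \<alpha> = c \<circ> across"
proof
  fix x
  consider "x \<in> T" | "x \<in> B" | "x = r" | "x \<notin> D" using T_B by blast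
  then show "(\<sigma> \<circ> \<alpha>) x = (c \<circ> across) x"
  proof cases
    case 4
    then have "x \<notin> T" "x \<notin> B" using T_subset B_subset by auto
    then show ?thesis using permutes_not_in[OF opp_permutes 4] by (simp add: motion_along along_def across_def)
  qed (use T_B opp_B T_subset B_subset in \<open>auto simp: motion_along along_def across_def\<close>)
qed

lemma motion_permutes: "c permutes D"
proof -
  have "c = \<sigma> \<circ> along" by (auto simp: motion_along)
  then show ?thesis
    using permutes_compose[OF permutes_subset[OF matching_permutes[OF matching_T]] rot_permutes] T_subset
    by auto
qed

section \<open>The tour is one cycle through all half-edges\<close>

lemma permutations: "permutation c" "permutation \<sigma>"
  using motion_permutes rot_permutes finite_D by (auto simp: permutation_permutes)

text \<open>The submap has a single face, so its face permutation \<open>g\<close> visits the root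
  and all of \<open>T\<close> in one cycle. Each \<open>g\<close>-step is a run of \<open>c\<close>,
  because after its first move the motion only turns around a vertex until it meets the tree
  again.\<close>

lemma orbit_motion_tree: "x \<in> insert r T \<Longrightarrow> x \<in> orbit c r"
proof -
  let ?A = "insert r T"
  let ?N = "submap M T"
  define g where "g = rot ?N \<circ> opp ?N"
  have N: "rooted_map ?N" "card (faces ?N) = 1" using tree by (auto simp: is_tree_def)
  have "rot ?N permutes ?A" "opp ?N permutes ?A" "finite ?A"
    using N(1) unfolding rooted_map_def by (auto simp: submap_def)
  then have g_perm: "g permutes ?A" "permutation g"
    unfolding g_def permutation_permutes using permutes_compose by blast+
  note perm = g_perm(2)
  have gA: "g y \<in> ?A" if "y \<in> ?A" for y using permutes_in_image[OF g_perm(1)] that by blast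
  have g: "g x \<in> orbit c x" if x: "x \<in> ?A" for x
  proof -
    define y where "y = along x"
    have y: "y \<in> ?A" using x opp_T by (auto simp: y_def along_def)
    have gx: "g x = induced ?A \<sigma> y"
      using x by (auto simp: g_def submap_def y_def along_def)
    define n where "n = (LEAST n. 0 < n \<and> (\<sigma> ^^ n) y \<in> ?A)"
    have ex: "\<exists>n. 0 < n \<and> (\<sigma> ^^ n) y \<in> ?A"
      using least_power_of_permutation[OF permutations(2), of y] y by metis
    have n: "0 < n" using LeastI_ex[OF ex] by (simp add: n_def)
    \<comment> \<open>The exponent 0 is excluded: there the two sides are \<open>x\<close> and
      \<open>along x\<close>. The first move absorbs \<open>along\<close>, and the later ones are
      plain rotations.\<close>
    have "(c ^^ m) x = (\<sigma> ^^ m) y" if "0 < m" "m \<le> n" for m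
      using that
    proof (induction m)
      case (Suc m)
      show ?case
      proof (cases "m = 0")
        case True
        then show ?thesis by (simp add: motion_along y_def)
      next
        case False
        then have "(\<sigma> ^^ m) y \<notin> ?A"
          using not_less_Least[of m "\<lambda>n. 0 < n \<and> (\<sigma> ^^ n) y \<in> ?A"] Suc.prems by (auto simp: n_def)
        then show ?thesis using Suc False by (simp add: motion_along along_def)
      qed
    qed simp
    then have "(c ^^ n) x = g x" using n gx y by (simp add: induced_def n_def)
    then show ?thesis using n unfolding orbit_altdef by (metis (mono_tags, lifting) mem_Collect_eq)
  qed
  assume x: "x \<in> ?A"
  have "orbit g x \<in> faces ?N" "orbit g r \<in> faces ?N"
    using x by (auto simp: faces_def g_def submap_def)
  then have "orbit g x = orbit g r" using N(2) by (metis card_1_singletonE singletonD)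
  then have "x \<in> orbit g r" using permutation_self_in_orbit[OF perm, of x] by simp
  moreover have "y \<in> orbit c r \<and> y \<in> ?A" if "y \<in> orbit g r" for y
    using that
  proof induction
    case base
    have "g r \<in> ?A" using gA by blast
    then show ?case using g[of r] by blast
  next
    case (step y)
    have "g y \<in> ?A" using gA step by blast
    then show ?case using g[of y] step orbit_trans[of "g y" c y r] by blast
  qed
  ultimately show ?thesis by blast
qed

text \<open>Turning around the vertex of \<open>x\<close> meets the tree, which is spanning. Up to
  that point the motion is mere rotation, so \<open>x\<close> shares its cycle with a half-edge of
  the tree.\<close>

lemma orbit_motion: "orbit c r = D"
proof
  show "orbit c r \<subseteq> D" using permutes_orbit_subset[OF motion_permutes root_D] .
  show "D \<subseteq> orbit c r"
  proof
    fix x assume "x \<in> D"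
    then have "orbit \<sigma> x \<inter> insert r T \<noteq> {}" using spanning by (auto simp: vertices_def)
    then have ex: "\<exists>n. (\<sigma> ^^ n) x \<in> insert r T" by (auto simp: orbit_altdef)
    define n where "n = (LEAST n. (\<sigma> ^^ n) x \<in> insert r T)"
    have n: "(\<sigma> ^^ n) x \<in> insert r T" using LeastI_ex[OF ex] by (simp add: n_def)
    have "(c ^^ m) x = (\<sigma> ^^ m) x" if "m \<le> n" for m
      using that
    proof (induction m)
      case (Suc m)
      then have "(\<sigma> ^^ m) x \<notin> insert r T"
        using not_less_Least[of m "\<lambda>n. (\<sigma> ^^ n) x \<in> insert r T"] by (auto simp: n_def)
      then show ?case using Suc by (simp add: motion_along along_def)
    qed simp
    then have "(c ^^ n) x \<in> orbit c r" using n orbit_motion_tree by simp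
    moreover have "(c ^^ n) x \<in> orbit c x"
      using funpow_in_orbit permutation_self_in_orbit permutations(1) by metis
    ultimately have "orbit c r = orbit c x" using orbit_eq_permutation permutations(1) by metis
    then show "x \<in> orbit c r" using permutation_self_in_orbit permutations(1) by metis
  qed
qed

section \<open>The tour as a list, Euler's formula and nesting\<close>

definition walk :: "'h list" where "walk = tl (tour M T)"

lemma tour_facts:
  shows tour_eq: "tour M T = r # walk" and walk_steps: "steps c r walk r"
    and distinct_tour: "distinct (r # walk)" and set_tour: "insert r (set walk) = D"
proof -
  obtain xs where xs: "steps c r xs r" "distinct (r # xs)" "set (r # xs) = orbit c r"
    using permutation_steps[OF permutations(1)] .
  have "tour M T = r # xs" using steps_support[OF xs(1)] xs(2) by (simp add: tour_def)
  then show "tour M T = r # walk" "steps c r walk r" "distinct (r # walk)" "insert r (set walk) = D"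
    using xs orbit_motion by (auto simp: walk_def)
qed

text \<open>Vertices number at most \<open>1 + card T / 2\<close> and faces at most
  \<open>1 + card B / 2\<close>. Since the edges number \<open>(card T + card B) / 2\<close>,
  Euler's formula demands the sum of the two bounds, so both are equalities.\<close>

lemma card_sides:
  shows card_vertices: "2 * card (vertices M) = 2 + card T"
    and card_faces: "2 * card (faces M) = 2 + card B"
proof -
  have V: "vertices M = orbit (c \<circ> along) ` D" by (simp add: vertices_def flip: rot_eq)
  have F: "faces M = orbit (c \<circ> across) ` D" by (simp add: faces_def face_eq)
  have "orbit c ` D = {D}"
  proof -
    have "orbit c x = D" if "x \<in> D" for x
      using orbit_eq_permutation[OF permutations(1), of x r] orbit_motion that by auto
    then show ?thesis using root_D by auto
  qed
  then have one: "card (orbit c ` D) = 1" by simp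
  have "2 * card (vertices M) \<le> 2 + card T" "2 * card (faces M) \<le> 2 + card B"
    using card_orbits_matching[OF finite_D _ matching_T motion_permutes]
      card_orbits_matching[OF finite_D _ matching_B motion_permutes] T_subset B_subset one V F by auto
  moreover have "2 * card (edges M) = card T + card B"
  proof -
    have "matching (edge_darts M) \<alpha>"
      using opp_fixed permutes_not_in[OF opp_permutes] unfolding matching_def edge_darts_def
      by (auto, metis opp_opp opp_root)
    then have "2 * card (edges M) = card (edge_darts M)"
      using matching_card_pairs finite_D by (fastforce simp: edges_def edge_darts_def)
    also have "edge_darts M = T \<union> B" using T_B by (auto simp: edge_darts_def)
    also have "card (T \<union> B) = card T + card B"
      using T_B finite_D T_subset B_subset by (intro card_Un_disjoint) (auto intro: finite_subset)
    finally show ?thesis .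
  qed
  ultimately show "2 * card (vertices M) = 2 + card T" "2 * card (faces M) = 2 + card B"
    using euler by auto
qed

lemma noncrossing:
  assumes "r # walk = us @ a # bs @ x # cs @ \<alpha> a # ds @ \<alpha> x # es" "E = T \<or> E = B" "a \<in> E" "x \<in> E"
  shows False
  using assms(2)
proof
  assume E: "E = T"
  show False
  proof (rule noncrossing_matching[OF finite_D motion_permutes _ matching_T walk_steps distinct_tour])
    show "2 + card T \<le> 2 * card (orbit (c \<circ> along) ` D)"
      using card_vertices by (simp add: vertices_def flip: rot_eq)
    show "r # walk = us @ a # bs @ x # cs @ along a # ds @ along x # es"
      using assms E by (simp add: along_def)
    show "set (r # walk) = D" using set_tour by simp
  qed (use assms E T_subset in auto)
next
  assume E: "E = B"
  show False
  proof (rule noncrossing_matching[OF finite_D motion_permutes _ matching_B walk_steps distinct_tour])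
    show "2 + card B \<le> 2 * card (orbit (c \<circ> across) ` D)"
      using card_faces by (simp add: faces_def face_eq)
    show "r # walk = us @ a # bs @ x # cs @ across a # ds @ across x # es"
      using assms E by (simp add: across_def)
    show "set (r # walk) = D" using set_tour by simp
  qed (use assms E B_subset in auto)
qed

text \<open>A partner of \<open>z\<close> outside the stretch would make the pairs of
  \<open>x\<close> and \<open>z\<close> cross, whichever side of the stretch it lies on.\<close>

lemma nested:
  assumes s: "r # walk = us @ x # bs @ \<alpha> x # ds" and E: "E = T \<or> E = B" "x \<in> E" "z \<in> E"
    and z: "z \<in> set bs"
  shows "\<alpha> z \<in> set bs"
proof (rule ccontr)
  assume n: "\<alpha> z \<notin> set bs"
  obtain b1 b2 where b: "bs = b1 @ z # b2" using split_list[OF z] by blast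
  have xD: "x \<in> D" "z \<in> D" using E T_subset B_subset by auto
  have d: "distinct (us @ x # bs @ \<alpha> x # ds)" using s distinct_tour by simp
  have "\<alpha> z \<in> D" using xD by simp
  then have "\<alpha> z \<in> set (us @ x # bs @ \<alpha> x # ds)" using s set_tour by (metis list.simps(15))
  moreover have "z \<noteq> x" "z \<noteq> \<alpha> x" using d z by auto
  then have "\<alpha> z \<noteq> x" "\<alpha> z \<noteq> \<alpha> x" using xD opp_opp by metis+
  ultimately consider "\<alpha> z \<in> set us" | "\<alpha> z \<in> set ds" using n by auto
  then show False
  proof cases
    case 1
    then obtain u1 u2 where u: "us = u1 @ \<alpha> z # u2" using split_list by fast
    have "r # walk = u1 @ \<alpha> z # u2 @ x # b1 @ \<alpha> (\<alpha> z) # b2 @ \<alpha> x # ds"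
      using s u b xD by simp
    then show False using noncrossing E(1) E(2) E(3) opp_T opp_B by metis
  next
    case 2
    then obtain u1 u2 where u: "ds = u1 @ \<alpha> z # u2" using split_list by fast
    have "r # walk = us @ x # b1 @ z # b2 @ \<alpha> x # u1 @ \<alpha> z # u2"
      using s u b xD by simp
    then show False using noncrossing E by metis
  qed
qed

section \<open>Heads and letters read off the tour\<close>

lemma walk_between:
  assumes "r # walk = us @ a # vs @ b # ws"
  shows "steps c a vs b"
  using assms walk_steps by (cases us) (auto simp: steps_append)

lemma linked_motion: "x \<notin> T \<or> x \<in> E \<Longrightarrow> linked M E x (c x)"
proof -
  assume x: "x \<notin> T \<or> x \<in> E"
  show ?thesis
  proof (cases "x \<in> T")
    case True
    then have "linked M E x (\<alpha> x)" "linked M E (\<alpha> x) (\<sigma> (\<alpha> x))"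
      using x unfolding linked_def by blast+
    then show ?thesis using True by (simp add: motion_def linked_def)
  next
    case False
    then show ?thesis by (auto simp: motion_def linked_def)
  qed
qed

lemma linked_steps:
  "steps c a zs b \<Longrightarrow> \<forall>z\<in>set (a # zs). z \<notin> T \<or> z \<in> E \<Longrightarrow> linked M E a b"
proof (induction zs arbitrary: a)
  case Nil
  then show ?case using linked_motion[of a E] by auto
next
  case (Cons z zs)
  then have "linked M E a z" "linked M E z b" using linked_motion[of a E] by auto
  then show ?case unfolding linked_def by (rule rtranclp_trans)
qed

text \<open>The tour is itself a path along \<open>T\<close>; if \<open>\<alpha> x\<close> comes
  first, the tour up to it uses neither half of the edge. If \<open>x\<close> comes first, the
  stretch up to \<open>\<alpha> x\<close> surrounds the branch beyond the edge, and no path from the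
  root enters this branch once the edge is deleted.\<close>

lemma tree_head:
  assumes s: "r # walk = xs @ x # ys" and x: "x \<in> T"
  shows "linked M (T - {x, \<alpha> x}) r (\<alpha> x) \<longleftrightarrow> \<alpha> x \<in> set xs"
proof
  have xD: "x \<in> D" "x \<noteq> r" "\<alpha> x \<noteq> x" "\<alpha> x \<noteq> r" using x T_subset opp_fixed opp_T by auto
  have d: "distinct (xs @ x # ys)" using s distinct_tour by simp
  {
    assume "\<alpha> x \<in> set xs"
    then obtain us vs where u: "xs = us @ \<alpha> x # vs" using split_list by fast
    then obtain us' where us: "us = r # us'" using s xD by (cases us) auto
    have "r # walk = [] @ r # us' @ \<alpha> x # vs @ x # ys" using s u us by simp
    then have "steps c r us' (\<alpha> x)" by (rule walk_between)
    then show "linked M (T - {x, \<alpha> x}) r (\<alpha> x)"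
      by (rule linked_steps) (use d u us xD in auto)
  next
    assume l: "linked M (T - {x, \<alpha> x}) r (\<alpha> x)"
    show "\<alpha> x \<in> set xs"
    proof (rule ccontr)
      assume "\<alpha> x \<notin> set xs"
      moreover have "\<alpha> x \<in> insert r (set walk)" using xD set_tour by simp
      ultimately have "\<alpha> x \<in> set ys" using s xD
        by (metis Un_iff list.simps(15) insert_iff set_append)
      then obtain bs ds where p: "ys = bs @ \<alpha> x # ds" using split_list by fast
      have s': "r # walk = xs @ x # bs @ \<alpha> x # ds" using s p by simp
      \<comment> \<open>A union of vertices that contains the far end of the edge. By nesting, the
        edges of \<open>T\<close> other than that of \<open>x\<close> do not lead out of it.\<close>
      define S where "S = insert (\<alpha> x) (set bs)"
      have bs: "along z \<in> set bs" if "z \<in> set bs" for z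
        using nested[OF s' _ x, of z] that by (auto simp: along_def)
      have st: "steps c x bs (\<alpha> x)" using walk_between[OF s'] .
      have "\<sigma> z \<in> S" if "z \<in> S" for z
      proof (cases "z = \<alpha> x")
        case True
        then have "\<sigma> z = c x" using x by (simp add: motion_def)
        then show ?thesis using steps_closed[OF st, of x] by (simp add: S_def)
      next
        case False
        then have "along z \<in> set bs" using that bs by (simp add: S_def)
        then have "c (along z) \<in> S" using steps_closed[OF st, of "along z"] by (simp add: S_def)
        then show ?thesis using rot_eq by (metis comp_apply)
      qed
      \<comment> \<open>A path of \<open>linked\<close> turns only forwards and must be kept from
        entering \<open>S\<close>, so closure under preimages of the rotation is required. For an
        injection on a finite set it follows from closure under images.\<close>
      then have "\<sigma> ` S \<subseteq> S" by blast
      moreover have "finite S" by (simp add: S_def)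
      ultimately have "\<sigma> ` S = S"
        using permutes_inj_on[OF rot_permutes, of S] by (simp add: endo_inj_surj)
      then have rot: "y \<in> S" if "\<sigma> y \<in> S" for y
        using that permutes_inj[OF rot_permutes] by (metis inj_image_mem_iff)
      have "y \<notin> S" if "linked M (T - {x, \<alpha> x}) r y" for y
        using that unfolding linked_def
      proof induction
        case base
        then show ?case using s' d xD by (cases xs) (auto simp: S_def p)
      next
        case (step y z)
        from step(2) show ?case
        proof
          assume "z = \<sigma> y"
          then show ?thesis using rot step by blast
        next
          assume y: "y \<in> T - {x, \<alpha> x} \<and> z = \<alpha> y"
          show ?thesis
          proof
            assume "z \<in> S"
            moreover have "y \<in> D" "z \<in> T" using y T_subset opp_T by auto
            moreover have "z \<noteq> \<alpha> x" using y xD \<open>y \<in> D\<close> opp_opp by (metis DiffE insertI1)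
            ultimately have "\<alpha> z \<in> set bs" using bs[of z] by (auto simp: S_def along_def)
            then show False using y \<open>y \<in> D\<close> step by (simp add: S_def)
          qed
        qed
      qed
      then show False using l by (auto simp: S_def)
    qed
  }
qed

lemma precedes_iff:
  assumes "r # walk = xs @ x # ys"
  shows "precedes M T y x \<longleftrightarrow> y \<in> set xs"
proof
  assume "precedes M T y x"
  then obtain i j where ij: "i < j" "j < length (r # walk)" "(r # walk) ! i = y" "(r # walk) ! j = x"
    unfolding precedes_def tour_eq by blast
  have "(r # walk) ! length xs = x" "length xs < length (r # walk)" using assms by auto
  then have "j = length xs" using ij distinct_tour nth_eq_iff_index_eq by blast
  then have "y = xs ! i" "i < length xs" using ij assms by (auto simp: nth_append)
  then show "y \<in> set xs" by simp
next
  assume "y \<in> set xs"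
  then obtain i where "i < length xs" "xs ! i = y" by (auto simp: in_set_conv_nth)
  then show "precedes M T y x" unfolding precedes_def tour_eq assms
    by (intro exI[of _ i] exI[of _ "length xs"]) (auto simp: nth_append)
qed

lemma head_iff:
  assumes s: "r # walk = xs @ x # ys"
  shows "x \<in> H \<longleftrightarrow> x = r \<or> (x \<in> T \<and> \<alpha> x \<in> set xs) \<or> (x \<in> B \<and> \<alpha> x \<notin> set xs)"
proof -
  have "x \<in> D" using s set_tour by (metis in_set_conv_decomp list.simps(15))
  have "precedes M T x (\<alpha> x) \<longleftrightarrow> \<alpha> x \<notin> set xs" if "x \<in> B"
  proof -
    have x: "\<alpha> x \<in> set (r # walk)" "\<alpha> x \<noteq> x" using that B_subset set_tour opp_fixed by auto
    have d: "distinct (xs @ x # ys)" using s distinct_tour by simp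
    show ?thesis
    proof (cases "\<alpha> x \<in> set xs")
      case True
      then obtain us vs where u: "xs = us @ \<alpha> x # vs" using split_list by fast
      have "precedes M T x (\<alpha> x) \<longleftrightarrow> x \<in> set us"
        by (rule precedes_iff) (use s u in simp)
      then show ?thesis using d u True by auto
    next
      case False
      then have "\<alpha> x \<in> set ys" using x s by auto
      then obtain us vs where u: "ys = us @ \<alpha> x # vs" using split_list by fast
      have "precedes M T x (\<alpha> x) \<longleftrightarrow> x \<in> set (xs @ x # us)"
        by (rule precedes_iff) (use s u in simp)
      then show ?thesis using False by auto
    qed
  qed
  then show ?thesis using tree_head[OF s] T_subset B_subset by (auto simp: delta_def B_def)
qed

text \<open>Read from the orientation instead of from the past of the tour. The root, a head outside
  \<open>T\<close>, gets \<open>OpB\<close>; \<open>Xi\<close> does not list it, but it fits the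
  initial tree, which the root creates.\<close>

definition letter :: "'h \<Rightarrow> letter" where
  "letter x = (if x \<in> T then (if x \<in> H then ClA else OpA) else (if x \<in> H then OpB else ClB))"

lemma Xi_eq: "Xi M T = map letter walk"
proof -
  have "letter (walk ! i) = (if walk ! i \<in> T then (if \<alpha> (walk ! i) \<in> set (r # take i walk) then ClA else OpA)
     else (if \<alpha> (walk ! i) \<in> set (r # take i walk) then ClB else OpB))" if i: "i < length walk" for i
  proof -
    have s: "r # walk = (r # take i walk) @ walk ! i # drop (Suc i) walk"
      using id_take_nth_drop[OF i] by simp
    have "walk ! i \<in> D - {r}" using i distinct_tour set_tour
      by (metis DiffI distinct.simps(2) insertCI nth_mem singletonD)
    then have "walk ! i \<in> T \<or> walk ! i \<in> B" using T_B by blast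
    then show ?thesis using head_iff[OF s] T_B \<open>walk ! i \<in> D - {r}\<close> by (auto simp: letter_def)
  qed
  moreover have upt: "[1..<length (r # walk)] = map Suc [0..<length walk]"
    by (simp add: map_Suc_upt del: upt_Suc)
  ultimately have "map (\<lambda>i. letter (walk ! i)) [0..<length walk] = Xi M T"
    unfolding Xi_def Let_def tour_eq upt map_map by (intro map_cong) auto
  moreover have "map letter walk = map (\<lambda>i. letter (walk ! i)) [0..<length walk]"
    by (rule nth_equalityI) auto
  ultimately show ?thesis by simp
qed

end

section \<open>The two stacks behind \<open>\<lambda>\<^sub>0\<close> and \<open>\<lambda>\<^sub>1\<close>\<close>

text \<open>\<open>Graft t c p\<close> is \<open>p\<close> with a new last child \<open>c\<close> of its root; \<open>t\<close> is the tail of the new edge. A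
  vertex carries as label the half-edge whose visit created it.\<close>

datatype 'a ltree = Single 'a | Graft 'a "'a ltree" "'a ltree"

primrec erase :: "'a ltree \<Rightarrow> ptree" where
  "erase (Single s) = tau"
| "erase (Graft t c p) = graft (erase c) (erase p)"

primrec preorder_labels :: "'a ltree \<Rightarrow> 'a list" where
  "preorder_labels (Single s) = [s]"
| "preorder_labels (Graft t c p) = preorder_labels p @ preorder_labels c"

text \<open>In a state \<open>(L, c, k, R)\<close>, \<open>c\<close> is the current tree. \<open>L\<close> holds the trees suspended by b, with the
  head of their roots, and \<open>R\<close> those suspended by a, with the tail at which they resume. \<open>k\<close> is the label
  of the latest piece of the vertex of the map that is being visited; it is suspended along with \<open>R\<close>.\<close>

type_synonym 'a state = "('a \<times> 'a ltree) list \<times> 'a ltree \<times> 'a \<times> ('a \<times> 'a \<times> 'a ltree) list"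

fun machine_step :: "'a state \<Rightarrow> letter \<Rightarrow> 'a \<Rightarrow> 'a state" where
  "machine_step (L, c, k, R) OpA d = (L, Single d, d, (d, k, c) # R)"
| "machine_step (L, c, k, R) OpB d = ((d, c) # L, Single d, d, R)"
| "machine_step (L, c, k, (i, k', q) # R) ClA d = (L, Graft i c q, k', R)"
| "machine_step ((i, l) # L, c, k, R) ClB d = (L, Graft d l c, k, R)"
| "machine_step s x d = s"

fun enabled :: "'a state \<Rightarrow> letter \<Rightarrow> bool" where
  "enabled (L, c, k, R) ClA \<longleftrightarrow> R \<noteq> []"
| "enabled (L, c, k, R) ClB \<longleftrightarrow> L \<noteq> []"
| "enabled (L, c, k, R) x \<longleftrightarrow> True"

lemma enabled_cases:
  assumes "enabled st x"
  obtains (OpA) L c k R where "st = (L, c, k, R)" "x = OpA"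
  | (OpB) L c k R where "st = (L, c, k, R)" "x = OpB"
  | (ClA) L c k i k' q R where "st = (L, c, k, (i, k', q) # R)" "x = ClA"
  | (ClB) i l L c k R where "st = ((i, l) # L, c, k, R)" "x = ClB"
proof -
  obtain L c k R where st: "st = (L, c, k, R)" by (cases st)
  show thesis
  proof (cases x)
    case ClA
    then obtain i k' q R' where "R = (i, k', q) # R'" using assms st by (cases R) auto
    then show ?thesis using that(3) st ClA by blast
  next
    case ClB
    then obtain i l L' where "L = (i, l) # L'" using assms st by (cases L) auto
    then show ?thesis using that(4) st ClB by blast
  qed (use that(1,2) st in blast)+
qed

lemma first_last_split [simp]:
  assumes "x \<notin> set us"
  shows "before_first x (us @ x # vs) = us" "after_first x (us @ x # vs) = vs"
  using assms by (induction us) (auto simp: before_first_def after_first_def)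

lemma last_split [simp]:
  assumes "x \<notin> set vs"
  shows "before_last x (us @ x # vs) = us" "after_last x (us @ x # vs) = vs"
  using assms by (auto simp: before_last_def after_last_def)

text \<open>Both stacks keep the latest tree first, hence the reversal of \<open>L\<close>. The last
  u and the first v stand on the two sides of the current tree, so every letter acts next to
  it.\<close>

fun forest_word :: "'a state \<Rightarrow> symbol list" where
  "forest_word (L, c, k, R) = concat (map (\<lambda>(i, l). [U, Tree (erase l)]) (rev L)) @ U # Tree (erase c) # V #
     concat (map (\<lambda>(i, k, q). [Tree (erase q), V]) R)"

lemma lambda0_machine_step:
  assumes "enabled st x"
  shows "lambda0_step (forest_word st) x = forest_word (machine_step st x d)"
proof -
  have nU: "U \<notin> set (concat (map (\<lambda>(i, k, q). [Tree (erase q), V]) R))"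
    and nV: "V \<notin> set (concat (map (\<lambda>(i, l). [U, Tree (erase l)]) L))"
    for R :: "('a \<times> 'a \<times> 'a ltree) list" and L :: "('a \<times> 'a ltree) list"
    by auto
  show ?thesis
    using assms
  proof (cases rule: enabled_cases)
    case (OpA L c k R)
    then show ?thesis using last_split[of U "Tree (erase c) # V # concat (map (\<lambda>(i, k, q). [Tree (erase q), V]) R)"] nU
      by simp
  next
    case (OpB L c k R)
    then show ?thesis
      using first_last_split[of V "concat (map (\<lambda>(i, l). [U, Tree (erase l)]) (rev L)) @ [U, Tree (erase c)]"] nV[of "rev L"]
      by simp
  next
    case (ClA L c k i k' q R)
    then show ?thesis
      using first_last_split[of V "concat (map (\<lambda>(i, l). [U, Tree (erase l)]) (rev L)) @ [U, Tree (erase c)]"] nV[of "rev L"]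
      by (simp add: join_def butlast_append)
  next
    case (ClB i l L c k R)
    then show ?thesis
      using last_split[of U "Tree (erase c) # V # concat (map (\<lambda>(i, k, q). [Tree (erase q), V]) R)"
          "concat (map (\<lambda>(i, l). [U, Tree (erase l)]) (rev L)) @ [U, Tree (erase l)]"] nU
      by (simp add: join_def butlast_append)
  qed
qed

section \<open>Labelled binary trees and their inorder words\<close>

datatype 'a lbtree = LLeaf bool | LNode 'a "'a lbtree" "'a lbtree"

primrec unlabel :: "'a lbtree \<Rightarrow> btree" where
  "unlabel (LLeaf a) = Leaf a"
| "unlabel (LNode s l r) = BNode (unlabel l) (unlabel r)"

primrec inorder :: "'a lbtree \<Rightarrow> 'a list" where
  "inorder (LLeaf a) = []"
| "inorder (LNode s l r) = inorder l @ s # inorder r"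

text \<open>\<open>MarkU\<close> and \<open>MarkV k\<close> stand for an active left leaf and for an active right leaf with father \<open>k\<close>.\<close>

datatype 'a mark = MarkU | MarkV 'a | MarkN 'a

primrec inorder_word :: "'a mark \<Rightarrow> 'a lbtree \<Rightarrow> 'a mark list" where
  "inorder_word mark (LLeaf a) = (if a then [mark] else [])"
| "inorder_word mark (LNode s l r) = inorder_word MarkU l @ MarkN s # inorder_word (MarkV s) r"

fun subst_at :: "nat list \<Rightarrow> 'a lbtree \<Rightarrow> 'a lbtree \<Rightarrow> 'a lbtree" where
  "subst_at [] C t = C"
| "subst_at (i # p) C (LNode s l r) = (if i = 0 then LNode s (subst_at p C l) r else LNode s l (subst_at p C r))"
| "subst_at (i # p) C (LLeaf a) = LLeaf a"

lemma unlabel_subst_at: "unlabel (subst_at p C t) = replace_at p (unlabel C) (unlabel t)"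
  by (induction p C t rule: subst_at.induct) auto

text \<open>Used with \<open>v\<close> sending a label to its vertex of the map: right sons stay in the vertex of their
  father, and the tops of the right chains are taken from \<open>S\<close>.\<close>

primrec consistent :: "('a \<Rightarrow> 'b) \<Rightarrow> 'a set \<Rightarrow> 'a mark \<Rightarrow> 'a lbtree \<Rightarrow> bool" where
  "consistent v S mark (LLeaf a) \<longleftrightarrow> True"
| "consistent v S mark (LNode s l r) \<longleftrightarrow>
     (case mark of MarkV k \<Rightarrow> v s = v k | _ \<Rightarrow> s \<in> S) \<and> consistent v S MarkU l \<and> consistent v S (MarkV s) r"

definition nodes_of :: "'a mark list \<Rightarrow> 'a list" where
  "nodes_of xs = concat (map (\<lambda>x. case x of MarkN s \<Rightarrow> [s] | _ \<Rightarrow> []) xs)"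

lemma nodes_of_simps [simp]:
  "nodes_of [] = []" "nodes_of (MarkN s # xs) = s # nodes_of xs" "nodes_of (MarkU # xs) = nodes_of xs"
  "nodes_of (MarkV k # xs) = nodes_of xs" "nodes_of (xs @ ys) = nodes_of xs @ nodes_of ys"
  by (simp_all add: nodes_of_def)

lemma nodes_of_map_MarkN [simp]: "nodes_of (map MarkN xs) = xs"
  by (induction xs) auto

lemma nodes_of_inorder_word: "(\<And>s. mark \<noteq> MarkN s) \<Longrightarrow> nodes_of (inorder_word mark t) = inorder t"
  by (induction t arbitrary: mark) (auto simp: nodes_of_def split: mark.split)

definition active_sides :: "'a mark list \<Rightarrow> bool list" where
  "active_sides xs = concat (map (\<lambda>x. case x of MarkN s \<Rightarrow> [] | MarkU \<Rightarrow> [True] | MarkV k \<Rightarrow> [False]) xs)"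

lemma active_sides_simps [simp]:
  "active_sides [] = []" "active_sides (MarkN s # xs) = active_sides xs" "active_sides (MarkU # xs) = True # active_sides xs"
  "active_sides (MarkV k # xs) = False # active_sides xs" "active_sides (xs @ ys) = active_sides xs @ active_sides ys"
  by (simp_all add: active_sides_def)

lemma active_sides_mem: "True \<in> set (active_sides xs) \<longleftrightarrow> MarkU \<in> set xs" "False \<in> set (active_sides xs) \<longleftrightarrow> (\<exists>k. MarkV k \<in> set xs)"
  by (induction xs) (auto simp: active_sides_def split: mark.splits)

text \<open>The empty address takes the side \<open>b\<close> on which the subtree itself hangs, so
  that the side of a leaf can be computed while descending.\<close>

definition is_left :: "bool \<Rightarrow> nat list \<Rightarrow> bool" where
  "is_left b p \<longleftrightarrow> (if p = [] then b else last p = 0)"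

lemma is_left_Cons [simp]: "is_left b (i # p) = is_left (i = 0) p"
  by (auto simp: is_left_def)

lemma inorder_word_sides: "(\<And>s. mark \<noteq> MarkN s) \<Longrightarrow> active_sides (inorder_word mark t) = map (is_left (mark = MarkU)) (active_leaves (unlabel t))"
proof (induction t arbitrary: mark)
  case (LLeaf a)
  then show ?case by (cases mark) (auto simp: is_left_def)
next
  case (LNode s l r)
  then show ?case by (simp add: comp_def)
qed

text \<open>The marks in the word match the active leaves in order, so substituting at a leaf
  rewrites one mark in its context. A mark \<open>MarkV k\<close> also remembers the father, which
  is what \<open>consistent\<close> has to know about the inserted tree.\<close>

lemma active_leaf_context:
  assumes "active_leaves (unlabel t) = ps @ p # qs" "\<And>s. mark \<noteq> MarkN s"
  shows "\<exists>X Y z. inorder_word mark t = X @ z # Y \<and> active_sides X = map (is_left (mark = MarkU)) ps \<and> active_sides [z] = [is_left (mark = MarkU) p] \<and>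
    active_sides Y = map (is_left (mark = MarkU)) qs \<and>
    (\<forall>C. inorder_word mark (subst_at p C t) = X @ inorder_word z C @ Y \<and> (consistent v S mark t \<longrightarrow> consistent v S z C \<longrightarrow> consistent v S mark (subst_at p C t)))"
  using assms
proof (induction t arbitrary: ps p qs mark)
  case (LLeaf a)
  then have "a" "ps = []" "p = []" "qs = []" by (auto split: if_splits simp: Cons_eq_append_conv)
  then show ?case using LLeaf(2)
    by (intro exI[of _ "[]"] exI[of _ mark]) (cases mark; auto simp: is_left_def)
next
  case (LNode s l r)
  let ?l = "map (Cons 0) (active_leaves (unlabel l))" and ?r = "map (Cons 1) (active_leaves (unlabel r))"
  have e: "?l @ ?r = ps @ p # qs" using LNode.prems by simp
  consider (l) qs' where "?l = ps @ p # qs'" "qs = qs' @ ?r" | (r) ps' where "?r = ps' @ p # qs" "ps = ?l @ ps'"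
    using e by (auto simp: append_eq_append_conv2 append_eq_Cons_conv Cons_eq_append_conv) 
  then show ?case
  proof cases
    case l
    then obtain ps0 p0 qs0 where 0: "active_leaves (unlabel l) = ps0 @ p0 # qs0" "ps = map (Cons 0) ps0"
      "p = 0 # p0" "qs' = map (Cons 0) qs0" by (auto simp: map_eq_append_conv map_eq_Cons_conv)
    obtain X Y z where 1: "inorder_word MarkU l = X @ z # Y" "active_sides X = map (is_left True) ps0" "active_sides [z] = [is_left True p0]"
      "active_sides Y = map (is_left True) qs0"
      "\<forall>C. inorder_word MarkU (subst_at p0 C l) = X @ inorder_word z C @ Y \<and>
        (consistent v S MarkU l \<longrightarrow> consistent v S z C \<longrightarrow> consistent v S MarkU (subst_at p0 C l))"
      using LNode.IH(1)[OF 0(1) mark.distinct(3)] by auto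
    have "active_sides (inorder_word (MarkV s) r) = map (is_left False) (active_leaves (unlabel r))" using inorder_word_sides[of "MarkV s" r] by simp
    then show ?thesis
      using 0 1 l
      by (intro exI[of _ X] exI[of _ "Y @ MarkN s # inorder_word (MarkV s) r"] exI[of _ z]) (simp add: comp_def)
  next
    case r
    then obtain ps0 p0 qs0 where 0: "active_leaves (unlabel r) = ps0 @ p0 # qs0" "ps' = map (Cons 1) ps0"
      "p = 1 # p0" "qs = map (Cons 1) qs0" by (auto simp: map_eq_append_conv map_eq_Cons_conv)
    obtain X Y z where 1: "inorder_word (MarkV s) r = X @ z # Y" "active_sides X = map (is_left False) ps0"
      "active_sides [z] = [is_left False p0]" "active_sides Y = map (is_left False) qs0"
      "\<forall>C. inorder_word (MarkV s) (subst_at p0 C r) = X @ inorder_word z C @ Y \<and>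
        (consistent v S (MarkV s) r \<longrightarrow> consistent v S z C \<longrightarrow> consistent v S (MarkV s) (subst_at p0 C r))"
      using LNode.IH(2)[OF 0(1) mark.distinct(5)[of s]] by auto
    have "active_sides (inorder_word MarkU l) = map (is_left True) (active_leaves (unlabel l))" using inorder_word_sides[of MarkU l] by simp
    then show ?thesis
      using 0 1 r
      by (intro exI[of _ "inorder_word MarkU l @ MarkN s # X"] exI[of _ Y] exI[of _ z]) (simp add: comp_def)
  qed
qed

lemma active_leaf_address:
  "p \<in> set (active_leaves (unlabel (LNode s l r))) \<Longrightarrow> p \<noteq> [] \<and> is_left True p = left_son p \<and> right_son p = (\<not> left_son p)"
proof -
  have bits: "i = 0 \<or> i = 1" if "p \<in> set (active_leaves (unlabel t))" "i \<in> set p" for t :: "'a lbtree" and p i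
    using that by (induction t arbitrary: p) (fastforce split: if_splits)+
  assume p: "p \<in> set (active_leaves (unlabel (LNode s l r)))"
  then have ne: "p \<noteq> []" by auto
  then have "last p = 0 \<or> last p = 1" using bits[OF p, of "last p"] by simp
  then show ?thesis using ne by (auto simp: is_left_def left_son_def right_son_def)
qed

lemma split_last_unique:
  assumes "xs @ x # ys = xs' @ x # ys'" "x \<notin> set ys" "x \<notin> set ys'"
  shows "xs = xs' \<and> ys = ys'"
  using assms by (auto simp: append_eq_append_conv2 append_eq_Cons_conv Cons_eq_append_conv)

lemma split_first_unique:
  assumes "xs @ x # ys = xs' @ x' # ys'" "P x" "P x'" "\<forall>z\<in>set xs. \<not> P z" "\<forall>z\<in>set xs'. \<not> P z"
  shows "xs = xs' \<and> x = x' \<and> ys = ys'"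
  using assms by (auto simp: append_eq_append_conv2 append_eq_Cons_conv Cons_eq_append_conv)

lemma replace_last_active_left:
  fixes t :: "'a lbtree"
  assumes t: "t = LNode s l r" and inorder_word: "inorder_word MarkU t = X @ MarkU # Y" "MarkU \<notin> set Y"
  defines "p \<equiv> last_active_left (unlabel t)"
  shows "inorder_word MarkU (subst_at p C t) = X @ inorder_word MarkU C @ Y"
    and "consistent v S MarkU t \<Longrightarrow> consistent v S MarkU C \<Longrightarrow> consistent v S MarkU (subst_at p C t)" and "p \<noteq> []"
proof -
  let ?A = "active_leaves (unlabel t)"
  have isl: "is_left True q = left_son q" "q \<noteq> []" if "q \<in> set ?A" for q
    using active_leaf_address[OF that[unfolded t]] by simp_all
  have "True \<in> set (active_sides (inorder_word MarkU t))" using inorder_word by (simp add: active_sides_mem)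
  then have "\<exists>q\<in>set ?A. left_son q" using inorder_word_sides[of MarkU t] isl by auto
  from split_list_last_prop[OF this] obtain ps q qs
    where q: "?A = ps @ q # qs" "left_son q" "\<forall>q\<in>set qs. \<not> left_son q" by blast
  have "p = q" using q by (simp add: p_def last_active_left_def)
  obtain X' Y' z where 1: "inorder_word MarkU t = X' @ z # Y'" "active_sides [z] = [is_left True q]"
      "active_sides Y' = map (is_left True) qs"
      "\<forall>C. inorder_word MarkU (subst_at q C t) = X' @ inorder_word z C @ Y' \<and>
        (consistent v S MarkU t \<longrightarrow> consistent v S z C \<longrightarrow> consistent v S MarkU (subst_at q C t))"
    using active_leaf_context[OF q(1) mark.distinct(3), of v S] by auto
  have "is_left True q" using isl q by simp
  then have z: "z = MarkU" using 1(2) by (cases z) auto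
  have "True \<notin> set (active_sides Y')" using 1(3) q isl by auto
  then have "X' = X \<and> Y' = Y" using split_last_unique[of X' MarkU Y' X Y] 1(1) inorder_word z by (simp add: active_sides_mem)
  then show "inorder_word MarkU (subst_at p C t) = X @ inorder_word MarkU C @ Y"
    "consistent v S MarkU t \<Longrightarrow> consistent v S MarkU C \<Longrightarrow> consistent v S MarkU (subst_at p C t)"
    using 1 z \<open>p = q\<close> by auto
  show "p \<noteq> []" using isl q \<open>p = q\<close> by simp
qed

lemma replace_first_active_right:
  fixes t :: "'a lbtree"
  assumes t: "t = LNode s l r" and inorder_word: "inorder_word MarkU t = X @ MarkV k # Y" "\<forall>k. MarkV k \<notin> set X"
  defines "p \<equiv> first_active_right (unlabel t)"
  shows "inorder_word MarkU (subst_at p C t) = X @ inorder_word (MarkV k) C @ Y"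
    and "consistent v S MarkU t \<Longrightarrow> consistent v S (MarkV k) C \<Longrightarrow> consistent v S MarkU (subst_at p C t)" and "p \<noteq> []"
proof -
  let ?A = "active_leaves (unlabel t)"
  have isl: "is_left True q \<longleftrightarrow> \<not> right_son q" "q \<noteq> []" if "q \<in> set ?A" for q
    using active_leaf_address[OF that[unfolded t]] by simp_all
  have "\<exists>k. MarkV k \<in> set (inorder_word MarkU t)" using inorder_word by auto
  then have "False \<in> set (active_sides (inorder_word MarkU t))" by (simp add: active_sides_mem)
  then have "\<exists>q\<in>set ?A. right_son q" using inorder_word_sides[of MarkU t] isl by auto
  from split_list_first_prop[OF this] obtain ps q qs
    where q: "?A = ps @ q # qs" "right_son q" "\<forall>q\<in>set ps. \<not> right_son q" by blast
  have "filter right_son ps = []" using q by (auto simp: filter_empty_conv)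
  then have "p = q" using q by (simp add: p_def first_active_right_def)
  obtain X' Y' z where 1: "inorder_word MarkU t = X' @ z # Y'" "active_sides X' = map (is_left True) ps" "active_sides [z] = [is_left True q]"
      "\<forall>C. inorder_word MarkU (subst_at q C t) = X' @ inorder_word z C @ Y' \<and>
        (consistent v S MarkU t \<longrightarrow> consistent v S z C \<longrightarrow> consistent v S MarkU (subst_at q C t))"
    using active_leaf_context[OF q(1) mark.distinct(3), of v S] by auto
  have "\<not> is_left True q" using isl q by simp
  then obtain k' where z: "z = MarkV k'" using 1(3) by (cases z) auto
  have "False \<notin> set (active_sides X')" using 1(2) q isl by auto
  then have "X' = X \<and> z = MarkV k \<and> Y' = Y"
    using inorder_word 1(1) z by (intro split_first_unique[where P = "\<lambda>z. \<exists>k. z = MarkV k"]) (auto simp: active_sides_mem)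
  then show "inorder_word MarkU (subst_at p C t) = X @ inorder_word (MarkV k) C @ Y"
    "consistent v S MarkU t \<Longrightarrow> consistent v S (MarkV k) C \<Longrightarrow> consistent v S MarkU (subst_at p C t)"
    using 1 \<open>p = q\<close> by auto
  show "p \<noteq> []" using isl q \<open>p = q\<close> by simp
qed

text \<open>The mark after the current tree carries the latest piece \<open>k\<close> of the vertex
  being visited. The letter b starts the next piece of that vertex and therefore attaches it as a
  right son of \<open>k\<close>.\<close>

fun node_word :: "'a state \<Rightarrow> 'a mark list" where
  "node_word (L, c, k, R) = concat (map (\<lambda>(i, l). MarkU # map MarkN (rev (preorder_labels l))) (rev L)) @
     MarkU # map MarkN (rev (preorder_labels c)) @ MarkV k # concat (map (\<lambda>(i, k, q). map MarkN (rev (preorder_labels q)) @ [MarkV k]) R)"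

lemma subst_at_LNode: "p \<noteq> [] \<Longrightarrow> \<exists>s' l' r'. subst_at p C (LNode s l r) = LNode s' l' r'"
  by (cases p) auto

text \<open>An opening letter puts \<open>MarkU\<close>, \<open>MarkN d\<close>,
  \<open>MarkV d\<close> in the place of one mark, a closing letter removes a mark and lets two
  reversed preorders merge. The premises on \<open>d\<close> are what \<open>consistent\<close> asks
  of a new left son and of a new right son.\<close>

lemma lambda1_machine_step:
  assumes e: "enabled st x" and t: "t = LNode s l r" "inorder_word MarkU t = node_word st" "consistent v S MarkU t"
    and d: "x = OpA \<Longrightarrow> d \<in> S" "x = OpB \<Longrightarrow> v d = v (fst (snd (snd st)))"
  shows "\<exists>s' l' r'. unlabel (LNode s' l' r') = lambda1_step (unlabel t) x \<and>
    inorder_word MarkU (LNode s' l' r') = node_word (machine_step st x d) \<and> consistent v S MarkU (LNode s' l' r')"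
proof -
  let ?p = "last_active_left (unlabel t)" and ?q = "first_active_right (unlabel t)"
  let ?B = "LNode d (LLeaf True) (LLeaf True)"
  have B: "unlabel ?B = B1" "inorder_word mark ?B = [MarkU, MarkN d, MarkV d]" for mark by (simp_all add: B1_def)
  have nU: "MarkU \<notin> set (concat (map (\<lambda>(i, k, q). map MarkN (rev (preorder_labels q)) @ [MarkV k]) R))"
    and nV: "\<forall>k. MarkV k \<notin> set (concat (map (\<lambda>(i, l). MarkU # map MarkN (rev (preorder_labels l))) L))"
    for R :: "('a \<times> 'a \<times> 'a ltree) list" and L :: "('a \<times> 'a ltree) list"
    by auto
  have left: "\<exists>s' l' r'. unlabel (LNode s' l' r') = replace_at ?p (unlabel C) (unlabel t) \<and>
      inorder_word MarkU (LNode s' l' r') = X @ inorder_word MarkU C @ Y \<and> consistent v S MarkU (LNode s' l' r')"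
    if "inorder_word MarkU t = X @ MarkU # Y" "MarkU \<notin> set Y" "consistent v S MarkU C" for X Y C
    using replace_last_active_left[OF t(1) that(1,2)] subst_at_LNode[of ?p C s l r] that(3) t unlabel_subst_at[of ?p C t] by metis
  have right: "\<exists>s' l' r'. unlabel (LNode s' l' r') = replace_at ?q (unlabel C) (unlabel t) \<and>
      inorder_word MarkU (LNode s' l' r') = X @ inorder_word (MarkV k) C @ Y \<and> consistent v S MarkU (LNode s' l' r')"
    if "inorder_word MarkU t = X @ MarkV k # Y" "\<forall>k. MarkV k \<notin> set X" "consistent v S (MarkV k) C" for X Y C k
    using replace_first_active_right[OF t(1) that(1,2)] subst_at_LNode[of ?q C s l r] that(3) t unlabel_subst_at[of ?q C t] by metis
  show ?thesis
    using e
  proof (cases rule: enabled_cases)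
    case (OpA L c k R)
    then show ?thesis using left[of "concat (map (\<lambda>(i, l). MarkU # map MarkN (rev (preorder_labels l))) (rev L))"
      "map MarkN (rev (preorder_labels c)) @ MarkV k # concat (map (\<lambda>(i, k, q). map MarkN (rev (preorder_labels q)) @ [MarkV k]) R)" ?B]
      nU t(2) d B by auto
  next
    case (OpB L c k R)
    then show ?thesis using right[of "concat (map (\<lambda>(i, l). MarkU # map MarkN (rev (preorder_labels l))) (rev L)) @ MarkU # map MarkN (rev (preorder_labels c))"
      k "concat (map (\<lambda>(i, k, q). map MarkN (rev (preorder_labels q)) @ [MarkV k]) R)" ?B]
      nV[of "rev L"] t(2) d B by auto
  next
    case (ClA L c k i k' q R)
    then show ?thesis using right[of "concat (map (\<lambda>(i, l). MarkU # map MarkN (rev (preorder_labels l))) (rev L)) @ MarkU # map MarkN (rev (preorder_labels c))"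
      k "concat (map (\<lambda>(i, k, q). map MarkN (rev (preorder_labels q)) @ [MarkV k]) ((i, k', q) # R))" "LLeaf False"]
      nV[of "rev L"] t(2) by auto
  next
    case (ClB i l' L c k R)
    then show ?thesis using left[of "concat (map (\<lambda>(i, l). MarkU # map MarkN (rev (preorder_labels l))) (rev ((i, l') # L)))"
      "map MarkN (rev (preorder_labels c)) @ MarkV k # concat (map (\<lambda>(i, k, q). map MarkN (rev (preorder_labels q)) @ [MarkV k]) R)" "LLeaf False"]
      nU t(2) by auto
  qed
qed

section \<open>Tours of plane trees\<close>

text \<open>Splitting off the last child keeps the addresses of the other vertices and follows the
  way in which the trees are grown.\<close>

lemma ptree_graft_induct [case_names tau graft]:
  assumes "P tau" "\<And>c q. P c \<Longrightarrow> P q \<Longrightarrow> P (graft c q)"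
  shows "P t"
proof (induction t)
  case (Node ks)
  then show ?case
  proof (induction ks rule: rev_induct)
    case Nil
    then show ?case using assms(1) by (simp add: tau_def)
  next
    case (snoc k ks)
    then show ?case using assms(2)[of k "Node ks"] by (simp add: graft_def)
  qed
qed

primrec tree_tour :: "ptree \<Rightarrow> nat list \<Rightarrow> tree_dart list" where
  "tree_tour (Node ks) = (\<lambda>p. concat (map (\<lambda>(i, F). Father (p @ [i]) # F (p @ [i]) @ [Son (p @ [i])])
     (enumerate 0 (map tree_tour ks))))"

lemma tree_tour_simps [simp]:
  "tree_tour tau p = []"
  "tree_tour (graft c q) p = tree_tour q p @ Father (p @ [length (kids q)]) # tree_tour c (p @ [length (kids q)]) @
     [Son (p @ [length (kids q)])]"
  by (simp add: tau_def) (cases q; simp add: graft_def enumerate_append_eq)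

lemma kids_simps [simp]: "kids tau = []" "kids (graft c q) = kids q @ [c]"
  by (simp_all add: tau_def graft_def)

lemma is_vertex_graft:
  "q \<noteq> [] \<Longrightarrow> is_vertex q (graft c s) \<longleftrightarrow>
    is_vertex q s \<or> (\<exists>q'. q = length (kids s) # q' \<and> is_vertex q' c)"
  by (cases q) (auto simp: nth_append less_Suc_eq)

lemma arity_graft:
  assumes "is_vertex q s" "q \<noteq> []"
  shows "arity q (graft c s) = arity q s"
  using assms by (cases q) (auto simp: nth_append)

lemma arity_graft_last: "arity (length (kids s) # q) (graft c s) = arity q c"
  by simp

lemma set_tree_tour: "set (tree_tour t p) = (\<lambda>q. Son (p @ q)) ` {q. q \<noteq> [] \<and> is_vertex q t} \<union>
    (\<lambda>q. Father (p @ q)) ` {q. q \<noteq> [] \<and> is_vertex q t}"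
proof (induction t arbitrary: p rule: ptree_graft_induct)
  case tau
  have "\<not> is_vertex q tau" if "q \<noteq> []" for q using that by (cases q) auto
  then show ?case by auto
next
  case (graft c s)
  let ?n = "length (kids s)"
  have "{q. q \<noteq> [] \<and> is_vertex q (graft c s)} =
      {q. q \<noteq> [] \<and> is_vertex q s} \<union> insert [?n] (Cons ?n ` {q. q \<noteq> [] \<and> is_vertex q c})"
    using is_vertex_graft[of _ c s] by (auto simp: image_iff) 
  then show ?case using graft.IH by (auto simp: image_Un image_image)
qed

text \<open>Here \<open>t\<close> is the subtree of \<open>t0\<close> at \<open>p\<close> cut down
  to its first few children, as it arises when last children are split off. So its tour ends either
  at the next child present in \<open>t0\<close> or on the half-edge towards the father.\<close>

lemma steps_tree_tour:
  fixes t0 :: ptree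
  defines "m \<equiv> \<lambda>d. tree_rot t0 (tree_opp d)"
  assumes "tree_opp x = Son p" "length (kids t) \<le> arity p t0"
    and "\<And>q. q \<noteq> [] \<Longrightarrow> is_vertex q t \<Longrightarrow> arity (p @ q) t0 = arity q t"
  shows "steps m x (tree_tour t p) (if length (kids t) < arity p t0 then Father (p @ [length (kids t)]) else Son p)"
  using assms(2-)
proof (induction t arbitrary: p x rule: ptree_graft_induct)
  case tau
  then show ?case by (auto simp: m_def tree_rot_def)
next
  case (graft c s)
  let ?n = "length (kids s)"
  have "steps m x (tree_tour s p) (Father (p @ [?n]))"
    using graft.IH(2)[of x p] graft.prems is_vertex_graft[of _ c s] arity_graft[of _ s c] by fastforce
  moreover have "steps m (Father (p @ [?n])) (tree_tour c (p @ [?n])) (Son (p @ [?n]))"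
  proof -
    have a: "arity ((p @ [?n]) @ q) t0 = arity q c" if "is_vertex q c" for q
      using graft.prems(3)[of "?n # q"] that arity_graft_last[of s q c] is_vertex_graft[of "?n # q" c s] by simp
    then have "arity (p @ [?n]) t0 = length (kids c)" using a[of "[]"] by simp
    then show ?thesis
      using graft.IH(1)[of "Father (p @ [?n])" "p @ [?n]"] a by (simp add: tree_opp_def)
  qed
  moreover have "m (Son (p @ [?n])) = (if Suc ?n < arity p t0 then Father (p @ [Suc ?n]) else Son p)"
    by (simp add: m_def tree_opp_def tree_rot_def)
  ultimately show ?case by (simp add: steps_append)
qed

lemma tree_opp_in: "d \<in> tree_darts t \<Longrightarrow> tree_opp d \<in> tree_darts t"
  by (cases d) (auto simp: tree_darts_def tree_opp_def)

lemma tree_opp_opp: "tree_opp (tree_opp d) = d" if "d \<noteq> Father []"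
  using that by (auto simp: tree_opp_def split: tree_dart.splits)

lemma root_in_tree_darts: "Son [] \<in> tree_darts t"
  by (auto simp: tree_darts_def)

lemma tree_map_tour:
  fixes t :: ptree
  defines "N \<equiv> tree_map t"
  shows "steps (motion N (edge_darts N)) (Son []) (tree_tour t []) (Son [])"
    and "insert (Son []) (set (tree_tour t [])) = darts N"
proof -
  have d: "insert (Son []) (set (tree_tour t [])) = tree_darts t"
    unfolding set_tree_tour tree_darts_def by auto
  then show "insert (Son []) (set (tree_tour t [])) = darts N" by (simp add: N_def tree_map_def)
  have st: "steps (\<lambda>d. tree_rot t (tree_opp d)) (Son []) (tree_tour t []) (Son [])"
    using steps_tree_tour[of "Son []" "[]" t t] by (simp add: tree_opp_def)
  have "motion N (edge_darts N) z = tree_rot t (tree_opp z)" if "z \<in> tree_darts t" for z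
    using that tree_opp_in[OF that] root_in_tree_darts[of t]
    by (auto simp: motion_def edge_darts_def N_def tree_map_def tree_opp_def)
  then show "steps (motion N (edge_darts N)) (Son []) (tree_tour t []) (Son [])"
    using d by (intro steps_cong[OF st]) auto
qed

lemma steps_map:
  "steps m x ys y \<Longrightarrow> steps m' (g x) (map g ys) (g y) \<Longrightarrow> z \<in> insert x (set ys) \<Longrightarrow> g (m z) = m' (g z)"
  by (induction ys arbitrary: x) auto

text \<open>The map \<open>g\<close> leads from \<open>M\<close> to \<open>N\<close>, so the
  isomorphism is its inverse. Injectivity of \<open>g\<close> is inherited from the distinct list
  \<open>xs\<close>, and compatibility with \<open>rot\<close> is compatibility with the motion
  taken at the opposite half-edge.\<close>

lemma rmap_iso_tourI:
  assumes M: "steps (motion M (edge_darts M)) (root M) ys (root M)" "insert (root M) (set ys) = darts M"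
    and N: "steps (motion N (edge_darts N)) (root N) xs (root N)" "insert (root N) (set xs) = darts N"
    and g: "map g ys = xs" "g (root M) = root N" "distinct (root N # xs)"
    and opp: "\<And>d. d \<in> darts M \<Longrightarrow> g (opp M d) = opp N (g d) \<and> opp M d \<in> darts M \<and> opp M (opp M d) = d"
    and root: "opp M (root M) = root M"
  shows "rmap_iso N M"
proof -
  have inj: "inj_on g (darts M)"
    using g unfolding M(2)[symmetric] by (metis distinct_map list.simps(15) list.simps(9))
  have img: "g ` darts M = darts N" unfolding M(2)[symmetric] N(2)[symmetric] using g by auto
  have rootD: "root M \<in> darts M" using M(2) by blast
  have mM: "motion M (edge_darts M) d = rot M (opp M d)" if "d \<in> darts M" for d
    using that root by (auto simp: motion_def edge_darts_def)
  have rootN: "opp N (root N) = root N" using opp[OF rootD] root g by simp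
  then have mN: "motion N (edge_darts N) d = rot N (opp N d)" if "d \<in> darts N" for d
    using that by (auto simp: motion_def edge_darts_def)
  have rot: "g (rot M d) = rot N (g d) \<and> rot M d \<in> darts M" if d: "d \<in> darts M" for d
  proof -
    have o: "opp M d \<in> darts M" "opp M (opp M d) = d" using opp d by blast+
    have "g (motion M (edge_darts M) (opp M d)) = motion N (edge_darts N) (g (opp M d))"
      using steps_map[OF M(1), of "motion N (edge_darts N)" g "opp M d"] N(1) g M(2) o by simp
    moreover have "g (opp M d) \<in> darts N" using o img by blast
    moreover have "opp N (g (opp M d)) = g d" using opp[OF o(1)] o(2) by simp
    moreover have "motion M (edge_darts M) (opp M d) \<in> darts M"
      using steps_closed[OF M(1), of "opp M d"] o M(2) by simp
    ultimately show ?thesis using mM[OF o(1)] mN o(2) by simp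
  qed
  define f where "f = inv_into (darts M) g"
  have fg: "f (g d) = d" if "d \<in> darts M" for d using inj that by (simp add: f_def)
  show ?thesis
    unfolding rmap_iso_def
  proof (intro exI[of _ f] conjI ballI)
    show "bij_betw f (darts N) (darts M)"
      unfolding f_def using inj img by (intro bij_betw_inv_into) (simp add: bij_betw_def)
    show "f (root N) = root M" using fg[OF rootD] g by simp
    fix h assume "h \<in> darts N"
    then obtain d where d: "h = g d" "d \<in> darts M" using img by blast
    show "f (rot N h) = rot M (f h)" using rot[OF d(2)] d fg by metis
    show "f (opp N h) = opp M (f h)" using opp[OF d(2)] d fg by metis
  qed
qed

section \<open>Tours of non-crossing partitions\<close>

text \<open>The part is an explicit argument, which separates the cyclic order inside a part from
  the choice made by \<open>part_of\<close>.\<close>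

definition cyclic_prev :: "nat set \<Rightarrow> nat \<Rightarrow> nat" where
  "cyclic_prev b i = (if \<exists>j\<in>b. j < i then Max {j \<in> b. j < i} else Max b)"
definition cyclic_next :: "nat set \<Rightarrow> nat \<Rightarrow> nat" where
  "cyclic_next b i = (if \<exists>j\<in>b. i < j then Min {j \<in> b. i < j} else Min b)"

lemma prev_in_eq: "prev_in P i = cyclic_prev (part_of P i) i" and next_in_eq: "next_in P i = cyclic_next (part_of P i) i"
  by (simp_all add: prev_in_def next_in_def cyclic_prev_def cyclic_next_def Let_def)

lemma cyclic_prev_next:
  assumes "finite b" "i \<in> b"
  shows "cyclic_prev b i \<in> b" and "cyclic_next b i \<in> b" and "cyclic_next b (cyclic_prev b i) = i" and "cyclic_prev b (cyclic_next b i) = i"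
proof -
  have exploded: "finite {j \<in> b. j < i}" "finite {j \<in> b. i < j}" using assms by auto
  have Mx: "Max {j \<in> b. j < i} \<in> {j \<in> b. j < i}" if "\<exists>j\<in>b. j < i"
    using that by (intro Max_in exploded) auto
  have Mn: "Min {j \<in> b. i < j} \<in> {j \<in> b. i < j}" if "\<exists>j\<in>b. i < j"
    using that by (intro Min_in exploded) auto
  have b: "Max b \<in> b" "Min b \<in> b" using assms by (auto intro: Max_in Min_in)
  have Ge: "Max b \<ge> j" "Min b \<le> j" if "j \<in> b" for j using that assms by auto
  show "cyclic_prev b i \<in> b" using Mx b by (auto simp: cyclic_prev_def)
  show "cyclic_next b i \<in> b" using Mn b by (auto simp: cyclic_next_def)
  show "cyclic_next b (cyclic_prev b i) = i"
  proof (cases "\<exists>j\<in>b. j < i")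
    case True
    have "cyclic_prev b i = Max {j \<in> b. j < i}" using True by (simp add: cyclic_prev_def)
    moreover have "Min {j \<in> b. Max {j \<in> b. j < i} < j} = i"
    proof (rule Min_eqI)
      fix y assume "y \<in> {j \<in> b. Max {j \<in> b. j < i} < j}"
      then have y: "y \<in> b" "Max {j \<in> b. j < i} < y" by auto
      have "y \<le> Max {j \<in> b. j < i}" if "y < i" using y that by (intro Max_ge exploded) auto
      then show "i \<le> y" using y by (meson leD not_le_imp_less)
    qed (use assms Mx[OF True] in auto)
    ultimately show ?thesis using assms Mx[OF True] by (auto simp: cyclic_next_def)
  next
    case False
    then have "cyclic_prev b i = Max b" by (simp add: cyclic_prev_def)
    moreover have "\<not> (\<exists>j\<in>b. Max b < j)" using Ge by (meson leD)
    moreover have "Min b = i" using False assms by (intro Min_eqI) (auto simp: not_less)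
    ultimately show ?thesis by (simp add: cyclic_next_def)
  qed
  show "cyclic_prev b (cyclic_next b i) = i"
  proof (cases "\<exists>j\<in>b. i < j")
    case True
    have "cyclic_next b i = Min {j \<in> b. i < j}" using True by (simp add: cyclic_next_def)
    moreover have "Max {j \<in> b. j < Min {j \<in> b. i < j}} = i"
    proof (rule Max_eqI)
      fix y assume "y \<in> {j \<in> b. j < Min {j \<in> b. i < j}}"
      then have y: "y \<in> b" "y < Min {j \<in> b. i < j}" by auto
      have "Min {j \<in> b. i < j} \<le> y" if "i < y" using y that by (intro Min_le exploded) auto
      then show "y \<le> i" using y by (meson leD not_le_imp_less)
    qed (use assms Mn[OF True] in auto)
    ultimately show ?thesis using assms Mn[OF True] by (auto simp: cyclic_prev_def)
  next
    case False
    then have "cyclic_next b i = Min b" by (simp add: cyclic_next_def)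
    moreover have "\<not> (\<exists>j\<in>b. j < Min b)" using Ge by (meson leD)
    moreover have "Max b = i" using False assms by (intro Max_eqI) (auto simp: not_less)
    ultimately show ?thesis by (simp add: cyclic_prev_def)
  qed
qed

lemma part_of_eq:
  assumes "partition_on A P" "b \<in> P" "i \<in> b"
  shows "part_of P i = b"
  unfolding part_of_def using assms
  by (intro the_equality) (auto simp: partition_on_def disjoint_def)

lemma part_of_in:
  assumes "partition_on A P" "i \<in> A"
  shows "part_of P i \<in> P" "i \<in> part_of P i"
proof -
  obtain b where "b \<in> P" "i \<in> b" using assms by (auto simp: partition_on_def)
  then show "part_of P i \<in> P" "i \<in> part_of P i" using part_of_eq[OF assms(1)] by auto
qed

context
  fixes m :: nat and P :: "nat set set"
  assumes P: "partition_on {1..m} P"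
begin

lemma part_finite: "b \<in> P \<Longrightarrow> finite b" "b \<in> P \<Longrightarrow> b \<subseteq> {1..m}"
proof -
  assume "b \<in> P"
  then show "b \<subseteq> {1..m}" using P by (auto simp: partition_on_def)
  then show "finite b" by (rule finite_subset) simp
qed

lemma prev_next:
  assumes "i \<in> {1..m}"
  shows "prev_in P i \<in> {1..m}" "next_in P i \<in> {1..m}" "next_in P (prev_in P i) = i" "prev_in P (next_in P i) = i"
    "prev_in P i \<in> part_of P i"
proof -
  note b = part_of_in[OF P assms]
  note pn = cyclic_prev_next[OF part_finite(1)[OF b(1)] b(2)]
  show "prev_in P i \<in> {1..m}" "next_in P i \<in> {1..m}" "prev_in P i \<in> part_of P i"
    using pn part_finite(2)[OF b(1)] by (auto simp: prev_in_eq next_in_eq)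
  show "next_in P (prev_in P i) = i" "prev_in P (next_in P i) = i"
    using pn part_of_eq[OF P b(1) pn(1)] part_of_eq[OF P b(1) pn(2)] by (simp_all add: prev_in_eq next_in_eq)
qed

abbreviation (input) "arc_tour n \<equiv> concat (map (\<lambda>i. [Comp i, Part (prev_in P i)]) (rev [1..<Suc n]))"

text \<open>From \<open>Comp i\<close> the motion crosses to \<open>Part i\<close> and turns to the
  predecessor of \<open>i\<close>. The arc of the predecessor ends at \<open>i\<close>, so the next
  move leads on to \<open>Comp (i - 1)\<close>: the indices of \<open>Comp\<close> run down one by
  one, however the parts jump.\<close>

lemma Upsilon_steps:
  defines "N \<equiv> Upsilon m P"
  shows "steps (motion N (edge_darts N)) Inf (arc_tour m) Inf"
proof -
  let ?m = "motion N (edge_darts N)"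
  have "steps ?m x (arc_tour n) Inf" if "n \<le> m" "?m x = (if n = 0 then Inf else Comp n)" for n x
    using that
  proof (induction n arbitrary: x)
    case (Suc n)
    have i: "Suc n \<in> {1..m}" using Suc.prems by simp
    have "?m (Comp (Suc n)) = Part (prev_in P (Suc n))"
      using i by (auto simp: motion_def N_def Upsilon_def edge_darts_def Let_def)
    moreover have "?m (Part (prev_in P (Suc n))) = (if n = 0 then Inf else Comp n)"
      using i prev_next[OF i] by (auto simp: motion_def N_def Upsilon_def edge_darts_def Let_def)
    ultimately show ?case using Suc by simp
  qed simp
  moreover have "?m Inf = (if m = 0 then Inf else Comp m)"
    by (auto simp: motion_def N_def Upsilon_def edge_darts_def Let_def)
  ultimately show ?thesis by blast
qed

lemma Upsilon_tour_set: "insert Inf (set (arc_tour m)) = darts (Upsilon m P)"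
  and Upsilon_tour_distinct: "distinct (Inf # arc_tour m)"
proof -
  have "prev_in P ` {1..m} = {1..m}"
  proof
    show "prev_in P ` {1..m} \<subseteq> {1..m}" using prev_next(1) by blast
    show "{1..m} \<subseteq> prev_in P ` {1..m}"
    proof
      fix i assume i: "i \<in> {1..m}"
      show "i \<in> prev_in P ` {1..m}"
        using prev_next(4)[OF i] prev_next(2)[OF i] by (metis imageI)
    qed
  qed
  then have "Part ` prev_in P ` {1..m} = Part ` {1..m}" by simp
  moreover have "set (arc_tour m) = Comp ` {1..m} \<union> Part ` prev_in P ` {1..m}"
    by (auto simp: atLeastLessThanSuc_atLeastAtMost simp del: upt_Suc)
  ultimately have s: "set (arc_tour m) = Comp ` {1..m} \<union> Part ` {1..m}" by simp
  then show "insert Inf (set (arc_tour m)) = darts (Upsilon m P)" by (auto simp: Upsilon_def Let_def)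
  have "card (set (arc_tour m)) = 2 * m"
    unfolding s by (subst card_Un_disjoint) (auto simp: card_image inj_on_def)
  moreover have "length (arc_tour m) = 2 * m"
    by (simp add: length_concat comp_def sum_list_triv del: upt_Suc)
  ultimately have "distinct (arc_tour m)" by (intro card_distinct) simp
  then show "distinct (Inf # arc_tour m)" using s by auto
qed

end

text \<open>From its maximum a part of \<open>P\<close> is swept out downwards by
  \<open>prev_in\<close>, which never leaves the part of \<open>Q\<close> that contains this
  maximum.\<close>

lemma part_subset_of_prev_eq:
  assumes P: "partition_on {1..m} P" "partition_on {1..m} Q" and pq: "\<And>i. i \<in> {1..m} \<Longrightarrow> prev_in P i = prev_in Q i"
    and b: "b \<in> P"
  shows "\<exists>b'\<in>Q. b \<subseteq> b'"
proof -
  have exploded: "finite b" "b \<subseteq> {1..m}" "b \<noteq> {}" using part_finite[OF P(1) b] b P(1) by (auto simp: partition_on_def)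
  have mx: "Max b \<in> b" using exploded by simp
  define b' where "b' = part_of Q (Max b)"
  have b': "b' \<in> Q" "Max b \<in> b'" using part_of_in[OF P(2)] subsetD[OF exploded(2) mx] by (auto simp: b'_def)
  have "j \<in> b'" if "j \<in> b" for j
    using that
  proof (induction "Max b - j" arbitrary: j rule: less_induct)
    case less
    show ?case
    proof (cases "j = Max b")
      case False
      then have "j < Max b" using less.prems exploded by (meson Max_ge le_neq_implies_less)
      then have ex: "\<exists>k\<in>b. j < k" using mx by blast
      define k where "k = cyclic_next b j"
      have "k = Min {k \<in> b. j < k}" using ex by (simp add: k_def cyclic_next_def)
      moreover have "Min {k \<in> b. j < k} \<in> {k \<in> b. j < k}" using exploded ex by (intro Min_in) auto
      ultimately have k: "k \<in> b" "j < k" by auto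
      have "cyclic_prev b k = j" using cyclic_prev_next(4)[OF exploded(1) less.prems] by (simp add: k_def)
      moreover have "part_of P k = b" using part_of_eq[OF P(1) b k(1)] .
      moreover have kb': "k \<in> b'" using less.hyps[of k] k \<open>j < Max b\<close> by simp
      moreover have "part_of Q k = b'" using part_of_eq[OF P(2) b'(1) kb'] .
      moreover have "k \<in> {1..m}" using k exploded by auto
      ultimately show ?thesis using pq[of k] prev_next(5)[OF P(2), of k] by (simp add: prev_in_eq)
    qed (use b' in simp)
  qed
  then show ?thesis using b' by blast
qed

lemma partition_le_eq:
  assumes "partition_on A P" "partition_on A Q" "\<forall>b\<in>P. \<exists>c\<in>Q. b \<subseteq> c" "\<forall>b\<in>Q. \<exists>c\<in>P. b \<subseteq> c"
  shows "P \<subseteq> Q"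
proof
  fix b assume b: "b \<in> P"
  then obtain c where c: "c \<in> Q" "b \<subseteq> c" using assms by blast
  then obtain d where d: "d \<in> P" "c \<subseteq> d" using assms by blast
  have "b \<noteq> {}" using assms(1) b by (auto simp: partition_on_def)
  then have "b \<inter> d \<noteq> {}" using c d by blast
  then have "b = d" using assms(1) b d by (auto simp: partition_on_def disjoint_def)
  then show "b \<in> Q" using c d by auto
qed

text \<open>Both isomorphisms respect the root, and following the tour down from \<open>m\<close>
  they agree on every \<open>Comp i\<close>, hence on every \<open>Part i\<close>. Rotating at
  \<open>Part i\<close> then identifies the predecessors of \<open>i\<close> in the two partitions,
  and these determine the parts.\<close>

lemma Upsilon_unique:
  assumes P: "partition_on {1..m} P" "partition_on {1..n} Q"
    and iso: "rmap_iso (Upsilon m P) N" "rmap_iso (Upsilon n Q) N"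
  shows "m = n \<and> P = Q"
proof -
  let ?U = "Upsilon m P" and ?W = "Upsilon n Q"
  obtain f where f: "bij_betw f (darts ?U) (darts N)" "f (root ?U) = root N"
    "\<And>h. h \<in> darts ?U \<Longrightarrow> f (rot ?U h) = rot N (f h) \<and> f (opp ?U h) = opp N (f h)"
    using iso(1) unfolding rmap_iso_def by blast
  obtain g where g: "bij_betw g (darts ?W) (darts N)" "g (root ?W) = root N"
    "\<And>h. h \<in> darts ?W \<Longrightarrow> g (rot ?W h) = rot N (g h) \<and> g (opp ?W h) = opp N (g h)"
    using iso(2) unfolding rmap_iso_def by blast
  have "card (darts (Upsilon m P)) = 2 * m + 1" for m P
  proof -
    have "card (Part ` {1..m} \<union> Comp ` {1..m}) = m + m"
      by (subst card_Un_disjoint) (auto simp: card_image inj_on_def)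
    moreover have "Inf \<notin> Part ` {1..m} \<union> Comp ` {1..m}" by auto
    ultimately show ?thesis by (simp add: Upsilon_def Let_def)
  qed
  moreover have "card (darts ?U) = card (darts ?W)"
    using bij_betw_same_card[OF f(1)] bij_betw_same_card[OF g(1)] by simp
  ultimately have mn: "m = n" by (metis add_right_cancel mult_cancel1 zero_neq_numeral)
  have D: "darts ?W = darts ?U" "root ?U = Inf" "root ?W = Inf" "Inf \<in> darts ?U"
    "\<And>i. Comp i \<in> darts ?U \<longleftrightarrow> i \<in> {1..m}" "\<And>i. Part i \<in> darts ?U \<longleftrightarrow> i \<in> {1..m}"
    using mn by (auto simp: Upsilon_def Let_def)
  have rU: "d \<in> darts ?U \<Longrightarrow> rot ?U d = arc_rot m P d" "d \<in> darts ?U \<Longrightarrow> opp ?U d = arc_opp d" for d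
    by (auto simp: Upsilon_def Let_def)
  have rW: "d \<in> darts ?U \<Longrightarrow> rot ?W d = arc_rot m Q d" "d \<in> darts ?U \<Longrightarrow> opp ?W d = arc_opp d" for d
    using mn by (auto simp: Upsilon_def Let_def)
  have rot: "f (arc_rot m P d) = g (arc_rot m Q e)" and opp: "f (arc_opp d) = g (arc_opp e)"
    if "f d = g e" "d \<in> darts ?U" "e \<in> darts ?U" for d e
    using f(3)[of d] g(3)[of e] that rU[of d] rW[of e] D(1) by auto
  have Q: "partition_on {1..m} Q" using P mn by simp
  have C: "f (Comp i) = g (Comp i)" if "i \<in> {1..m}" for i
    using that
  proof (induction "m - i" arbitrary: i rule: less_induct)
    case less
    show ?case
    proof (cases "i = m")
      case True
      then show ?thesis using rot[of Inf Inf] f(2) g(2) D less.prems by auto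
    next
      case False
      then have s: "Suc i \<in> {1..m}" "m - Suc i < m - i" using less.prems by auto
      have "f (Comp (Suc i)) = g (Comp (Suc i))" using less.hyps[of "Suc i"] s by blast
      then have "f (Part (Suc i)) = g (Part (Suc i))" using opp[of "Comp (Suc i)" "Comp (Suc i)"] s D by simp
      then have "f (Part (prev_in P (Suc i))) = g (Part (prev_in Q (Suc i)))"
        using rot[of "Part (Suc i)" "Part (Suc i)"] s D by simp
      moreover note pn = prev_next[OF P(1) s(1)] prev_next[OF Q s(1)]
      ultimately have "f (Comp (prev_in P (Suc i))) = g (Comp (prev_in Q (Suc i)))"
        using opp[of "Part (prev_in P (Suc i))" "Part (prev_in Q (Suc i))"] D by simp
      \<comment> \<open>In either partition the arc that leaves the predecessor of
        \<open>Suc i\<close> ends at \<open>Suc i\<close>, so turning on gives \<open>Comp i\<close>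
        on both sides.\<close>
      then have "f (arc_rot m P (Comp (prev_in P (Suc i)))) = g (arc_rot m Q (Comp (prev_in Q (Suc i))))"
        using rot pn D by metis
      then show ?thesis using pn less.prems by simp
    qed
  qed
  have pr: "prev_in P i = prev_in Q i" if i: "i \<in> {1..m}" for i
  proof -
    have Pt: "f (Part i) = g (Part i)" if "i \<in> {1..m}" for i using opp[OF C[OF that]] D that by simp
    have "g (Part (prev_in P i)) = g (Part (prev_in Q i))"
      using rot[OF Pt[OF i]] Pt[OF prev_next(1)[OF P(1) i]] D i by simp
    moreover have "inj_on g (darts ?U)" using g(1) D by (simp add: bij_betw_def)
    ultimately show ?thesis
      using prev_next(1)[OF P(1) i] prev_next(1)[OF Q i] D by (auto dest!: inj_onD)
  qed
  have "\<forall>b\<in>P. \<exists>b'\<in>Q. b \<subseteq> b'" "\<forall>b\<in>Q. \<exists>b'\<in>P. b \<subseteq> b'"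
    using part_subset_of_prev_eq[OF P(1) Q] part_subset_of_prev_eq[OF Q P(1)] pr by auto
  then have "P = Q" using partition_le_eq[OF P(1) Q] partition_le_eq[OF Q P(1)] by blast
  then show ?thesis using mn by blast
qed

section \<open>The partition of a binary tree\<close>

primrec top_label :: "'a lbtree \<Rightarrow> 'a \<Rightarrow> 'a" where
  "top_label (LLeaf a) q = q"
| "top_label (LNode s l r) q = s"

text \<open>The pairs \<open>(x, y)\<close> where \<open>y\<close> follows \<open>x\<close> cyclically on its right chain; \<open>q\<close> is the top of the
  chain through the root. The tour of \<open>\<theta>(B)\<close> meets \<open>Comp x\<close> and then \<open>Part y\<close>.\<close>

primrec chain_steps :: "'a \<Rightarrow> 'a lbtree \<Rightarrow> ('a \<times> 'a) list" where
  "chain_steps q (LLeaf a) = []"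
| "chain_steps q (LNode s l r) = chain_steps (top_label l s) l @ (s, top_label r q) # chain_steps q r"

text \<open>The right chain through the root; \<open>others\<close> collects the right chains that
  start at left sons. A left son that is a leaf starts none, which is why the empty set is removed
  there.\<close>

primrec chain :: "'a lbtree \<Rightarrow> 'a set" where
  "chain (LLeaf a) = {}"
| "chain (LNode s l r) = insert s (chain r)"

primrec others :: "'a lbtree \<Rightarrow> 'a set set" where
  "others (LLeaf a) = {}"
| "others (LNode s l r) = others l \<union> others r \<union> ({chain l} - {{}})"

lemma fst_chain_steps: "map fst (chain_steps q t) = inorder t"
  by (induction t arbitrary: q) auto

lemma chain_subset: "chain t \<subseteq> set (inorder t)" "finite (chain t)"
  by (induction t) auto

lemma parts_union: "chain t \<union> \<Union> (others t) = set (inorder t)"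
  by (induction t) auto

lemma parts_disjoint:
  assumes "distinct (inorder t)"
  shows "(\<forall>b\<in>others t. b \<noteq> {} \<and> b \<inter> chain t = {}) \<and> (\<forall>b\<in>others t. \<forall>c\<in>others t. b \<noteq> c \<longrightarrow> b \<inter> c = {})"
  using assms
proof (induction t)
  case (LNode s l r)
  have sub: "b \<subseteq> set (inorder t)" if "b \<in> insert (chain t) (others t)" for b and t :: "'a lbtree"
    using parts_union[of t] that by auto
  have d: "distinct (inorder l)" "distinct (inorder r)" "s \<notin> set (inorder l)" "s \<notin> set (inorder r)"
    "set (inorder l) \<inter> set (inorder r) = {}"
    using LNode.prems by auto
  have memb: "b \<in> insert (chain l) (others l) \<and> b \<noteq> {} \<or> b \<in> others r" if "b \<in> others (LNode s l r)" for b
    using that LNode.IH(1)[OF d(1)] by auto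
  have l: "b \<inter> c = {}" if "b \<in> insert (chain l) (others l)" "c \<in> insert (chain l) (others l)" "b \<noteq> c" for b c
    using that LNode.IH(1)[OF d(1)] by blast
  have lr: "b \<inter> insert s (set (inorder r)) = {}" if "b \<in> insert (chain l) (others l)" for b
    using sub[OF that] d by auto
  have 1: "b \<noteq> {} \<and> b \<inter> chain (LNode s l r) = {}" if "b \<in> others (LNode s l r)" for b
    using memb[OF that]
  proof
    assume "b \<in> insert (chain l) (others l) \<and> b \<noteq> {}"
    then show ?thesis using lr[of b] chain_subset(1)[of r] by auto
  next
    assume "b \<in> others r"
    then show ?thesis using LNode.IH(2)[OF d(2)] sub[of b r] d by auto
  qed
  have 2: "b \<inter> c = {}" if "b \<in> others (LNode s l r)" "c \<in> others (LNode s l r)" "b \<noteq> c" for b c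
  proof -
    have "b \<inter> c = {}" if "b \<in> insert (chain l) (others l)" "c \<in> others r" for b c
      using lr[OF that(1)] sub[of c r] that(2) by blast
    then show ?thesis using memb[OF that(1)] memb[OF that(2)] l[of b c] that(3) LNode.IH(2)[OF d(2)] by blast
  qed
  show ?case using 1 2 by blast
qed auto

lemma partition_parts:
  assumes "distinct (inorder t)" "t = LNode s l r"
  shows "partition_on (set (inorder t)) (insert (chain t) (others t))"
  unfolding partition_on_def
proof (intro conjI)
  show "\<Union> (insert (chain t) (others t)) = set (inorder t)" using parts_union[of t] by simp
  show "disjoint (insert (chain t) (others t))"
    using parts_disjoint[OF assms(1)] unfolding disjoint_def by blast
  show "{} \<notin> insert (chain t) (others t)" 
  proof -
    have "chain t \<noteq> {}" using assms(2) by simp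
    then show ?thesis using parts_disjoint[OF assms(1)] by blast
  qed
qed

text \<open>Labels decrease in inorder, so the left subtrees along the root chain fill the gaps
  above its elements, and no element of this chain lies between two elements of another part. This
  first claim is the strengthening that the induction uses when \<open>chain l\<close> becomes one
  of \<open>others\<close>.\<close>

lemma parts_noncrossing:
  fixes t :: "nat lbtree"
  assumes "sorted_wrt (>) (inorder t)"
  shows "(\<forall>b i j k. b \<in> others t \<longrightarrow> i \<in> b \<longrightarrow> k \<in> b \<longrightarrow> j \<in> chain t \<longrightarrow> i < j \<longrightarrow> j < k \<longrightarrow> False) \<and>
    (\<forall>b c i j k h. b \<in> others t \<longrightarrow> c \<in> others t \<longrightarrow> i \<in> b \<longrightarrow> k \<in> b \<longrightarrow> j \<in> c \<longrightarrow> h \<in> c \<longrightarrow>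
      i < j \<longrightarrow> j < k \<longrightarrow> k < h \<longrightarrow> b = c)"
  using assms
proof (induction t)
  case (LNode s l r)
  have sub: "b \<subseteq> set (inorder t)" if "b \<in> insert (chain t) (others t)" for b and t :: "nat lbtree"
    using parts_union[of t] that by auto
  have o: "sorted_wrt (>) (inorder l)" "sorted_wrt (>) (inorder r)"
    "\<And>x. x \<in> set (inorder l) \<Longrightarrow> s < x" "\<And>x. x \<in> set (inorder r) \<Longrightarrow> x < s"
    "\<And>x y. x \<in> set (inorder l) \<Longrightarrow> y \<in> set (inorder r) \<Longrightarrow> y < x"
    using LNode.prems by (auto simp: sorted_wrt_append)
  have memb: "b \<in> insert (chain l) (others l) \<or> b \<in> others r" if "b \<in> others (LNode s l r)" for b
    using that by auto
  note IHl = LNode.IH(1)[OF o(1)] and IHr = LNode.IH(2)[OF o(2)]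
  have 1: False if b: "b \<in> others (LNode s l r)" "i \<in> b" "k \<in> b" "j \<in> chain (LNode s l r)" "i < j" "j < k" for b i j k
  proof -
    have j: "j = s \<or> j \<in> chain r" using b by auto
    then have js: "j = s \<or> j \<in> set (inorder r)" using chain_subset(1)[of r] by auto
    from memb[OF b(1)] show ?thesis
    proof
      assume "b \<in> insert (chain l) (others l)"
      then have "i \<in> set (inorder l)" using sub[of b l] b by auto
      then show False using js o(3)[of i] o(5)[of i j] b by auto
    next
      assume br: "b \<in> others r"
      then have "k < s" using sub[of b r] b o(4) by auto
      then have "j \<in> chain r" using j b by auto
      then show False using IHr br b by blast
    qed
  qed
  have 2: "b = c" if b: "b \<in> others (LNode s l r)" "c \<in> others (LNode s l r)" "i \<in> b" "k \<in> b" "j \<in> c" "h \<in> c"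
    "i < j" "j < k" "k < h" for b c i j k h
  proof -
    consider "b \<in> insert (chain l) (others l)" "c \<in> insert (chain l) (others l)"
      | "b \<in> insert (chain l) (others l)" "c \<in> others r"
      | "b \<in> others r" "c \<in> insert (chain l) (others l)"
      | "b \<in> others r" "c \<in> others r" using memb b(1,2) by blast
    then show ?thesis
    proof cases
      case 1
      then show ?thesis using IHl b(3-) by blast
    next
      case 2
      then have "i \<in> set (inorder l)" "j \<in> set (inorder r)" using sub[of b l] sub[of c r] b by auto
      then show ?thesis using o(5)[of i j] b by auto
    next
      case 3
      then have "k \<in> set (inorder r)" "j \<in> set (inorder l)" using sub[of b r] sub[of c l] b by auto
      then show ?thesis using o(5)[of j k] b by auto
    next
      case 4
      then show ?thesis using IHr b(3-) by blast
    qed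
  qed
  show ?case using 1 2 by blast
qed auto

lemma noncrossing_parts:
  fixes t :: "nat lbtree"
  assumes i: "inorder t = rev [1..<Suc m]" and t: "t = LNode s l r"
  shows "noncrossing_partition m (insert (chain t) (others t))"
  unfolding noncrossing_partition_def
proof (intro conjI ballI impI)
  have s: "sorted_wrt (>) (inorder t)"
    unfolding i sorted_wrt_rev using sorted_wrt_upt[of 1 "Suc m"] by (simp del: upt_Suc)
  have d: "distinct (inorder t)" unfolding i by simp
  have "set (inorder t) = {1..m}" unfolding i by auto
  then show "partition_on {1..m} (insert (chain t) (others t))" using partition_parts[OF d t] by simp
  fix b c i k j h
  assume "b \<in> insert (chain t) (others t)" "c \<in> insert (chain t) (others t)" "i \<in> b" "k \<in> b" "j \<in> c" "h \<in> c"
    "i < j \<and> j < k \<and> k < h"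
  then show "b = c"
    using parts_noncrossing[OF s] by blast
qed

text \<open>\<open>Q\<close> holds the elements of the chain above the root of \<open>t\<close> and
  grows when the induction passes to a right son. Labels decrease down the chain, so a right son is
  the predecessor of its father, and the end of the chain wraps around to the maximum
  \<open>q\<close>.\<close>

lemma chain_steps_prev:
  fixes t :: "nat lbtree"
  assumes "(x, y) \<in> set (chain_steps q t)" "sorted_wrt (>) (inorder t)" "finite Q"
    and "\<And>z s. z \<in> Q \<Longrightarrow> s \<in> set (inorder t) \<Longrightarrow> s < z"
    and "Max (Q \<union> chain t) = q"
  shows "\<exists>b\<in>insert (Q \<union> chain t) (others t). x \<in> b \<and> y = cyclic_prev b x"
  using assms
proof (induction t arbitrary: q Q)
  case (LNode s l r)
  have o: "sorted_wrt (>) (inorder l)" "sorted_wrt (>) (inorder r)"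
    "\<And>x. x \<in> set (inorder l) \<Longrightarrow> s < x" "\<And>x. x \<in> set (inorder r) \<Longrightarrow> x < s"
    "\<And>x y. x \<in> set (inorder l) \<Longrightarrow> y \<in> set (inorder r) \<Longrightarrow> y < x"
    using LNode.prems by (auto simp: sorted_wrt_append)
  have Max_chain: "Max (chain t) = top_label t q" if "sorted_wrt (>) (inorder t)" "chain t \<noteq> {}" for t :: "nat lbtree" and q
  proof (cases t)
    case (LNode s' l' r')
    then have "\<forall>x\<in>chain r'. x < s'" using that(1) chain_subset(1)[of r'] by (auto simp: sorted_wrt_append)
    then show ?thesis using LNode chain_subset(2)[of r'] by (intro Max_eqI) auto
  qed (use that in auto)
  from LNode.prems(1) consider "(x, y) \<in> set (chain_steps (top_label l s) l)" | "x = s" "y = top_label r q" | "(x, y) \<in> set (chain_steps q r)"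
    by auto
  then show ?case
  proof cases
    case 1
    then have ne: "chain l \<noteq> {}" by (cases l) auto
    have "\<exists>b\<in>insert ({} \<union> chain l) (others l). x \<in> b \<and> y = cyclic_prev b x"
      by (rule LNode.IH(1)[OF 1 o(1)]) (use Max_chain[OF o(1) ne] in auto)
    then show ?thesis using ne by auto
  next
    case 2
    let ?b = "Q \<union> chain (LNode s l r)"
    have "y = cyclic_prev ?b x"
    proof (cases "chain r = {}")
      case True
      then have "top_label r q = q" by (cases r) auto
      moreover have "\<not> (\<exists>j\<in>?b. j < s)" using True LNode.prems(4)[of _ s] by (auto simp: not_less intro: less_imp_le)
      ultimately show ?thesis using 2 LNode.prems(5) by (simp add: cyclic_prev_def)
    next
      case False
      have "{j \<in> ?b. j < s} = chain r"
        using LNode.prems(4)[of _ s] o(4) chain_subset(1)[of r] by force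
      then show ?thesis using 2 False Max_chain[OF o(2) False, of q] by (auto simp: cyclic_prev_def)
    qed
    then show ?thesis using 2 by auto
  next
    case 3
    have "\<exists>b\<in>insert (insert s Q \<union> chain r) (others r). x \<in> b \<and> y = cyclic_prev b x"
      by (rule LNode.IH(2)[OF 3 o(2)]) (use LNode.prems(3-5) o in \<open>auto simp: insert_commute\<close>)
    then show ?thesis by auto
  qed
qed auto

lemma chain_steps_eq:
  fixes t :: "nat lbtree"
  assumes i: "inorder t = rev [1..<Suc m]" and t: "t = LNode s l r"
  defines "P \<equiv> insert (chain t) (others t)"
  shows "chain_steps (top_label t q) t = map (\<lambda>x. (x, prev_in P x)) (rev [1..<Suc m])"
proof -
  have s: "sorted_wrt (>) (inorder t)"
    unfolding i sorted_wrt_rev using sorted_wrt_upt[of 1 "Suc m"] by (simp del: upt_Suc)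
  have P: "partition_on {1..m} P"
    using noncrossing_parts[OF i t] by (simp add: noncrossing_partition_def P_def)
  have "Max (chain t) = top_label t q"
  proof -
    have "\<forall>x\<in>chain r. x < s" using s t chain_subset(1)[of r] by (auto simp: sorted_wrt_append)
    then show ?thesis using t chain_subset(2)[of r] by (intro Max_eqI) auto
  qed
  then have m: "Max ({} \<union> chain t) = top_label t q" by simp
  have "y = prev_in P x" if xy: "(x, y) \<in> set (chain_steps (top_label t q) t)" for x y
  proof -
    obtain b where "b \<in> P" "x \<in> b" "y = cyclic_prev b x"
      using chain_steps_prev[OF xy s _ _ m] by (auto simp: P_def)
    then show ?thesis using part_of_eq[OF P] by (simp add: prev_in_eq)
  qed
  then have "chain_steps (top_label t q) t = map (\<lambda>(x, y). (x, prev_in P x)) (chain_steps (top_label t q) t)"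
    by (intro map_idI[symmetric]) auto
  also have "\<dots> = map (\<lambda>x. (x, prev_in P x)) (map fst (chain_steps (top_label t q) t))" by (simp add: split_def)
  finally show ?thesis unfolding fst_chain_steps i .
qed

section \<open>The tour of the contracted tree\<close>

fun label_at :: "'a lbtree \<Rightarrow> nat list \<Rightarrow> 'a" where
  "label_at (LNode s l r) [] = s"
| "label_at (LNode s l r) (i # q) = label_at (if i = 0 then l else r) q"
| "label_at (LLeaf a) q = undefined"

definition branches :: "tree_dart \<Rightarrow> bool" where
  "branches d \<longleftrightarrow> branching (pos d) (butlast (pos d))"

text \<open>Exactly one of the two edges below a node branches: the left one below a right son, the
  right one below a left son or the root. So each node owns one edge of the contracted tree, which
  becomes the arc with its label.\<close>

lemma branches_simps:
  "branches (Son (p @ [i])) = branching (p @ [i]) p" "branches (Father (p @ [i])) = branching (p @ [i]) p"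
  "branching (p @ [0]) p \<longleftrightarrow> right_son p" "branching (p @ [Suc 0]) p \<longleftrightarrow> left_son p \<or> p = []"
  by (auto simp: branches_def branching_def right_son_def left_son_def)

lemma tree_tour_shape:
  "tree_tour (shape (BNode l r)) p = Father (p @ [0]) # tree_tour (shape l) (p @ [0]) @ Son (p @ [0]) #
     Father (p @ [Suc 0]) # tree_tour (shape r) (p @ [Suc 0]) @ [Son (p @ [Suc 0])]"
  "tree_tour (shape (Leaf a)) p = []"
  by simp_all

abbreviation "arcs ps \<equiv> concat (map (\<lambda>(x, y). [Comp x, Part y]) ps)"

text \<open>The \<open>Comp\<close> half of a node is always met between its two subtrees. Its
  \<open>Part\<close> half is met last at a left son or the root, but on entry at a right son, where
  it completes the pair begun by the \<open>Comp\<close> half of the father. Hence the claim for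
  right sons is shifted by one entry, with \<open>Part q\<close> supplied from outside.\<close>

lemma arcs_shape:
  assumes "\<And>q. G (Father (p @ q @ [1])) = Comp (label_at t q) \<and> G (Son (p @ q @ [1])) = Part (label_at t q) \<and>
    G (Son (p @ q @ [0])) = Comp (label_at t q) \<and> G (Father (p @ q @ [0])) = Part (label_at t q)"
  shows "(left_son p \<or> p = [] \<longrightarrow> (\<forall>q. map G (filter branches (tree_tour (shape (unlabel t)) p)) = arcs (chain_steps (top_label t q) t))) \<and>
    (right_son p \<longrightarrow>
      (\<forall>q. map G (filter branches (tree_tour (shape (unlabel t)) p)) @ [Part q] = Part (top_label t q) # arcs (chain_steps q t)))"
  using assms
proof (induction t arbitrary: p)
  case (LNode s l r)
  let ?w = "\<lambda>t p. map G (filter branches (tree_tour (shape (unlabel t)) p))"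
  have here: "G (Father (p @ [Suc 0])) = Comp s" "G (Son (p @ [Suc 0])) = Part s"
    "G (Son (p @ [0])) = Comp s" "G (Father (p @ [0])) = Part s"
    using LNode.prems[of "[]"] by simp_all
  have l: "?w l (p @ [0]) = arcs (chain_steps (top_label l q) l)" for q
    using LNode.IH(1)[of "p @ [0]"] LNode.prems[of "0 # _"] by (simp add: left_son_def)
  have r: "?w r (p @ [Suc 0]) @ [Part q] = Part (top_label r q) # arcs (chain_steps q r)" for q
    using LNode.IH(2)[of "p @ [Suc 0]"] LNode.prems[of "1 # _"] by (simp add: right_son_def)
  have 1: "?w (LNode s l r) p = arcs (chain_steps (top_label (LNode s l r) q) (LNode s l r))" if p: "left_son p \<or> p = []" for q
  proof -
    have "\<not> right_son p" using p by (auto simp: right_son_def left_son_def)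
    then have "?w (LNode s l r) p = ?w l (p @ [0]) @ Comp s # (?w r (p @ [Suc 0]) @ [Part s])"
      using p here by (simp add: tree_tour_shape branches_simps del: shape.simps)
    also have "\<dots> = arcs (chain_steps (top_label (LNode s l r) q) (LNode s l r))"
      unfolding l[of s] r[of s] by simp
    finally show ?thesis .
  qed
  have 2: "?w (LNode s l r) p @ [Part q] = Part (top_label (LNode s l r) q) # arcs (chain_steps q (LNode s l r))"
    if p: "right_son p" for q
  proof -
    have "\<not> (left_son p \<or> p = [])" using p by (auto simp: right_son_def left_son_def)
    then have "?w (LNode s l r) p @ [Part q] =
        Part s # ?w l (p @ [0]) @ Comp s # (?w r (p @ [Suc 0]) @ [Part q])"
      using p here by (simp add: tree_tour_shape branches_simps del: shape.simps)
    also have "\<dots> = Part (top_label (LNode s l r) q) # arcs (chain_steps q (LNode s l r))"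
      unfolding l[of s] r[of q] by simp
    finally show ?thesis .
  qed
  show ?case using 1 2 by blast
qed (auto simp: tree_tour_shape simp del: shape.simps)

definition dart_arc :: "nat lbtree \<Rightarrow> tree_dart \<Rightarrow> arc_dart" where
  "dart_arc t d = (if d = Son [] then Inf else
     let q = butlast (pos d); i = last (pos d)
     in if (case d of Father _ \<Rightarrow> i = 1 | Son _ \<Rightarrow> i = 0) then Comp (label_at t q) else Part (label_at t q))"

lemma theta_tour:
  fixes B :: btree
  defines "N \<equiv> theta B"
  shows "steps (motion N (edge_darts N)) (root N) (filter branches (tree_tour (shape B) [])) (root N)"
    and "insert (root N) (set (filter branches (tree_tour (shape B) []))) = darts N"
    and "root N = Son []"
    and "d \<in> darts N \<Longrightarrow> opp N d = tree_opp d \<and> tree_opp d \<in> darts N \<and> tree_opp (tree_opp d) = d"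
    and "d \<in> darts N \<Longrightarrow> d = Son [] \<or> (branches d \<and> pos d \<noteq> [])"
proof -
  define K where "K = tree_map (shape B)"
  define C where "C = {d \<in> edge_darts K. \<not> branches d}"
  have N: "N = contract K C" by (simp add: N_def theta_def K_def C_def branches_def Let_def)
  define A where "A = darts K - C"
  have K: "darts K = tree_darts (shape B)" "root K = Son []" "\<And>d. d \<in> darts K \<Longrightarrow> opp K d = tree_opp d"
    by (auto simp: K_def tree_map_def)
  have A: "darts N = A" "root N = Son []" by (simp_all add: N contract_def A_def K)
  show "root N = Son []" using A by simp
  have T: "set (tree_tour (shape B) []) = darts K - {Son []}"
    unfolding K(1) set_tree_tour tree_darts_def by auto
  have memA: "d \<in> A \<longleftrightarrow> d = Son [] \<or> (d \<in> set (tree_tour (shape B) []) \<and> branches d)" for d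
    using T root_in_tree_darts[of "shape B"] K by (auto simp: A_def C_def edge_darts_def)
  then have "insert (Son []) (set (filter branches (tree_tour (shape B) []))) = A" by auto
  then show "insert (root N) (set (filter branches (tree_tour (shape B) []))) = darts N" using A by simp
  have oppA: "tree_opp d \<in> A \<and> tree_opp (tree_opp d) = d" if "d \<in> A" for d
  proof -
    have d: "d \<in> tree_darts (shape B)" using that K by (auto simp: A_def)
    have "d \<noteq> Father []" using d by (auto simp: tree_darts_def)
    moreover have "branches (tree_opp d) = branches d"
      by (cases d) (auto simp: branches_def tree_opp_def)
    moreover have "d \<noteq> Son [] \<Longrightarrow> tree_opp d \<noteq> Son []" using \<open>d \<noteq> Father []\<close>
      by (cases d) (auto simp: tree_opp_def)
    ultimately show ?thesis using that memA[of d] memA[of "tree_opp d"] T tree_opp_in[OF d] K tree_opp_opp[of d]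
      by (auto simp: tree_opp_def)
  qed
  then show "d \<in> darts N \<Longrightarrow> opp N d = tree_opp d \<and> tree_opp d \<in> darts N \<and> tree_opp (tree_opp d) = d"
    unfolding A using K(3) by (auto simp: N contract_def A_def)
  show "d \<in> darts N \<Longrightarrow> d = Son [] \<or> (branches d \<and> pos d \<noteq> [])"
    unfolding A memA using T K(1) by (cases d) (auto simp: tree_darts_def)
  have "steps (motion N (edge_darts N)) (Son []) (filter (\<lambda>d. d \<in> A) (tree_tour (shape B) [])) (Son [])"
  proof (rule steps_induced[where a = "opp K" and f = "motion K C"])
    show "steps (motion K (edge_darts K)) (Son []) (tree_tour (shape B) []) (Son [])"
      using tree_map_tour(1) unfolding K_def .
    show "Son [] \<in> A" "Son [] \<in> A" using memA by auto
    show "motion N (edge_darts N) x = induced A (motion K C) (opp K x)" if "x \<in> A" for x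
    proof -
      have "x \<in> darts K" "x \<notin> C" using that by (auto simp: A_def)
      then show ?thesis
        using that K by (auto simp: motion_def edge_darts_def A N contract_def A_def tree_opp_def)
    qed
    show "motion K C (opp K x) = motion K (edge_darts K) x" if "x \<in> A" for x
    proof -
      have "x \<in> darts K" "opp K x \<notin> C" using that oppA[OF that] K by (auto simp: A_def)
      then show ?thesis using K by (auto simp: motion_def edge_darts_def tree_opp_def)
    qed
    show "opp K x \<in> A" if "x \<in> A" for x using oppA[OF that] K that by (auto simp: A_def)
    show "motion K C x = motion K (edge_darts K) x" if "x \<notin> A" for x
      using that by (auto simp: motion_def A_def C_def edge_darts_def)
  qed
  moreover have "filter (\<lambda>d. d \<in> A) (tree_tour (shape B) []) = filter branches (tree_tour (shape B) [])"
    using memA T by (intro filter_cong) auto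
  ultimately show "steps (motion N (edge_darts N)) (root N) (filter branches (tree_tour (shape B) [])) (root N)"
    using A by simp
qed

lemma Theta_unlabel:
  fixes t :: "nat lbtree"
  assumes i: "inorder t = rev [1..<Suc m]" and t: "t = LNode s l r"
  shows "Theta (unlabel t) = insert (chain t) (others t)"
proof -
  define P where "P = insert (chain t) (others t)"
  have nc: "noncrossing_partition m P" using noncrossing_parts[OF i t] by (simp add: P_def)
  then have P: "partition_on {1..m} P" by (simp add: noncrossing_partition_def)
  have "rmap_iso (Upsilon m P) (theta (unlabel t))"
  proof (rule rmap_iso_tourI[OF theta_tour(1,2)])
    \<comment> \<open>The argument 0 is arbitrary: \<open>top_label\<close> ignores it at a
      node.\<close>
    have "map (dart_arc t) (filter branches (tree_tour (shape (unlabel t)) [])) = arcs (chain_steps (top_label t 0) t)"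
      using arcs_shape[of "dart_arc t" "[]" t] by (simp add: dart_arc_def del: shape.simps)
    also have "\<dots> = arc_tour P m" unfolding chain_steps_eq[OF i t] P_def by (simp add: comp_def del: upt_Suc)
    finally show "map (dart_arc t) (filter branches (tree_tour (shape (unlabel t)) [])) = arc_tour P m" .
    have "root (Upsilon m P) = Inf" by (simp add: Upsilon_def Let_def)
    then show "steps (motion (Upsilon m P) (edge_darts (Upsilon m P))) (root (Upsilon m P)) (arc_tour P m) (root (Upsilon m P))"
      "insert (root (Upsilon m P)) (set (arc_tour P m)) = darts (Upsilon m P)"
      "dart_arc t (root (theta (unlabel t))) = root (Upsilon m P)"
      "distinct (root (Upsilon m P) # arc_tour P m)"
      using Upsilon_steps[OF P] Upsilon_tour_set[OF P] Upsilon_tour_distinct[OF P] theta_tour(3)[of "unlabel t"]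
      by (simp_all add: dart_arc_def del: upt_Suc)
    show "opp (theta (unlabel t)) (root (theta (unlabel t))) = root (theta (unlabel t))"
      using theta_tour(2)[of "unlabel t"] theta_tour(3)[of "unlabel t"] theta_tour(4)[of "root (theta (unlabel t))" "unlabel t"]
      by (auto simp: tree_opp_def)
    fix d assume d: "d \<in> darts (theta (unlabel t))"
    have "dart_arc t d \<in> darts (Upsilon m P)"
    proof -
      have "dart_arc t d \<in> insert Inf (set (arc_tour P m))"
        using d theta_tour(2)[of "unlabel t"] theta_tour(3)[of "unlabel t"]
          \<open>map (dart_arc t) (filter branches (tree_tour (shape (unlabel t)) [])) = arc_tour P m\<close>
        by (metis (no_types, lifting) dart_arc_def imageI insert_iff set_map)
      then show ?thesis unfolding Upsilon_tour_set[OF P] .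
    qed
    then have "opp (Upsilon m P) (dart_arc t d) = arc_opp (dart_arc t d)" by (simp add: Upsilon_def Let_def)
    moreover have "dart_arc t (tree_opp d) = arc_opp (dart_arc t d)"
    proof (cases "d = Son []")
      case False
      then have "branches d" "pos d \<noteq> []" using theta_tour(5)[OF d] by auto
      then obtain p i where "pos d = p @ [i]" "i = 0 \<or> i = 1"
        by (cases "pos d" rule: rev_cases) (auto simp: branches_def branching_def left_son_def right_son_def)
      then show ?thesis by (cases d) (auto simp: dart_arc_def tree_opp_def Let_def)
    qed (simp add: dart_arc_def tree_opp_def)
    ultimately show "dart_arc t (opp (theta (unlabel t)) d) = opp (Upsilon m P) (dart_arc t d) \<and>
        opp (theta (unlabel t)) d \<in> darts (theta (unlabel t)) \<and> opp (theta (unlabel t)) (opp (theta (unlabel t)) d) = d"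
      using theta_tour(4)[OF d] theta_tour(4)[of "tree_opp d" "unlabel t"] by simp
  qed
  then have "Theta (unlabel t) = P"
    unfolding Theta_def
    using nc Upsilon_unique[OF _ P] by (intro the_equality) (auto simp: noncrossing_partition_def)
  then show ?thesis by (simp add: P_def)
qed

lemma Theta_inactivate_all: "Theta (inactivate_all B) = Theta B"
proof -
  have "shape (inactivate_all B) = shape B" by (induction B) auto
  then show ?thesis by (simp add: Theta_def theta_def)
qed

section \<open>The exploded map\<close>

primrec root_label :: "'a ltree \<Rightarrow> 'a" where
  "root_label (Single s) = s"
| "root_label (Graft t c p) = root_label p"

primrec root_tails :: "'a ltree \<Rightarrow> 'a list" where
  "root_tails (Single s) = []"
| "root_tails (Graft t c p) = root_tails p @ [t]"

primrec tour_word :: "('a \<Rightarrow> 'a) \<Rightarrow> 'a ltree \<Rightarrow> 'a list" where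
  "tour_word f (Single s) = []"
| "tour_word f (Graft t c p) = tour_word f p @ t # tour_word f c @ [f t]"

text \<open>The vertices below the root in preorder, each as a triple of label, tails in rotation
  order, and head. With \<open>f\<close> the \<open>opp\<close> of the map, the head is the other
  half of the edge whose tail is \<open>t\<close>.\<close>

primrec inner :: "('a \<Rightarrow> 'a) \<Rightarrow> 'a ltree \<Rightarrow> ('a \<times> 'a list \<times> 'a) list" where
  "inner f (Single s) = []"
| "inner f (Graft t c p) = inner f p @ (root_label c, root_tails c, f t) # inner f c"

definition nodes :: "('a \<Rightarrow> 'a) \<Rightarrow> 'a \<Rightarrow> 'a ltree \<Rightarrow> ('a \<times> 'a list \<times> 'a) list" where
  "nodes f h t = (root_label t, root_tails t, h) # inner f t"

lemma preorder_inner: "preorder_labels t = root_label t # map fst (inner f t)"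
  by (induction t) auto

lemma fst_nodes: "map fst (nodes f h t) = preorder_labels t"
  by (simp add: nodes_def preorder_inner[of t f])

text \<open>The same half-edges sorted by vertex and by the tour. This carries distinctness and
  completeness of the tour over to the exploded vertices.\<close>

lemma mset_nodes: "mset (concat (map (\<lambda>(s, ts, h). ts @ [h]) (nodes f h t))) = mset (h # tour_word f t)"
proof -
  have "mset (root_tails t) + mset (concat (map (\<lambda>(s, ts, h). ts @ [h]) (inner f t))) = mset (tour_word f t)"
    by (induction t) (auto simp: ac_simps)
  then show ?thesis by (simp add: nodes_def)
qed

text \<open>The head of the vertex at an address, given the head \<open>h\<close> of the root. The
  child whose index is the number of tails of \<open>p\<close> is the one grafted last.\<close>

primrec head_at :: "('a \<Rightarrow> 'a) \<Rightarrow> 'a ltree \<Rightarrow> 'a \<Rightarrow> nat list \<Rightarrow> 'a" where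
  "head_at f (Single s) = (\<lambda>h q. h)"
| "head_at f (Graft t c p) = (\<lambda>h q. case q of [] \<Rightarrow> h
     | i # q' \<Rightarrow> if i = length (root_tails p) then head_at f c (f t) q' else head_at f p h q)"

lemma head_at_Nil [simp]: "head_at f t h [] = h"
  by (cases t) auto

lemma length_kids_erase: "length (kids (erase t)) = length (root_tails t)"
  by (induction t) auto

lemma map_tree_tour_erase:
  assumes "\<And>q. q \<noteq> [] \<Longrightarrow> is_vertex q (erase t) \<Longrightarrow>
      G (Son (p @ q)) = head_at f t h q \<and> G (Father (p @ q)) = f (head_at f t h q)"
    and "\<And>x. x \<in> set (tour_word f t) \<Longrightarrow> f (f x) = x"
  shows "map G (tree_tour (erase t) p) = tour_word f t"
  using assms
proof (induction t arbitrary: p h)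
  case (Graft t c s)
  let ?n = "length (root_tails s)"
  have n: "length (kids (erase s)) = ?n" by (rule length_kids_erase)
  have G: "G (Son (p @ ?n # q)) = head_at f c (f t) q \<and> G (Father (p @ ?n # q)) = f (head_at f c (f t) q)"
    if "is_vertex q (erase c)" for q
    using Graft.prems(1)[of "?n # q"] that n by (simp add: nth_append)
  have "map G (tree_tour (erase s) p) = tour_word f s"
  proof (rule Graft.IH(2))
    fix q assume q: "q \<noteq> []" "is_vertex q (erase s)"
    then obtain i q' where i: "q = i # q'" "i < ?n" using n by (cases q) auto
    then have "head_at f (Graft t c s) h q = head_at f s h q" by simp
    moreover have "is_vertex q (erase (Graft t c s))" using q by (simp add: is_vertex_graft)
    ultimately show "G (Son (p @ q)) = head_at f s h q \<and> G (Father (p @ q)) = f (head_at f s h q)"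
      using Graft.prems(1)[OF q(1)] by simp
  qed (use Graft.prems(2) in auto)
  moreover have "map G (tree_tour (erase c) (p @ [?n])) = tour_word f c"
    by (rule Graft.IH(1)[where h = "f t"]) (use Graft.prems(2) G in auto)
  moreover have "G (Father (p @ [?n])) = t" "G (Son (p @ [?n])) = f t"
    using G[of "[]"] Graft.prems(2)[of t] by auto
  ultimately show ?case by (simp add: n)
qed simp

text \<open>Position by position, the label of the vertex that carries the half-edge in
  \<open>tour_word\<close>.\<close>

primrec labels_met :: "'a ltree \<Rightarrow> 'a list" where
  "labels_met (Single s) = []"
| "labels_met (Graft t c p) = labels_met p @ root_label p # labels_met c @ [root_label c]"

text \<open>The root of \<open>p\<close> receives further tails by later graftings, so its final
  list \<open>ts\<close> is only required to contain those of the subtree.\<close>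

lemma tour_word_labels:
  assumes "set (inner f t) \<subseteq> N" "(root_label t, ts, h) \<in> N" "set (root_tails t) \<subseteq> set ts"
  shows "list_all2 (\<lambda>d s. \<exists>ts h. (s, ts, h) \<in> N \<and> d \<in> set (ts @ [h])) (tour_word f t) (labels_met t)"
  using assms
proof (induction t arbitrary: ts h)
  case (Graft t c p)
  have c: "(root_label c, root_tails c, f t) \<in> N" using Graft.prems(1) by auto
  have "list_all2 (\<lambda>d s. \<exists>ts h. (s, ts, h) \<in> N \<and> d \<in> set (ts @ [h])) (tour_word f c) (labels_met c)"
    using Graft.prems(1) by (intro Graft.IH(1)[OF _ c]) auto
  moreover have "list_all2 (\<lambda>d s. \<exists>ts h. (s, ts, h) \<in> N \<and> d \<in> set (ts @ [h])) (tour_word f p) (labels_met p)"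
    using Graft.prems by (intro Graft.IH(2)[of ts h]) auto
  moreover have "\<exists>ts h. (root_label p, ts, h) \<in> N \<and> t \<in> set (ts @ [h])"
    using Graft.prems(2,3) by (intro exI[of _ ts] exI[of _ h]) auto
  moreover have "\<exists>ts h. (root_label c, ts, h) \<in> N \<and> f t \<in> set (ts @ [h])"
    using c by (intro exI[of _ "root_tails c"] exI[of _ "f t"]) auto
  ultimately show ?case by (auto intro!: list_all2_appendI)
qed simp

text \<open>The elements of \<open>ps\<close> occur for the first time in \<open>Z\<close> in the order of \<open>ps\<close>.\<close>

definition prefixwise :: "'a list \<Rightarrow> 'a list \<Rightarrow> bool" where
  "prefixwise Z ps \<longleftrightarrow> (\<forall>n. \<exists>k. set (take n Z) = set (take k ps)) \<and> set Z = set ps"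

lemma prefixwise_append:
  assumes "prefixwise Y ps" "prefixwise Z qs"
  shows "prefixwise (Y @ Z) (ps @ qs)"
  unfolding prefixwise_def
proof (intro conjI allI)
  fix n
  show "\<exists>k. set (take n (Y @ Z)) = set (take k (ps @ qs))"
  proof (cases "n \<le> length Y")
    case True
    obtain k where k: "set (take n Y) = set (take k ps)" using assms(1) unfolding prefixwise_def by blast
    have "set (take (min k (length ps)) (ps @ qs)) = set (take n (Y @ Z))"
      using True k by (simp add: min_def)
    then show ?thesis by metis
  next
    case False
    obtain k where k: "set (take (n - length Y) Z) = set (take k qs)" using assms(2) unfolding prefixwise_def by blast
    have "set (take (length ps + k) (ps @ qs)) = set (take n (Y @ Z))"
      using False k assms(1) by (simp add: prefixwise_def)
    then show ?thesis by metis
  qed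
qed (use assms in \<open>simp add: prefixwise_def\<close>)

lemma prefixwise_snoc:
  assumes "prefixwise Z ps" "x \<in> set ps"
  shows "prefixwise (Z @ [x]) ps"
  unfolding prefixwise_def
proof (intro conjI allI)
  fix n
  show "\<exists>k. set (take n (Z @ [x])) = set (take k ps)"
  proof (cases "n \<le> length Z")
    case True
    then show ?thesis using assms(1) by (simp add: prefixwise_def)
  next
    case False
    then have "set (take n (Z @ [x])) = set (take (length ps) ps)"
      using assms by (auto simp: prefixwise_def)
    then show ?thesis by blast
  qed
qed (use assms in \<open>auto simp: prefixwise_def\<close>)

text \<open>A single vertex meets no half-edge below itself, so its label has to be appended to
  appear at all. For a grafted child the appended label is the visit of its head, and the induction
  closes up.\<close>

lemma prefixwise_labels_met: "prefixwise (labels_met t @ [root_label t]) (preorder_labels t)"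
proof (induction t)
  case (Single s)
  have "\<exists>k. set (take n [s]) = set (take k [s])" for n by blast
  then show ?case by (simp add: prefixwise_def)
next
  case (Graft t c p)
  have "root_label p \<in> set (preorder_labels p)" by (induction p) auto
  then show ?case
    using prefixwise_snoc[OF prefixwise_append[OF Graft.IH(2,1)], of "root_label p"] by simp
qed

lemma prefixwise_tour: "prefixwise (root_label t # labels_met t) (preorder_labels t)"
proof -
  have p: "prefixwise (labels_met t @ [root_label t]) (preorder_labels t)" by (rule prefixwise_labels_met)
  have hd: "preorder_labels t = root_label t # tl (preorder_labels t)" using preorder_inner[of t id] by simp
  show ?thesis
    unfolding prefixwise_def
  proof (intro conjI allI)
    show "set (root_label t # labels_met t) = set (preorder_labels t)" using p by (auto simp: prefixwise_def)
    fix n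
    show "\<exists>k. set (take n (root_label t # labels_met t)) = set (take k (preorder_labels t))"
    proof (cases n)
      case 0
      then show ?thesis by (intro exI[of _ 0]) simp
    next
      case (Suc m)
      obtain k where "set (take (min m (length (labels_met t))) (labels_met t @ [root_label t])) = set (take k (preorder_labels t))"
        using p unfolding prefixwise_def by blast
      then have k: "set (take m (labels_met t)) = set (take k (preorder_labels t))" by (simp add: min_def split: if_splits)
      \<comment> \<open>With the root label moved to the front, every nonempty prefix contains the
        first element of the preorder; hence \<open>max 1 k\<close>.\<close>
      have "set (take n (root_label t # labels_met t)) = set (take (max 1 k) (preorder_labels t))"
      proof (cases k)
        case 0
        then have "take m (labels_met t) = []" using k by simp
        moreover have "set (take 1 (preorder_labels t)) = {root_label t}" by (subst hd) simp
        ultimately have "set (take n (root_label t # labels_met t)) = set (take 1 (preorder_labels t))"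
          by (simp add: \<open>n = Suc m\<close> del: take_eq_Nil)
        then show ?thesis using 0 by simp
      next
        case (Suc k')
        then have "root_label t \<in> set (take k (preorder_labels t))" by (subst hd) simp
        then show ?thesis using \<open>n = Suc m\<close> k Suc by auto
      qed
      then show ?thesis by blast
    qed
  qed
qed

text \<open>When \<open>ps ! j\<close> first occurs in \<open>Z\<close>, the set of elements met
  grows from the first \<open>k\<close> to the first \<open>Suc k\<close> elements of
  \<open>ps\<close>. The new element is \<open>ps ! k\<close>, so \<open>j = k\<close> by
  distinctness.\<close>

lemma card_first_occurrence:
  fixes Z ps :: "'a list"
  defines "fi \<equiv> \<lambda>s. LEAST i. i < length Z \<and> Z ! i = s"
  assumes Z: "prefixwise Z ps" "distinct ps" and j: "j < length ps"
  shows "card {s \<in> set ps. fi s \<le> fi (ps ! j)} = Suc j"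
proof -
  have fi: "fi s < length Z" "Z ! fi s = s" if "s \<in> set ps" for s
  proof -
    have "s \<in> set Z" using that Z(1) by (simp add: prefixwise_def)
    then have "\<exists>i. i < length Z \<and> Z ! i = s" unfolding in_set_conv_nth .
    from LeastI_ex[OF this] show "fi s < length Z" "Z ! fi s = s" by (auto simp: fi_def)
  qed
  have le: "fi s \<le> i" if "i < length Z" "Z ! i = s" for i s
    using that by (auto simp: fi_def intro: Least_le)
  have pk: "\<exists>k\<le>length ps. set (take n Z) = set (take k ps)" for n
  proof -
    obtain k where "set (take n Z) = set (take k ps)" using Z(1) unfolding prefixwise_def by blast
    then have "set (take n Z) = set (take (min k (length ps)) ps)" by (simp add: min_def)
    then show ?thesis by (meson min.cobounded2)
  qed
  define s i where "s = ps ! j" and "i = fi s"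
  have s: "s \<in> set ps" using j by (simp add: s_def)
  note i = fi[OF s, folded i_def]
  have nin: "s \<notin> set (take i Z)"
  proof
    assume "s \<in> set (take i Z)"
    then obtain i' where "i' < i" "Z ! i' = s" using i by (auto simp: in_set_conv_nth)
    then show False using le[of i' s] i by (simp add: i_def)
  qed
  obtain k where k: "k \<le> length ps" "set (take i Z) = set (take k ps)" using pk by blast
  obtain l where l: "l \<le> length ps" "set (take (Suc i) Z) = set (take l ps)" using pk by blast
  have ins: "set (take (Suc i) Z) = insert s (set (take i Z))" using i by (simp add: take_Suc_conv_app_nth)
  have card: "card (set (take k ps)) = k" if "k \<le> length ps" for k
    using distinct_card[OF distinct_take[OF Z(2)], of k] that by simp
  have "l = Suc k" using card[OF k(1)] card[OF l(1)] ins k l nin by simp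
  then have "insert (ps ! k) (set (take k ps)) = insert s (set (take k ps))"
    using ins k l by (simp add: take_Suc_conv_app_nth)
  then have "s = ps ! k" using nin k by blast
  then have "j = k" using j l \<open>l = Suc k\<close> Z(2) by (simp add: s_def nth_eq_iff_index_eq)
  moreover have "{s' \<in> set ps. fi s' \<le> i} = set (take (Suc i) Z)"
  proof (intro set_eqI iffI)
    fix x assume "x \<in> {s' \<in> set ps. fi s' \<le> i}"
    then have "fi x < Suc i" "fi x < length Z" "Z ! fi x = x" using fi[of x] by auto
    then show "x \<in> set (take (Suc i) Z)" by (auto simp: in_set_conv_nth intro!: exI[of _ "fi x"])
  next
    fix x assume x: "x \<in> set (take (Suc i) Z)"
    then obtain i' where "i' < length (take (Suc i) Z)" "take (Suc i) Z ! i' = x"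
      unfolding in_set_conv_nth by blast
    then have "i' \<le> i" "i' < length Z" "Z ! i' = x" by auto
    moreover have "x \<in> set ps" using x Z(1) in_set_takeD by (fastforce simp: prefixwise_def)
    ultimately show "x \<in> {s' \<in> set ps. fi s' \<le> i}" using le[of i' x] by auto
  qed
  ultimately show ?thesis using card[OF l(1)] l \<open>l = Suc k\<close> by (simp add: s_def i_def)
qed

text \<open>Along a right chain \<open>v\<close> is constant, and a chain that starts at a left son
  or the root has its top in \<open>S\<close>. Below \<open>MarkV k\<close> the chain is the
  continuation of one through \<open>k\<close>, whose top lies further up; hence the second
  claim.\<close>

lemma consistent_parts:
  fixes v :: "'a \<Rightarrow> 'b" and S :: "'a set"
  defines "Q \<equiv> \<lambda>A. \<exists>s\<in>A \<inter> S. \<forall>x\<in>A. v x = v s"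
  shows "(consistent v S MarkU t \<longrightarrow> (\<forall>A\<in>others t \<union> ({chain t} - {{}}). Q A)) \<and>
    (\<forall>k. consistent v S (MarkV k) t \<longrightarrow> (\<forall>A\<in>others t. Q A) \<and> (\<forall>x\<in>chain t. v x = v k))"
proof (induction t)
  case (LNode s l r)
  have sub: "(\<forall>A\<in>others (LNode s l r). Q A) \<and> (\<forall>x\<in>chain r. v x = v s)"
    if "consistent v S MarkU l" "consistent v S (MarkV s) r"
    using LNode.IH(1) LNode.IH(2)[THEN conjunct2, rule_format, OF that(2)] that(1)
    by (simp only: others.simps ball_Un) blast
  show ?case
  proof (intro conjI impI allI)
    assume g: "consistent v S MarkU (LNode s l r)"
    then have "s \<in> S" "consistent v S MarkU l" "consistent v S (MarkV s) r" by simp_all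
    moreover from this sub have "Q (insert s (chain r))" unfolding Q_def by blast
    ultimately show "\<forall>A\<in>others (LNode s l r) \<union> ({chain (LNode s l r)} - {{}}). Q A" using sub by auto
  next
    fix k assume g: "consistent v S (MarkV k) (LNode s l r)"
    then have g: "v s = v k" "consistent v S MarkU l" "consistent v S (MarkV s) r" by simp_all
    then show "\<forall>A\<in>others (LNode s l r). Q A" using sub by blast
    show "\<forall>x\<in>chain (LNode s l r). v x = v k" using sub g by simp
  qed
qed simp

lemma map_lbtree_simps:
  "inorder (map_lbtree f t) = map f (inorder t)" "unlabel (map_lbtree f t) = unlabel t" "chain (map_lbtree f t) = f ` chain t"
  "others (map_lbtree f t) = image f ` others t"
  by (induction t) auto

section \<open>The state of the two stacks along the tour\<close>

context tree_rooted
begin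

lemma opp_head:
  assumes "x \<in> T \<or> x \<in> B"
  shows "\<alpha> x \<in> H \<longleftrightarrow> x \<notin> H"
proof -
  have x: "x \<in> D" "\<alpha> x \<noteq> x" "x \<noteq> r" "\<alpha> x \<noteq> r" "\<alpha> (\<alpha> x) = x" using assms T_subset B_subset opp_T opp_B opp_fixed by auto
  have "x \<in> set (r # walk)" "\<alpha> x \<in> set (r # walk)" using x set_tour by simp_all
  moreover have "\<alpha> y \<in> H \<longleftrightarrow> y \<notin> H"
    if s: "r # walk = us @ y # vs @ \<alpha> y # ws" and y: "y \<noteq> r" "\<alpha> y \<noteq> r" "\<alpha> (\<alpha> y) = y" "y \<in> T \<or> y \<in> B" for us vs ws y
  proof -
    have d: "distinct (us @ y # vs @ \<alpha> y # ws)" using s distinct_tour by simp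
    have "r # walk = (us @ y # vs) @ \<alpha> y # ws" using s by simp
    from head_iff[OF this] head_iff[OF s] show ?thesis using d y T_B opp_T opp_B by auto
  qed
  ultimately show ?thesis using split_list2[of x "r # walk" "\<alpha> x"] x assms opp_T opp_B by metis
qed

text \<open>The half-edges of \<open>E\<close> still waiting for their partner, latest first: the
  expected first components on a stack.\<close>

definition opens :: "'h set \<Rightarrow> 'h list \<Rightarrow> 'h list" where
  "opens E us = filter (\<lambda>z. z \<in> E \<and> \<alpha> z \<notin> set us) (rev us)"

text \<open>Since \<open>letter r = OpB\<close>, the root is included; these half-edges are the
  labels created so far.\<close>

definition openings :: "'h list \<Rightarrow> 'h list" where
  "openings us = filter (\<lambda>d. letter d = OpA \<or> letter d = OpB) us"

lemma openings_snoc: "openings (us @ [d]) = openings us @ (if letter d = OpA \<or> letter d = OpB then [d] else [])"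
  by (simp add: openings_def)

text \<open>The second claim is where nesting enters: whatever was opened after
  \<open>\<alpha> d\<close> within \<open>E\<close> is closed before \<open>d\<close>, so
  \<open>\<alpha> d\<close> is on top.\<close>

lemma opens_snoc:
  assumes s: "r # walk = us @ d # vs" and E: "E = T \<or> E = B"
  shows "d \<in> E \<Longrightarrow> \<alpha> d \<notin> set us \<Longrightarrow> opens E (us @ [d]) = d # opens E us"
    and "d \<in> E \<Longrightarrow> \<alpha> d \<in> set us \<Longrightarrow> opens E us = \<alpha> d # opens E (us @ [d])"
    and "d \<notin> E \<Longrightarrow> opens E (us @ [d]) = opens E us"
proof -
  have E_facts: "\<alpha> z \<in> E" "\<alpha> (\<alpha> z) = z" "\<alpha> z \<noteq> z" if "z \<in> E" for z
    using that E T_subset B_subset opp_T opp_B opp_fixed[of z] by auto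
  have dist: "distinct (us @ d # vs)" using s distinct_tour by simp
  note opens_def [simp]
  show "opens E (us @ [d]) = d # opens E us" if "d \<in> E" "\<alpha> d \<notin> set us"
  proof -
    have "opens E us = filter (\<lambda>z. z \<in> E \<and> \<alpha> z \<notin> set (us @ [d])) (rev us)"
      unfolding opens_def using that E_facts by (intro filter_cong) auto
    then show ?thesis using that E_facts by simp
  qed
  show "opens E (us @ [d]) = opens E us" if "d \<notin> E"
  proof -
    have "opens E us = filter (\<lambda>z. z \<in> E \<and> \<alpha> z \<notin> set (us @ [d])) (rev us)"
      unfolding opens_def using that E_facts by (intro filter_cong) auto
    then show ?thesis using that by simp
  qed
  show "opens E us = \<alpha> d # opens E (us @ [d])" if d: "d \<in> E" "\<alpha> d \<in> set us"
  proof -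
    obtain u bs where u: "us = u @ \<alpha> d # bs" using split_list[OF d(2)] by blast
    have s': "r # walk = u @ \<alpha> d # bs @ \<alpha> (\<alpha> d) # vs" using s u E_facts(2)[OF d(1)] by simp
    have bs: "\<alpha> z \<in> set bs" if "z \<in> set bs" "z \<in> E" for z
      using nested[OF s' E E_facts(1)[OF d(1)] that(2,1)] .
    have f1: "filter (\<lambda>z. z \<in> E \<and> \<alpha> z \<notin> set us) (rev bs) = []"
      "filter (\<lambda>z. z \<in> E \<and> \<alpha> z \<notin> set (us @ [d])) (rev bs) = []"
      using bs u by (auto simp: filter_empty_conv)
    have "z \<noteq> \<alpha> d" if "z \<in> set u" for z using dist u that by auto
    then have "\<alpha> z \<noteq> d" if "z \<in> set u" "z \<in> E" for z using that E_facts(2)[of z] by metis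
    then have f2: "filter (\<lambda>z. z \<in> E \<and> \<alpha> z \<notin> set us) (rev u) =
        filter (\<lambda>z. z \<in> E \<and> \<alpha> z \<notin> set (us @ [d])) (rev u)"
      by (intro filter_cong) auto
    have "d \<notin> set us" using dist by auto
    have "rev us = rev bs @ \<alpha> d # rev u" using u by simp
    then show ?thesis using f1 f2 d E_facts[OF d(1)] \<open>d \<notin> set us\<close> by simp
  qed
qed

text \<open>A piece labelled \<open>s\<close> starts just after \<open>along s\<close>: after the
  half-edge reached at the other end when \<open>s\<close> lies in \<open>T\<close>, after
  \<open>s\<close> itself otherwise.\<close>

definition vertex_from :: "'h \<Rightarrow> 'h set" where "vertex_from s = orbit \<sigma> (along s)"

lemma vert_motion: "vertex_from s = orbit \<sigma> (c s)"
  using permutation_orbit_step[OF permutations(2)] by (simp add: vertex_from_def motion_along)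

text \<open>For a finished root, \<open>x\<close> is its head; for the current tree it is the
  half-edge met next, and for a tree suspended by a it is the tail at which the tree
  resumes.\<close>

definition ends_at :: "'h ltree \<Rightarrow> 'h \<Rightarrow> bool" where
  "ends_at t x \<longleftrightarrow> steps \<sigma> (along (root_label t)) (root_tails t) x"

primrec exploded :: "'h ltree \<Rightarrow> bool" where
  "exploded (Single s) \<longleftrightarrow> True"
| "exploded (Graft x t p) \<longleftrightarrow> exploded p \<and> exploded t \<and> x \<notin> H \<and> \<alpha> x \<in> H \<and> x \<in> D \<and> ends_at t (\<alpha> x)"

text \<open>The multiset equations keep account of everything read: a half-edge is the root, occurs
  in the tour word of some tree, or is the one at which a tree was suspended, and each opening
  labels one vertex. With empty stacks they identify the half-edges and labels of the final
  tree.\<close>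

fun invariant :: "'h list \<Rightarrow> 'h state \<Rightarrow> bool" where
  "invariant us (L, t, k, R) \<longleftrightarrow>
     exploded t \<and> ends_at t (c (last us)) \<and> vertex_from k = orbit \<sigma> (c (last us)) \<and>
     (\<forall>(i, l)\<in>set L. exploded l \<and> ends_at l i) \<and>
     (\<forall>(i, k', q)\<in>set R. exploded q \<and> ends_at q i \<and> vertex_from k' = orbit \<sigma> i) \<and>
     map fst L = opens B us \<and> map fst R = opens T us \<and>
     mset us = mset (r # tour_word \<alpha> t @ concat (map (\<lambda>(i, l). i # tour_word \<alpha> l) L) @
       concat (map (\<lambda>(i, k', q). i # tour_word \<alpha> q) R)) \<and>
     mset (openings us) =
       mset (preorder_labels t @ concat (map (\<lambda>(i, l). preorder_labels l) L) @ concat (map (\<lambda>(i, k', q). preorder_labels q) R))"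

definition start :: "'h state" where "start = ([], Single r, r, [])"

lemma root_head: "r \<in> H" "r \<notin> T" "r \<notin> B"
  using T_subset B_subset by (auto simp: delta_def)

lemma invariant_start: "invariant [r] start"
  using root_head vert_motion[of r]
  by (simp add: start_def ends_at_def letter_def opens_def openings_def) (simp add: motion_along)

text \<open>By \<open>opens_snoc\<close> a closing \<open>d\<close> finds \<open>\<alpha> d\<close>
  on top of its stack, so the tree popped belongs to the other end of the same edge and the new edge
  of the tree is an edge of the map.\<close>

lemma invariant_step:
  assumes s: "r # walk = us @ d # vs" and us: "us \<noteq> []" and invariant: "invariant us st"
  shows "enabled st (letter d) \<and> invariant (us @ [d]) (machine_step st (letter d) d) \<and>
    (letter d = OpB \<longrightarrow> vertex_from d = vertex_from (fst (snd (snd st))))"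
proof -
  obtain L t k R where st: "st = (L, t, k, R)" by (cases st)
  have "r # walk = (butlast us) @ last us # [] @ d # vs" using s us by simp
  from walk_between[OF this] have d: "c (last us) = d" by simp
  have "distinct (us @ d # vs)" using s distinct_tour by simp
  then have "d \<notin> set us" by auto
  have "d \<in> set (r # walk)" using s by simp
  moreover have "d \<noteq> r" using s us \<open>d \<notin> set us\<close> by (cases us) auto
  ultimately have dD: "d \<in> D" "d \<in> T \<or> d \<in> B" using set_tour T_B by auto
  have I: "exploded t" "ends_at t d" "vertex_from k = orbit \<sigma> d"
    "\<forall>(i, l)\<in>set L. exploded l \<and> ends_at l i" "\<forall>(i, k', q)\<in>set R. exploded q \<and> ends_at q i \<and> vertex_from k' = orbit \<sigma> i"
    "map fst L = opens B us" "map fst R = opens T us"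
    "mset us = mset (r # tour_word \<alpha> t @ concat (map (\<lambda>(i, l). i # tour_word \<alpha> l) L) @
       concat (map (\<lambda>(i, k', q). i # tour_word \<alpha> q) R))"
    "mset (openings us) =
       mset (preorder_labels t @ concat (map (\<lambda>(i, l). preorder_labels l) L) @ concat (map (\<lambda>(i, k', q). preorder_labels q) R))"
    using invariant d by (auto simp: st)
  note oT = opens_snoc[OF s, of T, simplified] and oB = opens_snoc[OF s, of B, simplified]
  have hd: "d \<in> H \<longleftrightarrow> (d \<in> T \<and> \<alpha> d \<in> set us) \<or> (d \<in> B \<and> \<alpha> d \<notin> set us)"
    using head_iff[OF s] \<open>d \<noteq> r\<close> by simp
  have oh: "\<alpha> d \<in> H \<longleftrightarrow> d \<notin> H" and dd: "\<alpha> (\<alpha> d) = d" using opp_head[OF dD(2)] dD by auto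
  have new: "ends_at (Single d) (c d)" "vertex_from d = orbit \<sigma> (c d)"
    using vert_motion by (auto simp: ends_at_def motion_along)
  have orb: "orbit \<sigma> (\<sigma> x) = orbit \<sigma> x" for x using permutation_orbit_step[OF permutations(2)] .
  show ?thesis
  proof (cases "letter d")
    case OpA
    then have "d \<in> T" "d \<notin> H" by (auto simp: letter_def split: if_splits)
    then have "d \<notin> B" "\<alpha> d \<notin> set us" using hd T_B by auto
    then show ?thesis using I new oT(1) oB(3) \<open>d \<in> T\<close> OpA by (simp add: st openings_snoc)
  next
    case OpB
    then have "d \<notin> T" "d \<in> H" by (auto simp: letter_def split: if_splits)
    then have "d \<in> B" "\<alpha> d \<notin> set us" using hd dD by auto
    moreover have "vertex_from d = orbit \<sigma> d" using \<open>d \<notin> T\<close> by (simp add: vertex_from_def along_def)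
    ultimately show ?thesis using I new oT(3) oB(1) \<open>d \<notin> T\<close> OpB by (simp add: st openings_snoc)
  next
    case ClA
    then have "d \<in> T" "d \<in> H" by (auto simp: letter_def split: if_splits)
    then have B: "d \<notin> B" "\<alpha> d \<in> set us" using hd T_B by auto
    then obtain k' q R' where R: "R = (\<alpha> d, k', q) # R'" "map fst R' = opens T (us @ [d])"
      using I(7) oT(2) \<open>d \<in> T\<close> by (cases R) auto
    have "c d = \<sigma> (\<alpha> d)" using \<open>d \<in> T\<close> by (simp add: motion_def)
    then have "ends_at (Graft (\<alpha> d) t q) (c d)" "vertex_from k' = orbit \<sigma> (c d)"
      using I(5) R orb by (auto simp: ends_at_def steps_append)
    moreover have "exploded (Graft (\<alpha> d) t q)" using I R oh dd dD \<open>d \<in> H\<close> by simp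
    ultimately show ?thesis using I R oB(3)[OF B(1)] ClA dd by (simp add: st openings_snoc)
  next
    case ClB
    then have nT: "d \<notin> T" "d \<notin> H" by (auto simp: letter_def split: if_splits)
    then have B: "d \<in> B" "\<alpha> d \<in> set us" using hd dD by auto
    then obtain l L' where L: "L = (\<alpha> d, l) # L'" "map fst L' = opens B (us @ [d])"
      using I(6) oB(2) by (cases L) auto
    have "c d = \<sigma> d" using nT by (simp add: motion_def)
    then have "ends_at (Graft d l t) (c d)" "vertex_from k = orbit \<sigma> (c d)"
      using I L orb by (auto simp: ends_at_def steps_append)
    moreover have "exploded (Graft d l t)" using I L oh nT dD by simp
    ultimately show ?thesis using I L oT(3)[OF nT(1)] ClB by (simp add: st openings_snoc)
  qed
qed

definition run :: "'h list \<Rightarrow> 'h state" where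
  "run us = foldl (\<lambda>st d. machine_step st (letter d) d) start us"

text \<open>The root and the half-edges read as a. They label the pieces with which the tour enters
  a vertex of the map for the first time.\<close>

definition vertex_tops :: "'h set" where "vertex_tops = insert r (T - H)"

lemma run_facts:
  assumes "walk = us @ vs"
  shows "invariant (r # us) (run us) \<and> lambda0 (map letter us) = forest_word (run us) \<and>
    (\<exists>s l' r'. unlabel (LNode s l' r') = lambda1 (map letter us) \<and> inorder_word MarkU (LNode s l' r') = node_word (run us) \<and>
       consistent vertex_from vertex_tops MarkU (LNode s l' r')) \<and>
    count_list (map letter us) OpA = count_list (map letter us) ClA + length (snd (snd (snd (run us)))) \<and>
    count_list (map letter us) OpB = count_list (map letter us) ClB + length (fst (run us))"
  using assms
proof (induction us arbitrary: vs rule: rev_induct)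
  case Nil
  have "unlabel (LNode r (LLeaf True) (LLeaf True)) = lambda1 [] \<and> inorder_word MarkU (LNode r (LLeaf True) (LLeaf True)) = node_word start \<and>
       consistent vertex_from vertex_tops MarkU (LNode r (LLeaf True) (LLeaf True))"
    by (simp add: lambda1_def B1_def start_def vertex_tops_def)
  then show ?case using invariant_start
    by (auto simp: run_def lambda0_def start_def simp del: invariant.simps unlabel.simps inorder_word.simps consistent.simps)
next
  case (snoc d us)
  let ?st = "run us"
  note IH = snoc.IH[of "d # vs"]
  have w: "walk = us @ d # vs" using snoc.prems by simp
  have s: "r # walk = (r # us) @ d # vs" using w by simp
  have step: "enabled ?st (letter d) \<and> invariant (r # us @ [d]) (machine_step ?st (letter d) d) \<and>
    (letter d = OpB \<longrightarrow> vertex_from d = vertex_from (fst (snd (snd ?st))))"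
    using invariant_step[OF s] IH w by simp
  have run: "run (us @ [d]) = machine_step ?st (letter d) d" by (simp add: run_def)
  have l0: "lambda0 (map letter (us @ [d])) = forest_word (run (us @ [d]))"
    using lambda0_machine_step[of ?st "letter d" d] step IH w by (simp add: run lambda0_def)
  obtain s l' r' where t: "unlabel (LNode s l' r') = lambda1 (map letter us)" "inorder_word MarkU (LNode s l' r') = node_word ?st"
    "consistent vertex_from vertex_tops MarkU (LNode s l' r')" using IH w by blast
  have top_label: "letter d = OpA \<Longrightarrow> d \<in> vertex_tops"
    by (auto simp: letter_def vertex_tops_def split: if_splits)
  have "lambda1 (map letter (us @ [d])) = lambda1_step (unlabel (LNode s l' r')) (letter d)"
    using t by (simp add: lambda1_def)
  then have l1: "\<exists>s l' r'. unlabel (LNode s l' r') = lambda1 (map letter (us @ [d])) \<and>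
      inorder_word MarkU (LNode s l' r') = node_word (run (us @ [d])) \<and> consistent vertex_from vertex_tops MarkU (LNode s l' r')"
    using lambda1_machine_step[of ?st "letter d" "LNode s l' r'" s l' r' vertex_from vertex_tops d] step t top_label
    by (simp add: run del: unlabel.simps inorder_word.simps consistent.simps)
  have "enabled ?st (letter d)" using step by blast
  then have "count_list (map letter (us @ [d])) OpA = count_list (map letter (us @ [d])) ClA + length (snd (snd (snd (run (us @ [d]))))) \<and>
    count_list (map letter (us @ [d])) OpB = count_list (map letter (us @ [d])) ClB + length (fst (run (us @ [d])))"
    using IH w unfolding run by (cases rule: enabled_cases) auto
  then show ?case using step l0 l1 run by simp
qed

end

lemma steps_last: "steps f x xs y \<Longrightarrow> f (last (x # xs)) = y"
  by (induction xs arbitrary: x) auto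

context tree_rooted
begin

lemma Xi_final:
  obtains F s l r' where
    "lambda0 (Xi M T) = [U, Tree (erase F), V]" "exploded F" "ends_at F r" "mset (r # walk) = mset (r # tour_word \<alpha> F)"
    "distinct (preorder_labels F)" "set (preorder_labels F) \<subseteq> D"
    "unlabel (LNode s l r') = lambda1 (Xi M T)" "inorder (LNode s l r') = rev (preorder_labels F)" "consistent vertex_from vertex_tops MarkU (LNode s l r')"
    "parenthesis_shuffle (Xi M T)"
proof -
  have op: "opens T (r # walk) = []" "opens B (r # walk) = []"
    using T_subset B_subset set_tour by (auto simp: opens_def filter_empty_conv simp del: set_rev)
  have last: "c (last (r # walk)) = r" using steps_last[OF walk_steps] .
  note R = run_facts[of walk "[]", OF append_Nil2[symmetric]]
  obtain L F k R where run: "run walk = (L, F, k, R)" by (cases "run walk")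
  have I: "invariant (r # walk) (L, F, k, R)" using R run by simp
  then have LR: "L = []" "R = []" using op by simp_all
  have F: "exploded F" "ends_at F r" "mset (r # walk) = mset (r # tour_word \<alpha> F)" "mset (openings (r # walk)) = mset (preorder_labels F)"
    using I LR last by simp_all
  obtain s l r' where t: "unlabel (LNode s l r') = lambda1 (Xi M T)" "inorder_word MarkU (LNode s l r') = node_word (run walk)"
    "consistent vertex_from vertex_tops MarkU (LNode s l r')"
    using R unfolding Xi_eq by blast
  have "inorder (LNode s l r') = nodes_of (inorder_word MarkU (LNode s l r'))" by (rule nodes_of_inorder_word[symmetric]) simp
  also have "\<dots> = rev (preorder_labels F)" unfolding t(2) run LR by simp
  finally have i: "inorder (LNode s l r') = rev (preorder_labels F)" .
  have "distinct (openings (r # walk))" using distinct_tour by (simp add: openings_def)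
  then have d: "distinct (preorder_labels F)" using F(4) mset_eq_imp_distinct_iff by blast
  have "set (preorder_labels F) = set (openings (r # walk))" using F(4) by (metis mset_eq_setD)
  also have "\<dots> \<subseteq> D" using set_tour by (auto simp: openings_def)
  finally have sub: "set (preorder_labels F) \<subseteq> D" .
  have "prefix_shuffle (Xi M T)"
    unfolding prefix_shuffle_def
  proof (intro allI impI)
    fix u v assume "Xi M T = u @ v"
    then obtain us vs where "walk = us @ vs" "u = map letter us" unfolding Xi_eq map_eq_append_conv by blast
    then show "count_list u ClA \<le> count_list u OpA \<and> count_list u ClB \<le> count_list u OpB"
      using run_facts[of us vs] by simp
  qed
  then have "parenthesis_shuffle (Xi M T)"
    using R run LR by (simp add: parenthesis_shuffle_def Xi_eq)
  moreover have "lambda0 (Xi M T) = [U, Tree (erase F), V]" using R run LR by (simp add: Xi_eq)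
  ultimately show ?thesis using that F t i d sub by blast
qed

section \<open>The explosion is the tree of the final state\<close>

lemma inner_facts:
  "exploded t \<Longrightarrow> set (root_tails t) \<inter> H = {} \<and>
    (\<forall>(s, ts, h)\<in>set (inner \<alpha> t). steps \<sigma> (along s) ts h \<and> h \<in> H \<and> set ts \<inter> H = {})"
  by (induction t) (auto simp: ends_at_def)

lemma head_met_steps:
  assumes "steps \<sigma> x xs h" "x \<notin> H" "set xs \<inter> H = {}" "h \<in> H"
  shows "head_met M H x = h"
proof -
  have p: "(\<sigma> ^^ Suc i) x = (xs @ [h]) ! i" if "i \<le> length xs" for i using steps_funpow[OF assms(1) that] .
  have "(LEAST n. (\<sigma> ^^ n) x \<in> H) = Suc (length xs)"
  proof (rule Least_equality)
    show "(\<sigma> ^^ Suc (length xs)) x \<in> H" using p[of "length xs"] assms(4) by (simp add: nth_append)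
    fix n assume n: "(\<sigma> ^^ n) x \<in> H"
    show "Suc (length xs) \<le> n"
    proof (rule ccontr)
      assume "\<not> ?thesis"
      then have "n = 0 \<or> (\<exists>i. n = Suc i \<and> i < length xs)" by (cases n) auto
      then show False
      proof
        assume "\<exists>i. n = Suc i \<and> i < length xs"
        then obtain i where i: "n = Suc i" "i < length xs" by blast
        then have "xs ! i \<in> H" using p[of i] n by (simp add: nth_append)
        then show False using assms(3) i by (auto dest: nth_mem)
      qed (use n assms in simp)
    qed
  qed
  then show ?thesis using p[of "length xs"] by (simp add: head_met_def nth_append)
qed

lemma head_met_head: "h \<in> H \<Longrightarrow> head_met M H h = h"
  by (simp add: head_met_def Least_eq_0)

text \<open>\<open>opp\<close> exchanges heads and tails within \<open>T\<close>, so there are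
  \<open>1 + card T / 2\<close> tops, which is the number of vertices by
  \<open>card_vertices\<close>.\<close>

lemma card_vertex_tops: "card vertex_tops = card (vertices M)" "finite vertex_tops"
proof -
  have f: "finite T" using finite_D T_subset finite_subset by blast
  have "bij_betw \<alpha> (T - H) (T \<inter> H)"
    using opp_head opp_T T_subset by (intro bij_betw_byWitness[where f' = \<alpha>]) auto
  then have "card (T - H) = card (T \<inter> H)" by (rule bij_betw_same_card)
  moreover have "card T = card (T \<inter> H) + card (T - H)" using f by (rule card_Int_Diff)
  moreover have "card vertex_tops = Suc (card (T - H))"
    using f root_head by (simp add: vertex_tops_def)
  ultimately show "card vertex_tops = card (vertices M)" using card_vertices by simp
  show "finite vertex_tops" using f by (simp add: vertex_tops_def)
qed

context
  fixes F :: "'h ltree"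
  assumes F: "exploded F" "ends_at F r" and w: "mset (r # walk) = mset (r # tour_word \<alpha> F)"
    and labels: "distinct (preorder_labels F)" "set (preorder_labels F) \<subseteq> D"
begin

abbreviation "N \<equiv> set (nodes \<alpha> r F)"

lemma tour_word_facts: "distinct (r # tour_word \<alpha> F)" "set (r # tour_word \<alpha> F) = D"
  using mset_eq_imp_distinct_iff[OF w] mset_eq_setD[OF w] distinct_tour set_tour by auto

lemma tour_word_in_D: "z \<in> set (tour_word \<alpha> F) \<Longrightarrow> z \<in> D"
  unfolding tour_word_facts(2)[symmetric] by simp

lemma node_facts:
  assumes "(s, ts, h) \<in> N"
  shows "steps \<sigma> (along s) ts h" "h \<in> H" "set ts \<inter> H = {}" "distinct (ts @ [h])" "set (ts @ [h]) \<subseteq> D" "s \<in> set (preorder_labels F)"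
proof -
  show "steps \<sigma> (along s) ts h" "h \<in> H" "set ts \<inter> H = {}"
    using assms inner_facts[OF F(1)] F(2) root_head by (auto simp: nodes_def ends_at_def)
  have m: "mset (concat (map (\<lambda>(s, ts, h). ts @ [h]) (nodes \<alpha> r F))) = mset (r # tour_word \<alpha> F)"
    by (rule mset_nodes)
  have "distinct (concat (map (\<lambda>(s, ts, h). ts @ [h]) (nodes \<alpha> r F)))"
    using mset_eq_imp_distinct_iff[OF m] tour_word_facts by blast
  moreover have mem: "ts @ [h] \<in> set (map (\<lambda>(s, ts, h). ts @ [h]) (nodes \<alpha> r F))"
    using imageI[OF assms, of "\<lambda>(s, ts, h). ts @ [h]"] by simp
  ultimately show "distinct (ts @ [h])" unfolding distinct_concat_iff by blast
  have "set (concat (map (\<lambda>(s, ts, h). ts @ [h]) (nodes \<alpha> r F))) = D"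
    using mset_eq_setD[OF m] tour_word_facts by blast
  then show "set (ts @ [h]) \<subseteq> D" using mem unfolding set_concat by blast
  show "s \<in> set (preorder_labels F)" using assms fst_nodes[of \<alpha> r F] by (metis fst_conv image_eqI set_map)
qed

lemma node_cover:
  assumes "d \<in> D"
  obtains s ts h where "(s, ts, h) \<in> N" "d \<in> set (ts @ [h])"
proof -
  have m: "mset (concat (map (\<lambda>(s, ts, h). ts @ [h]) (nodes \<alpha> r F))) = mset (r # tour_word \<alpha> F)"
    by (rule mset_nodes)
  have "d \<in> set (concat (map (\<lambda>(s, ts, h). ts @ [h]) (nodes \<alpha> r F)))"
    using mset_eq_setD[OF m] tour_word_facts assms by blast
  then show ?thesis using that by auto
qed

lemma node_unique:
  assumes "(s, ts, h) \<in> N" "(s', ts', h') \<in> N" "d \<in> set (ts @ [h])" "d \<in> set (ts' @ [h'])"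
  shows "(s, ts, h) = (s', ts', h')"
proof -
  let ?l = "\<lambda>(s, ts, h). ts @ [h]" and ?n = "nodes \<alpha> r F"
  have m: "mset (concat (map ?l ?n)) = mset (r # tour_word \<alpha> F)" by (rule mset_nodes)
  have dc: "distinct (concat (map ?l ?n))"
    using mset_eq_imp_distinct_iff[OF m] tour_word_facts by blast
  have "[] \<notin> set (map ?l ?n)" by auto
  then have "distinct (map ?l ?n)" using dc by (simp add: distinct_concat_iff)
  then have inj: "inj_on ?l N" by (simp add: distinct_map)
  have mem: "ts @ [h] \<in> set (map ?l ?n)" "ts' @ [h'] \<in> set (map ?l ?n)"
    using imageI[OF assms(1), of ?l] imageI[OF assms(2), of ?l] by simp_all
  have "ts @ [h] = ts' @ [h']"
    using dc mem assms(3,4) unfolding distinct_concat_iff by blast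
  then show ?thesis using inj_onD[OF inj, of "(s, ts, h)" "(s', ts', h')"] assms(1,2) by simp
qed

lemma label_unique:
  assumes "(s, ts, h) \<in> N" "(s, ts', h') \<in> N"
  shows "(s, ts, h) = (s, ts', h')"
proof -
  have "inj_on fst N" using labels(1) fst_nodes[of \<alpha> r F] by (metis distinct_map)
  from inj_onD[OF this _ assms] show ?thesis by simp
qed

lemma head_met_node:
  assumes n: "(s, ts, h) \<in> N" and d: "d \<in> set (ts @ [h])"
  shows "head_met M H d = h"
proof (cases "d = h")
  case True
  then show ?thesis using head_met_head node_facts(2)[OF n] by simp
next
  case False
  then obtain us vs where ts: "ts = us @ d # vs" using d by (auto dest: split_list)
  then have "steps \<sigma> d vs h" using node_facts(1)[OF n] by (simp add: steps_append)
  then show ?thesis using node_facts(2,3)[OF n] ts by (intro head_met_steps) auto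
qed

lemma head_class:
  assumes n: "(s, ts, h) \<in> N"
  shows "{k \<in> D. head_met M H k = h} = set (ts @ [h])"
proof
  show "set (ts @ [h]) \<subseteq> {k \<in> D. head_met M H k = h}"
    using head_met_node[OF n] node_facts(5)[OF n] by blast
  show "{k \<in> D. head_met M H k = h} \<subseteq> set (ts @ [h])"
  proof
    fix k assume k: "k \<in> {k \<in> D. head_met M H k = h}"
    then obtain s' ts' h' where n': "(s', ts', h') \<in> N" "k \<in> set (ts' @ [h'])" using node_cover by blast
    then have "h' = h" using head_met_node k by auto
    then have "(s, ts, h) = (s', ts', h')" using node_unique[OF n n'(1), of h] by simp
    then show "k \<in> set (ts @ [h])" using n' by simp
  qed
qed

abbreviation "\<rho> \<equiv> rot (phi0 M H)"

lemma rho: "d \<in> D \<Longrightarrow> \<rho> d = induced {k \<in> D. head_met M H k = head_met M H d} \<sigma> d"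
  by (simp add: phi0_def)

text \<open>From a tail the induced rotation is \<open>\<sigma>\<close> itself. From the head it
  would have to run through the other pieces of the vertex; instead, the induced map is a bijection
  of the piece, and the first tail is the image of no tail, so it is the image of the head.\<close>

lemma node_cycle:
  assumes n: "(s, ts, h) \<in> N"
  shows "steps \<rho> h ts h"
proof -
  define A where "A = set (ts @ [h])"
  define I where "I = induced A \<sigma>"
  have \<rho>: "\<rho> d = I d" if "d \<in> A" for d
  proof -
    have "d \<in> D" using that node_facts(5)[OF n] by (auto simp: A_def)
    then show ?thesis
      using rho[of d] head_class[OF n] head_met_node[OF n, of d] that by (simp add: I_def A_def)
  qed
  have I: "I ` A \<subseteq> A" "inj_on I A" using induced_inj_on[OF permutations(2), of A] by (simp_all add: I_def)
  have "finite A" by (simp add: A_def)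
  then have surj: "I ` A = A" using I by (simp add: endo_inj_surj)
  have st: "steps \<sigma> (along s) ts h" using node_facts(1)[OF n] .
  have tail: "I z = \<sigma> z" if z: "z \<in> set ts" for z
  proof -
    obtain us vs where ts: "ts = us @ z # vs" using split_list[OF z] by blast
    then have "steps \<sigma> z vs h" using st by (simp add: steps_append)
    then have "\<sigma> z \<in> A" by (cases vs) (auto simp: A_def ts)
    then show ?thesis using induced_steps[of \<sigma> z "[]" "\<sigma> z" A] z by (simp add: I_def A_def)
  qed
  have "steps I h ts h"
  proof (cases ts)
    case Nil
    then show ?thesis using I(1) by (simp add: A_def)
  next
    case (Cons t ts')
    then have "steps \<sigma> t ts' h" using st by simp
    then have st': "steps I t ts' h" by (rule steps_cong) (use tail Cons in auto)
    have t: "t \<in> A" "t \<notin> set ts'" "t \<noteq> h" using Cons node_facts(4)[OF n] by (auto simp: A_def)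
    then have "t \<in> I ` A" using surj by simp
    then obtain y where y: "y \<in> A" "I y = t" by (metis imageE)
    have "y \<notin> set ts"
    proof
      assume "y \<in> set ts"
      then have "I y \<in> insert h (set ts')" using steps_closed[OF st', of y] Cons by simp
      then show False using y t by auto
    qed
    then have "y = h" using y by (simp add: A_def)
    then show ?thesis using y st' Cons by simp
  qed
  then show ?thesis by (rule steps_cong) (use \<rho> in \<open>auto simp: A_def\<close>)
qed

lemma steps_tour_word:
  assumes "steps \<rho> h (root_tails t) y" "\<alpha> x = h" "\<And>s ts h. (s, ts, h) \<in> set (inner \<alpha> t) \<Longrightarrow> steps \<rho> h ts h"
    and "\<And>z. z \<in> set (tour_word \<alpha> t) \<Longrightarrow> \<alpha> (\<alpha> z) = z"
  shows "steps (\<lambda>z. \<rho> (\<alpha> z)) x (tour_word \<alpha> t) y"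
  using assms
proof (induction t arbitrary: x y h)
  case (Graft z t p)
  have 1: "steps \<rho> h (root_tails p) z" "\<rho> z = y" using Graft.prems(1) by (auto simp: steps_append)
  have "steps (\<lambda>z. \<rho> (\<alpha> z)) x (tour_word \<alpha> p) z"
    using Graft.prems by (intro Graft.IH(2)[OF 1(1)]) auto
  moreover have "steps (\<lambda>z. \<rho> (\<alpha> z)) z (tour_word \<alpha> t) (\<alpha> z)"
  proof (rule Graft.IH(1))
    show "steps \<rho> (\<alpha> z) (root_tails t) (\<alpha> z)" by (rule Graft.prems(3)[of "root_label t"]) simp
  qed (use Graft.prems in auto)
  moreover have "\<rho> (\<alpha> (\<alpha> z)) = y" using 1 Graft.prems(4) by simp
  ultimately show ?case by (simp add: steps_append)
qed simp

lemma phi0_simps [simp]: "darts (phi0 M H) = D" "opp (phi0 M H) = \<alpha>" "root (phi0 M H) = r"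
  "edge_darts (phi0 M H) = edge_darts M"
  by (simp_all add: phi0_def edge_darts_def)

lemma phi0_tour: "steps (motion (phi0 M H) (edge_darts M)) r (tour_word \<alpha> F) r"
proof -
  have "(root_label F, root_tails F, r) \<in> N" by (simp add: nodes_def)
  then have "steps \<rho> r (root_tails F) r" by (rule node_cycle)
  then have "steps (\<lambda>z. \<rho> (\<alpha> z)) r (tour_word \<alpha> F) r"
  proof (rule steps_tour_word)
    show "steps \<rho> h ts h" if "(s, ts, h) \<in> set (inner \<alpha> F)" for s ts h
      by (rule node_cycle[of s]) (use that in \<open>simp add: nodes_def\<close>)
    show "\<alpha> (\<alpha> z) = z" if "z \<in> set (tour_word \<alpha> F)" for z
      using tour_word_in_D[OF that] by simp
  qed simp
  then show ?thesis
    by (rule steps_cong) (use tour_word_facts root_D in \<open>auto simp: motion_def edge_darts_def\<close>)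
qed

lemma phi0_iso: "rmap_iso (phi0 M H) (tree_map (erase F))"
proof -
  define g where "g d = (case d of Son q \<Rightarrow> head_at \<alpha> F r q | Father q \<Rightarrow> \<alpha> (head_at \<alpha> F r q))" for d
  have g: "map g (tree_tour (erase F) []) = tour_word \<alpha> F"
    by (rule map_tree_tour_erase[where h = r]) (use tour_word_in_D in \<open>auto simp: g_def\<close>)
  have root: "g (Son []) = r" by (simp add: g_def)
  have dm: "darts (tree_map (erase F)) = tree_darts (erase F)" by (simp add: tree_map_def)
  have "g ` tree_darts (erase F) = D"
    using g root tour_word_facts(2) tree_map_tour(2)[of "erase F", unfolded dm] by (metis image_insert list.simps(15) set_map)
  then have gD: "g d \<in> D" if "d \<in> tree_darts (erase F)" for d using that by blast
  show ?thesis
  proof (rule rmap_iso_tourI[where ys = "tree_tour (erase F) []" and xs = "tour_word \<alpha> F" and g = g])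
    fix d assume "d \<in> darts (tree_map (erase F))"
    then have d: "d \<in> tree_darts (erase F)" unfolding dm .
    have nF: "d \<noteq> Father []" using d by (auto simp: tree_darts_def)
    have "g (tree_opp d) = \<alpha> (g d)"
    proof (cases d)
      case (Son q)
      then show ?thesis using root by (simp add: tree_opp_def g_def)
    next
      case (Father q)
      then have "Son q \<in> tree_darts (erase F)" using d by (auto simp: tree_darts_def)
      then have "head_at \<alpha> F r q \<in> D" using gD[of "Son q"] by (simp add: g_def)
      then show ?thesis using Father by (simp add: tree_opp_def g_def)
    qed
    then show "g (opp (tree_map (erase F)) d) = opp (phi0 M H) (g d) \<and>
        opp (tree_map (erase F)) d \<in> darts (tree_map (erase F)) \<and>
        opp (tree_map (erase F)) (opp (tree_map (erase F)) d) = d"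
      using d tree_opp_in[OF d] tree_opp_opp[OF nF] by (simp add: tree_map_def)
  qed (use tree_map_tour[of "erase F"] phi0_tour tour_word_facts g root root_in_tree_darts[of "erase F"]
      in \<open>auto simp: tree_map_def tree_opp_def\<close>)
qed

section \<open>Ranks and classes of the exploded vertices\<close>

definition cell :: "'h \<Rightarrow> 'h set" where
  "cell s = {d. \<exists>ts h. (s, ts, h) \<in> N \<and> d \<in> set (ts @ [h])}"

lemma cell_node:
  assumes "(s, ts, h) \<in> N"
  shows "cell s = set (ts @ [h])"
proof -
  have "ts' = ts \<and> h' = h" if "(s, ts', h') \<in> N" for ts' h' using label_unique[OF assms that] by simp
  then show ?thesis using assms unfolding cell_def by blast
qed

lemma cellE:
  assumes "s \<in> set (preorder_labels F)"
  obtains ts h where "(s, ts, h) \<in> N" "cell s = set (ts @ [h])"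
proof -
  have "s \<in> fst ` N" using assms fst_nodes[of \<alpha> r F] by (metis set_map)
  then obtain ts h where "(s, ts, h) \<in> N" by auto
  then show ?thesis using that cell_node by blast
qed

lemma cell_unique:
  assumes "s \<in> set (preorder_labels F)" "s' \<in> set (preorder_labels F)" "d \<in> cell s" "d \<in> cell s'"
  shows "s = s'"
  using assms by (metis cellE node_unique prod.inject)

lemma cell_orbit:
  assumes "s \<in> set (preorder_labels F)" "d \<in> cell s"
  shows "orbit \<rho> d = cell s"
proof -
  obtain ts h where n: "(s, ts, h) \<in> N" "cell s = set (ts @ [h])" using cellE[OF assms(1)] .
  have "d \<in> set (h # ts)" using assms n by auto
  then obtain us vs where "h # ts = us @ d # vs" using split_list by fast
  from steps_orbit[OF steps_rotate[OF node_cycle[OF n(1)] this]] this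
  have "orbit \<rho> d = set (h # ts)" by auto
  then show ?thesis using n by auto
qed

lemma vertices_phi0: "vertices (phi0 M H) = cell ` set (preorder_labels F)"
proof -
  have "orbit \<rho> d \<in> cell ` set (preorder_labels F)" if d: "d \<in> D" for d
  proof -
    obtain s ts h where n: "(s, ts, h) \<in> N" "d \<in> set (ts @ [h])" using node_cover[OF d] .
    then have "s \<in> set (preorder_labels F)" "d \<in> cell s" using node_facts(6) cell_node by auto
    then show ?thesis using cell_orbit by blast
  qed
  moreover have "cell s \<in> orbit \<rho> ` D" if s: "s \<in> set (preorder_labels F)" for s
  proof -
    obtain ts h where n: "(s, ts, h) \<in> N" "cell s = set (ts @ [h])" using cellE[OF s] .
    then have "h \<in> D" "h \<in> cell s" using node_facts(5)[OF n(1)] by auto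
    then show ?thesis using cell_orbit[OF s] by blast
  qed
  ultimately show ?thesis by (auto simp: vertices_def)
qed

lemma cell_vert:
  assumes "s \<in> set (preorder_labels F)"
  shows "cell s \<subseteq> vertex_from s" "cell s \<noteq> {}"
proof -
  obtain ts h where n: "(s, ts, h) \<in> N" "cell s = set (ts @ [h])" using cellE[OF assms] .
  show "cell s \<noteq> {}" using n by simp
  show "cell s \<subseteq> vertex_from s"
    using steps_subset_orbit[OF node_facts(1)[OF n(1)]] n(2) by (auto simp: vertex_from_def)
qed

lemma vertices_vert: "vertices M = vertex_from ` set (preorder_labels F)"
proof -
  have "orbit \<sigma> d \<in> vertex_from ` set (preorder_labels F)" if d: "d \<in> D" for d
  proof -
    obtain s ts h where n: "(s, ts, h) \<in> N" "d \<in> set (ts @ [h])" using node_cover[OF d] .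
    then have s: "s \<in> set (preorder_labels F)" "d \<in> vertex_from s" using node_facts(6) cell_node cell_vert by blast+
    then have "orbit \<sigma> d = vertex_from s" using orbit_eq_permutation[OF permutations(2)] by (simp add: vertex_from_def)
    then show ?thesis using s by blast
  qed
  moreover have "vertex_from s \<in> orbit \<sigma> ` D" if "s \<in> set (preorder_labels F)" for s
    using that labels(2) by (auto simp: vertex_from_def along_def)
  ultimately show ?thesis by (auto simp: vertices_def)
qed

lemma cell_subset_iff:
  assumes "s \<in> set (preorder_labels F)" "Y \<in> vertices M"
  shows "cell s \<subseteq> Y \<longleftrightarrow> vertex_from s = Y"
proof
  assume sub: "cell s \<subseteq> Y"
  obtain d where d: "d \<in> cell s" using cell_vert[OF assms(1)] by blast
  obtain y where y: "Y = orbit \<sigma> y" using assms(2) by (auto simp: vertices_def)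
  have "d \<in> orbit \<sigma> y" "d \<in> orbit \<sigma> (along s)" using d sub y cell_vert[OF assms(1)] by (auto simp: vertex_from_def)
  then show "vertex_from s = Y" using y orbit_eq_permutation[OF permutations(2)] by (metis vertex_from_def)
qed (use cell_vert assms in auto)

lemma first_visit_cell:
  assumes "s \<in> set (preorder_labels F)"
  shows "first_visit (phi0 M H) (cell s) =
    (LEAST i. i < length (root_label F # labels_met F) \<and> (root_label F # labels_met F) ! i = s)"
proof -
  let ?W = "r # tour_word \<alpha> F" and ?Z = "root_label F # labels_met F"
  have tour: "tour (phi0 M H) (edge_darts (phi0 M H)) = ?W"
    using steps_support[OF phi0_tour] tour_word_facts(1) by (simp add: tour_def)
  have root: "(root_label F, root_tails F, r) \<in> N" by (simp add: nodes_def)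
  have "list_all2 (\<lambda>d s. \<exists>ts h. (s, ts, h) \<in> N \<and> d \<in> set (ts @ [h])) ?W ?Z"
    using tour_word_labels[OF _ root] root by (auto simp: nodes_def)
  then have rel: "list_all2 (\<lambda>d s. d \<in> cell s \<and> s \<in> set (preorder_labels F)) ?W ?Z"
    by (rule list_all2_mono) (metis cell_node node_facts(6))
  note len = list_all2_lengthD[OF rel]
  have nth: "?W ! i \<in> cell (?Z ! i) \<and> ?Z ! i \<in> set (preorder_labels F)" if "i < length ?W" for i
    using list_all2_nthD[OF rel that] .
  have "i < length ?W \<and> ?W ! i \<in> cell s \<longleftrightarrow> i < length ?Z \<and> ?Z ! i = s" for i
    using nth[of i] len cell_unique[OF assms] by metis
  then show ?thesis unfolding first_visit_def tour by simp
qed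

lemma vertex_rank_cell:
  assumes "j < length (preorder_labels F)"
  shows "vertex_rank (phi0 M H) (cell (preorder_labels F ! j)) = Suc j"
proof -
  let ?fi = "\<lambda>s. LEAST i. i < length (root_label F # labels_met F) \<and> (root_label F # labels_met F) ! i = s"
  let ?s = "preorder_labels F ! j"
  have s: "?s \<in> set (preorder_labels F)" using assms by simp
  have "{u \<in> vertices (phi0 M H). first_visit (phi0 M H) u \<le> first_visit (phi0 M H) (cell ?s)} =
      cell ` {s \<in> set (preorder_labels F). ?fi s \<le> ?fi ?s}"
    unfolding vertices_phi0 using first_visit_cell s by auto
  moreover have "inj_on cell (set (preorder_labels F))"
    using cell_unique cell_vert(2) by (intro inj_onI) blast
  then have "inj_on cell {s \<in> set (preorder_labels F). ?fi s \<le> ?fi ?s}" by (rule inj_on_subset) auto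
  ultimately show ?thesis
    unfolding vertex_rank_def
    using card_first_occurrence[OF prefixwise_tour labels(1) assms] by (simp add: card_image)
qed

lemma phi1_eq:
  defines "rk \<equiv> \<lambda>s. vertex_rank (phi0 M H) (cell s)"
  shows "phi1 M H = (\<lambda>Y. rk ` {s \<in> set (preorder_labels F). vertex_from s = Y}) ` vertex_from ` set (preorder_labels F)"
proof -
  have "{u \<in> vertices (phi0 M H). u \<subseteq> Y} = cell ` {s \<in> set (preorder_labels F). vertex_from s = Y}" if "Y \<in> vertices M" for Y
    unfolding vertices_phi0 using cell_subset_iff[OF _ that] by auto
  then have "phi1 M H = (\<lambda>Y. rk ` {s \<in> set (preorder_labels F). vertex_from s = Y}) ` vertices M"
    unfolding phi1_def rk_def by (intro image_cong) (auto simp: image_image)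
  then show ?thesis unfolding vertices_vert .
qed

lemma parts_classes:
  assumes t: "t = LNode s l r'" "inorder t = rev (preorder_labels F)" "consistent vertex_from vertex_tops MarkU t"
  shows "insert (chain t) (others t) = (\<lambda>Y. {s \<in> set (preorder_labels F). vertex_from s = Y}) ` vertex_from ` set (preorder_labels F)"
proof -
  let ?P = "insert (chain t) (others t)"
  have part: "partition_on (set (preorder_labels F)) ?P"
  proof -
    have "distinct (inorder t)" "set (inorder t) = set (preorder_labels F)" unfolding t(2) using labels(1) by simp_all
    then show ?thesis using partition_parts[OF _ t(1)] by simp
  qed
  have top_label: "\<exists>s\<in>A \<inter> vertex_tops. \<forall>x\<in>A. vertex_from x = vertex_from s" if "A \<in> ?P" for A
  proof -
    have "A \<in> others t \<union> ({chain t} - {{}})" using that t(1) by auto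
    then show ?thesis using consistent_parts[of vertex_from vertex_tops t] t(3) by blast
  qed
  have cover: "\<exists>A\<in>?P. x \<in> A" if "x \<in> set (preorder_labels F)" for x using part that by (auto simp: partition_on_def)
  have sub: "A \<subseteq> set (preorder_labels F)" if "A \<in> ?P" for A using part that by (auto simp: partition_on_def)
  have disj: "A = A'" if "A \<in> ?P" "A' \<in> ?P" "x \<in> A" "x \<in> A'" for A A' x
    using part that unfolding partition_on_def disjoint_def by blast
  \<comment> \<open>Each vertex of the map contains a part, hence a top, and there are as many tops
    as vertices. So all tops are labels of \<open>F\<close> and \<open>vertex_from\<close> is
    injective on them; two parts within one vertex would share their top.\<close>
  let ?S = "vertex_tops \<inter> set (preorder_labels F)"
  have "vertex_from x \<in> vertex_from ` ?S" if x: "x \<in> set (preorder_labels F)" for x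
  proof -
    obtain A where A: "A \<in> ?P" "x \<in> A" using cover[OF x] by blast
    obtain s where "s \<in> A" "s \<in> vertex_tops" "vertex_from x = vertex_from s" using top_label[OF A(1)] A(2) by blast
    then show ?thesis using sub[OF A(1)] by blast
  qed
  then have cov: "vertices M \<subseteq> vertex_from ` ?S" unfolding vertices_vert by blast
  then have "card (vertices M) \<le> card ?S"
    using surj_card_le[OF _ cov] card_vertex_tops(2) by simp
  then have "card vertex_tops \<le> card ?S" using card_vertex_tops(1) by simp
  then have S: "?S = vertex_tops" using card_vertex_tops(2) by (intro card_seteq) auto
  have "vertex_from ` vertex_tops = vertices M"
    using cov S vertices_vert by auto
  then have inj: "inj_on vertex_from vertex_tops"
    using card_vertex_tops by (intro eq_card_imp_inj_on) auto
  have same: "A = {y \<in> set (preorder_labels F). vertex_from y = vertex_from x}" if A: "A \<in> ?P" "x \<in> A" for A x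
  proof -
    obtain s where s: "s \<in> A" "s \<in> vertex_tops" "\<forall>x\<in>A. vertex_from x = vertex_from s" using top_label[OF A(1)] by blast
    have "y \<in> A" if y: "y \<in> set (preorder_labels F)" "vertex_from y = vertex_from x" for y
    proof -
      obtain A' where A': "A' \<in> ?P" "y \<in> A'" using cover[OF y(1)] by blast
      obtain s' where s': "s' \<in> A'" "s' \<in> vertex_tops" "\<forall>x\<in>A'. vertex_from x = vertex_from s'" using top_label[OF A'(1)] by blast
      have "vertex_from s = vertex_from s'" using s s' A A' y by metis
      then have "s = s'" using inj_onD[OF inj _ s(2) s'(2)] by blast
      then have "A = A'" using disj[OF A(1) A'(1)] s s' by blast
      then show ?thesis using A' by simp
    qed
    moreover have "vertex_from y = vertex_from x" if "y \<in> A" for y using s A that by metis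
    ultimately show ?thesis using sub[OF A(1)] by blast
  qed
  show ?thesis
  proof
    show "?P \<subseteq> (\<lambda>Y. {s \<in> set (preorder_labels F). vertex_from s = Y}) ` vertex_from ` set (preorder_labels F)"
    proof
      fix A assume A: "A \<in> ?P"
      then obtain x where x: "x \<in> A" using top_label by blast
      then show "A \<in> (\<lambda>Y. {s \<in> set (preorder_labels F). vertex_from s = Y}) ` vertex_from ` set (preorder_labels F)"
        using same[OF A x] sub[OF A] by blast
    qed
    show "(\<lambda>Y. {s \<in> set (preorder_labels F). vertex_from s = Y}) ` vertex_from ` set (preorder_labels F) \<subseteq> ?P"
    proof
      fix A assume "A \<in> (\<lambda>Y. {s \<in> set (preorder_labels F). vertex_from s = Y}) ` vertex_from ` set (preorder_labels F)"
      then obtain x where x: "x \<in> set (preorder_labels F)" "A = {s \<in> set (preorder_labels F). vertex_from s = vertex_from x}" by blast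
      then obtain A' where "A' \<in> ?P" "x \<in> A'" using cover by blast
      then show "A \<in> ?P" using same x by metis
    qed
  qed
qed

text \<open>Replacing labels by ranks keeps the unlabelled tree and turns the inorder into
  \<open>m, ..., 1\<close>, the form in which the partition of a binary tree is known.\<close>

lemma phi1_Theta:
  assumes t: "t = LNode s l r'" "inorder t = rev (preorder_labels F)" "consistent vertex_from vertex_tops MarkU t"
  shows "phi1 M H = Theta (unlabel t)"
proof -
  define rk where "rk s = vertex_rank (phi0 M H) (cell s)" for s
  define t' where "t' = map_lbtree rk t"
  have "map rk (preorder_labels F) = [1..<Suc (length (preorder_labels F))]"
    using vertex_rank_cell by (intro nth_equalityI) (auto simp: rk_def simp del: upt_Suc)
  then have "inorder t' = rev [1..<Suc (length (preorder_labels F))]"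
    using t(2) by (simp add: t'_def map_lbtree_simps flip: rev_map del: upt_Suc)
  moreover have "t' = LNode (rk s) (map_lbtree rk l) (map_lbtree rk r')" by (simp add: t'_def t(1))
  ultimately have "Theta (unlabel t') = insert (chain t') (others t')" by (rule Theta_unlabel)
  also have "\<dots> = image rk ` insert (chain t) (others t)" by (simp add: t'_def map_lbtree_simps)
  also have "\<dots> = phi1 M H" unfolding parts_classes[OF t] phi1_eq rk_def by (simp add: image_image)
  finally show ?thesis by (simp add: t'_def map_lbtree_simps)
qed

end

lemma explosion:
  "parenthesis_shuffle (Xi M T) \<and> rmap_iso (phi0 M H) (tree_map (lambda0' (Xi M T))) \<and>
    phi1 M H = Theta (lambda1' (Xi M T))"
proof -
  obtain F s l r' where F: "lambda0 (Xi M T) = [U, Tree (erase F), V]" "exploded F" "ends_at F r"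
    "mset (r # walk) = mset (r # tour_word \<alpha> F)" "distinct (preorder_labels F)" "set (preorder_labels F) \<subseteq> D"
    and t: "unlabel (LNode s l r') = lambda1 (Xi M T)" "inorder (LNode s l r') = rev (preorder_labels F)"
      "consistent vertex_from vertex_tops MarkU (LNode s l r')"
    and "parenthesis_shuffle (Xi M T)"
    using Xi_final .
  moreover have "lambda0' (Xi M T) = erase F" unfolding lambda0'_def F(1) by simp
  moreover have "rmap_iso (phi0 M H) (tree_map (erase F))" using phi0_iso[OF F(2-6)] .
  moreover have "phi1 M H = Theta (lambda1' (Xi M T))"
    unfolding lambda1'_def Theta_inactivate_all t(1)[symmetric] by (rule phi1_Theta[OF F(2-6) refl t(2,3)])
  ultimately show ?thesis by simp
qed

end

theorem theorem2:
  fixes M :: "'h rmap" and T :: "'h set" and w :: "letter list" and H :: "'h set"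
  assumes "tree_rooted_map M T"
    and "w = Xi M T"
    and "H = delta M T"
  shows "parenthesis_shuffle w \<and>
         rmap_iso (phi0 M H) (tree_map (lambda0' w)) \<and>
         phi1 M H = Theta (lambda1' w)"
proof -
  interpret tree_rooted M T using assms(1) by unfold_locales
  show ?thesis using explosion assms(2,3) by simp
qed

end
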